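(* Over $\Lambda=\mathbb{Z}[G(7,6)]$, the third syzygy of the trivial module $\mathbb{Z}$ is $\Omega_3(\mathbb{Z})=[R(2)\oplus[y-1)]$; i.e. the condition $M(7)$ holds.
   Context: Modules are right modules. $G(7,6)=\langle x,y\mid x^7=1,\ y^6=1,\ yx=x^3y\rangle$ and $\Lambda=\mathbb{Z}[G(7,6)]$. The symbol $[y-1)$ denotes the right ideal $(y-1)\Lambda$. Let $\mathcal{T}_{6}=\{(a_{i,j})\in M_{6}(\mathbb{Z})\mid a_{i,j}\in 7\mathbb{Z}\text{ if }i>j\}$. There is a surjective ring homomorphism $\tilde\lambda:\Lambda\to\mathcal{T}_{6}$, realized as follows. Let $\zeta=e^{2\pi i/7}$ and let $\sigma$ be the automorphism of $\mathbb{Z}[\zeta]$ with $\sigma(\zeta)=\zeta^3$. Let $\Lambda$ act on the right on the ideal $(\zeta-1)\mathbb{Z}[\zeta]$ by $v\cdot x=v\zeta$, $v\cdot y=\sigma^{-1}(v)$; $\tilde\lambda(a)$ is the matrix of $v\mapsto v\cdot a$ acting on row vectors with respect to the $\mathbb{Z}$-basis $(\zeta-1)^j$, $1\le j\le 6$. Then $\mathcal{T}_{6}$ is a right $\Lambda$-module via $t\cdot a=t\,\tilde\lambda(a)$, and $R(i)$ denotes its $i$-th row, i.e. $R(i)=\{(r_1,\dots,r_{6})\in\mathbb{Z}^{6}\mid r_j\in 7\mathbb{Z}\text{ for }j<i\}$; it is isomorphic to the ideal $(\zeta-1)^i\mathbb{Z}[\zeta]$ with the right $\Lambda$-action $v\cdot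 x=v\zeta$, $v\cdot y=\sigma^{-1}(v)$. In particular, $R(2)$ is characterized up to isomorphism as a $\Lambda$-lattice of $\mathbb{Z}$-rank $6$ annihilated by $1+x+\dots+x^6$ and generated over $\Lambda$ by an element $v$ with $v\cdot y=v\cdot(1+x)^2$. Finitely generated $\Lambda$-modules $M,N$ are stably equivalent if $M\oplus\Lambda^a\cong N\oplus\Lambda^b$ for some $a,b\ge 0$; the stable module $[M]$ is the class of all modules stably equivalent to $M$. The third syzygy $\Omega_3(\mathbb{Z})$ is the stable module $[J]$, where $0\to J\to F_2\to F_1\to F_0\to\mathbb{Z}\to0$ is any exact sequence of $\Lambda$-modules with each $F_i$ finitely generated free (well defined by Schanuel's lemma). Condition $M(7)$: the third syzygy of $\mathbb{Z}$ over $\mathbb{Z}[G(7,6)]$ is the stable module $[R(2)\oplus[y-1)]$. *)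

theory Defs
  imports
    "HOL-Analysis.Analysis"
    "HOL-Library.Poly_Mapping"
    "HOL-Computational_Algebra.Polynomial"
begin

section \<open>Right modules\<close>

text \<open>
  A right module over a ring type is given by a carrier inside an abelian group type together with
  an action; addition and zero are those of the ambient type, and only the values of the action on
  the carrier matter.
\<close>

record ('r, 'm) rmod =
  mcarrier :: "'m set"
  act :: "'m \<Rightarrow> 'r \<Rightarrow> 'm"

definition right_module :: "('r::ring_1, 'm::ab_group_add) rmod \<Rightarrow> bool" where
  "right_module M \<longleftrightarrow>
     0 \<in> mcarrier M \<and>
     (\<forall>u\<in>mcarrier M. \<forall>v\<in>mcarrier M. u + v \<in> mcarrier M) \<and>
     (\<forall>u\<in>mcarrier M. - u \<in> mcarrier M) \<and>
     (\<forall>u\<in>mcarrier M. \<forall>a. act M u a \<in> mcarrier M) \<and>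
     (\<forall>u\<in>mcarrier M. \<forall>v\<in>mcarrier M. \<forall>a. act M (u + v) a = act M u a + act M v a) \<and>
     (\<forall>u\<in>mcarrier M. \<forall>a b. act M u (a + b) = act M u a + act M u b) \<and>
     (\<forall>u\<in>mcarrier M. \<forall>a b. act M u (a * b) = act M (act M u a) b) \<and>
     (\<forall>u\<in>mcarrier M. act M u 1 = u)"

definition module_hom ::
  "('r::ring_1, 'm::ab_group_add) rmod \<Rightarrow> ('r, 'n::ab_group_add) rmod \<Rightarrow> ('m \<Rightarrow> 'n) \<Rightarrow> bool" where
  "module_hom M N f \<longleftrightarrow>
     f ` mcarrier M \<subseteq> mcarrier N \<and>
     (\<forall>u\<in>mcarrier M. \<forall>v\<in>mcarrier M. f (u + v) = f u + f v) \<and>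
     (\<forall>u\<in>mcarrier M. \<forall>a. f (act M u a) = act N (f u) a)"

definition module_kernel :: "('r::ring_1, 'm::ab_group_add) rmod \<Rightarrow> ('m \<Rightarrow> 'n::ab_group_add) \<Rightarrow> 'm set" where
  "module_kernel M f = {u \<in> mcarrier M. f u = 0}"

definition module_isomorphic ::
  "('r::ring_1, 'm::ab_group_add) rmod \<Rightarrow> ('r, 'n::ab_group_add) rmod \<Rightarrow> bool" where
  "module_isomorphic M N \<longleftrightarrow> (\<exists>f. module_hom M N f \<and> bij_betw f (mcarrier M) (mcarrier N))"

definition direct_sum ::
  "('r::ring_1, 'm::ab_group_add) rmod \<Rightarrow> ('r, 'n::ab_group_add) rmod \<Rightarrow> ('r, 'm \<times> 'n) rmod" where
  "direct_sum M N =
     \<lparr>mcarrier = mcarrier M \<times> mcarrier N, act = (\<lambda>(u, v) a. (act M u a, act N v a))\<rparr>"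

definition finitely_generated :: "('r::ring_1, 'm::ab_group_add) rmod \<Rightarrow> bool" where
  "finitely_generated M \<longleftrightarrow>
     (\<exists>S. finite S \<and> S \<subseteq> mcarrier M \<and> (\<forall>u\<in>mcarrier M. \<exists>c. u = (\<Sum>s\<in>S. act M s (c s))))"

text \<open>The free module of rank \<open>n\<close>, realized by the functions \<open>nat \<Rightarrow> 'r\<close> vanishing outside
  \<open>{..<n}\<close>.\<close>

definition free_module :: "nat \<Rightarrow> ('r::ring_1, nat \<Rightarrow>\<^sub>0 'r) rmod" where
  "free_module n =
     \<lparr>mcarrier = {u. Poly_Mapping.keys u \<subseteq> {..<n}}, act = (\<lambda>u a. Poly_Mapping.map (\<lambda>l. l * a) u)\<rparr>"

definition fg_free :: "('r::ring_1, 'm::ab_group_add) rmod \<Rightarrow> bool" where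
  "fg_free M \<longleftrightarrow> right_module M \<and> (\<exists>n. module_isomorphic M (free_module n))"

definition stably_equivalent ::
  "('r::ring_1, 'm::ab_group_add) rmod \<Rightarrow> ('r, 'n::ab_group_add) rmod \<Rightarrow> bool" where
  "stably_equivalent M N \<longleftrightarrow>
     (\<exists>a b. module_isomorphic (direct_sum M (free_module a)) (direct_sum N (free_module b)))"

text \<open>The stable module of \<open>N\<close>, as the collection of its members carried by an arbitrary
  type \<open>'m\<close>.\<close>

definition stable_module :: "('r::ring_1, 'n::ab_group_add) rmod \<Rightarrow> ('r, 'm::ab_group_add) rmod set" where
  "stable_module N = {M. right_module M \<and> finitely_generated M \<and> stably_equivalent M N}"

text \<open>Exactness of \<open>0 \<rightarrow> J \<rightarrow> F\<^sub>2 \<rightarrow> F\<^sub>1 \<rightarrow> F\<^sub>0 \<rightarrow> N \<rightarrow> 0\<close> with maps \<open>j\<close>, \<open>d\<^sub>2\<close>, \<open>d\<^sub>1\<close>, \<open>e\<close> and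
  finitely generated free \<open>F\<^sub>i\<close>.\<close>

definition exact_free3 ::
  "('r::ring_1, 'j::ab_group_add) rmod \<Rightarrow> ('j \<Rightarrow> 'f2) \<Rightarrow> ('r, 'f2::ab_group_add) rmod \<Rightarrow> ('f2 \<Rightarrow> 'f1) \<Rightarrow>
   ('r, 'f1::ab_group_add) rmod \<Rightarrow> ('f1 \<Rightarrow> 'f0) \<Rightarrow> ('r, 'f0::ab_group_add) rmod \<Rightarrow> ('f0 \<Rightarrow> 'n) \<Rightarrow>
   ('r, 'n::ab_group_add) rmod \<Rightarrow> bool" where
  "exact_free3 J j F2 d2 F1 d1 F0 e N \<longleftrightarrow>
     right_module J \<and> fg_free F2 \<and> fg_free F1 \<and> fg_free F0 \<and> right_module N \<and>
     module_hom J F2 j \<and> module_hom F2 F1 d2 \<and> module_hom F1 F0 d1 \<and> module_hom F0 N e \<and>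
     inj_on j (mcarrier J) \<and>
     j ` mcarrier J = module_kernel F2 d2 \<and>
     d2 ` mcarrier F2 = module_kernel F1 d1 \<and>
     d1 ` mcarrier F1 = module_kernel F0 e \<and>
     e ` mcarrier F0 = mcarrier N"

text \<open>The third syzygy of \<open>N\<close>: all members (carried by \<open>'m\<close>) of the stable module of some \<open>J\<close>
  occurring as above. The ambient type \<open>nat \<Rightarrow>\<^sub>0 'r\<close> of \<open>J\<close> and the \<open>F\<^sub>i\<close> is no restriction up to
  isomorphism: each \<open>F\<^sub>i\<close> is isomorphic to some \<open>free_module n\<close>, and \<open>J\<close> embeds into \<open>F\<^sub>2\<close>.\<close>

definition third_syzygy :: "('r::ring_1, 'n::ab_group_add) rmod \<Rightarrow> ('r, 'm::ab_group_add) rmod set" where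
  "third_syzygy N =
     {M. \<exists>(J :: ('r, nat \<Rightarrow>\<^sub>0 'r) rmod) j (F2 :: ('r, nat \<Rightarrow>\<^sub>0 'r) rmod) d2
           (F1 :: ('r, nat \<Rightarrow>\<^sub>0 'r) rmod) d1 (F0 :: ('r, nat \<Rightarrow>\<^sub>0 'r) rmod) e.
           exact_free3 J j F2 d2 F1 d1 F0 e N \<and> M \<in> stable_module J}"


section \<open>The group \<open>G(7,6)\<close> and its integral group ring\<close>

text \<open>A letter \<open>(s, False)\<close> stands for the generator \<open>s\<close> and \<open>(s, True)\<close> for its formal inverse;
  \<open>presented_eq R\<close> is the congruence on words that defines the group with generators \<open>'g\<close> and
  relations \<open>u = v\<close> for \<open>(u, v) \<in> R\<close>.\<close>

type_synonym 'g word = "('g \<times> bool) list"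

inductive presented_eq :: "('g word \<times> 'g word) set \<Rightarrow> 'g word \<Rightarrow> 'g word \<Rightarrow> bool"
  for R :: "('g word \<times> 'g word) set" where
  rel: "(u, v) \<in> R \<Longrightarrow> presented_eq R u v"
| cancel: "presented_eq R [(s, b), (s, \<not> b)] []"
| refl: "presented_eq R u u"
| sym: "presented_eq R u v \<Longrightarrow> presented_eq R v u"
| trans: "presented_eq R u v \<Longrightarrow> presented_eq R v w \<Longrightarrow> presented_eq R u w"
| append: "presented_eq R u v \<Longrightarrow> presented_eq R u' v' \<Longrightarrow> presented_eq R (u @ u') (v @ v')"

definition word_inv :: "'g word \<Rightarrow> 'g word" where
  "word_inv w = rev (map (\<lambda>(s, b). (s, \<not> b)) w)"

lemma word_inv_append: "word_inv (u @ v) = word_inv v @ word_inv u"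
  by (simp add: word_inv_def)

lemma word_inv_word_inv: "word_inv (word_inv w) = w"
  by (induction w) (auto simp: word_inv_def)

lemma presented_eq_inv_left: "presented_eq R (word_inv w @ w) []"
proof (induction w)
  case Nil
  then show ?case by (simp add: word_inv_def presented_eq.refl)
next
  case (Cons l w)
  obtain s b where l: "l = (s, b)" by (cases l)
  have eq: "word_inv (l # w) @ l # w = word_inv w @ [(s, \<not> b), (s, b)] @ w"
    by (simp add: word_inv_def l)
  have "presented_eq R [(s, \<not> b), (s, b)] []"
    using presented_eq.cancel[of R s "\<not> b"] by simp
  then have "presented_eq R (word_inv w @ [(s, \<not> b), (s, b)] @ w) (word_inv w @ [] @ w)"
    by (intro presented_eq.append presented_eq.refl)
  then show ?case unfolding eq using Cons presented_eq.trans by fastforce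
qed

lemma presented_eq_inv:
  assumes "presented_eq R u v"
  shows "presented_eq R (word_inv u) (word_inv v)"
proof -
  have right: "presented_eq R (w @ word_inv w) []" for w
    using presented_eq_inv_left[of R "word_inv w"] by (simp add: word_inv_word_inv)
  have "presented_eq R (word_inv u @ []) (word_inv u @ (v @ word_inv v))"
    by (intro presented_eq.append presented_eq.refl presented_eq.sym[OF right])
  moreover have "presented_eq R (word_inv u @ (v @ word_inv v)) (word_inv u @ (u @ word_inv v))"
    by (intro presented_eq.append presented_eq.refl presented_eq.sym[OF assms])
  moreover have "presented_eq R ((word_inv u @ u) @ word_inv v) ([] @ word_inv v)"
    by (intro presented_eq.append presented_eq.refl presented_eq_inv_left)
  ultimately show ?thesis
    by (simp, meson presented_eq.trans)
qed

datatype gen = X | Y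

definition G76_relations :: "(gen word \<times> gen word) set" where
  "G76_relations =
     {(replicate 7 (X, False), []),
      (replicate 6 (Y, False), []),
      ([(Y, False), (X, False)], replicate 3 (X, False) @ [(Y, False)])}"

quotient_type G76 = "gen word" / "presented_eq G76_relations"
  by (intro equivpI reflpI sympI transpI) (blast intro: presented_eq.intros)+

text \<open>The group is written additively (the class \<open>group_add\<close> does not assume commutativity), so that
  the convolution product of the library makes \<open>G76 \<Rightarrow>\<^sub>0 int\<close> the integral group ring.\<close>

instantiation G76 :: group_add
begin

lift_definition zero_G76 :: G76 is "[]" .

lift_definition plus_G76 :: "G76 \<Rightarrow> G76 \<Rightarrow> G76" is "(@)"
  by (rule presented_eq.append)

lift_definition uminus_G76 :: "G76 \<Rightarrow> G76" is word_inv
  by (rule presented_eq_inv)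

definition minus_G76 :: "G76 \<Rightarrow> G76 \<Rightarrow> G76" where
  "minus_G76 g h = g + (- h)"

instance
proof
  fix a b c :: G76
  show "a + b + c = a + (b + c)"
    by transfer (simp add: presented_eq.refl)
  show "0 + a = a" "a + 0 = a"
    by (transfer, simp add: presented_eq.refl)+
  show "- a + a = 0"
    by transfer (rule presented_eq_inv_left)
  show "a + (- b) = a - b"
    by (simp add: minus_G76_def)
qed

end

lift_definition gen_elem :: "gen \<Rightarrow> G76" is "\<lambda>s. [(s, False)]" .

type_synonym Lam = "G76 \<Rightarrow>\<^sub>0 int"

definition gen_x :: Lam where "gen_x = Poly_Mapping.single (gen_elem X) 1"

definition gen_y :: Lam where "gen_y = Poly_Mapping.single (gen_elem Y) 1"

definition trivial_module :: "(Lam, int) rmod" where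
  "trivial_module =
     \<lparr>mcarrier = UNIV, act = (\<lambda>n a. n * (\<Sum>g\<in>Poly_Mapping.keys a. Poly_Mapping.lookup a g))\<rparr>"

definition right_ideal :: "Lam \<Rightarrow> (Lam, Lam) rmod" where
  "right_ideal c = \<lparr>mcarrier = range (\<lambda>a. c * a), act = (*)\<rparr>"


section \<open>The modules \<open>R(i)\<close>\<close>

definition zeta :: complex where
  "zeta = exp (2 * pi * \<i> / 7)"

definition Z_zeta :: "complex set" where
  "Z_zeta = range (\<lambda>p :: int poly. poly (map_poly of_int p) zeta)"

text \<open>The automorphism \<open>\<sigma>\<close> is unique on \<open>Z_zeta\<close>; its values elsewhere are irrelevant.\<close>

definition sigma :: "complex \<Rightarrow> complex" where
  "sigma = (SOME s. bij_betw s Z_zeta Z_zeta \<and>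
     (\<forall>u\<in>Z_zeta. \<forall>v\<in>Z_zeta. s (u + v) = s u + s v \<and> s (u * v) = s u * s v) \<and>
     s zeta = zeta ^ 3)"

text \<open>The ideal \<open>(\<zeta> - 1)\<int>[\<zeta>]\<close> with its right module structure; as \<open>gen_x\<close> and \<open>gen_y\<close> generate
  the group ring, the action on the carrier is determined by the conditions below.\<close>

definition cyc_module :: "(Lam, complex) rmod" where
  "cyc_module = (SOME M. right_module M \<and>
     mcarrier M = (\<lambda>w. (zeta - 1) * w) ` Z_zeta \<and>
     (\<forall>v\<in>mcarrier M. act M v gen_x = v * zeta \<and> act M v gen_y = inv_into Z_zeta sigma v))"

text \<open>The six indices are the elements of the ordered type \<open>6\<close>, in which \<open>6 = 0\<close> is the least
  element; \<open>idx\<close> translates them to the usual \<open>1, \<dots>, 6\<close>.\<close>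

definition idx :: "6 \<Rightarrow> nat" where
  "idx j = card {..j}"

definition T6 :: "(int ^ 6 ^ 6) set" where
  "T6 = {A. \<forall>i j. i > j \<longrightarrow> 7 dvd A $ i $ j}"

text \<open>The matrix of \<open>v \<mapsto> v \<cdot> a\<close>, acting on row vectors, in the basis \<open>(\<zeta> - 1)\<^sup>j\<close>,
  \<open>1 \<le> j \<le> 6\<close>: row \<open>i\<close> contains the coordinates of the image of the \<open>i\<close>-th basis vector.\<close>

definition lam :: "Lam \<Rightarrow> int ^ 6 ^ 6" where
  "lam a = (THE A. \<forall>i. act cyc_module ((zeta - 1) ^ idx i) a =
                         (\<Sum>j\<in>UNIV. of_int (A $ i $ j) * (zeta - 1) ^ idx j))"

definition row_module :: "nat \<Rightarrow> (Lam, int ^ 6) rmod" where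
  "row_module i = \<lparr>mcarrier = {t $ k | t k. t \<in> T6 \<and> idx k = i}, act = (\<lambda>r a. r v* lam a)\<rparr>"

end

theory Submission
  imports Defs
begin

text \<open>
  By Schanuel's lemma it is enough to exhibit one resolution whose third syzygy is the given module.
  Put \<open>w = \<zeta>\<^sup>4(\<zeta> - 1)\<close>, so that \<open>w \<cdot> y = - w(1 + \<zeta>)\<close> and \<open>w\<^sup>2 \<cdot> y = w\<^sup>2(1 + \<zeta>)\<^sup>2\<close>; thus \<open>w\<close> and
  \<open>w\<^sup>2\<close> generate \<open>R(1)\<close> and \<open>R(2)\<close>.
  With \<open>\<Sigma>\<^sub>y = 1 + y + \<dots> + y\<^sup>5\<close> the element \<open>r = - x \<Sigma>\<^sub>y x\<^sup>4(x - 1)\<close> satisfies the defining relations of \<open>w\<close>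
  and \<open>\<Sigma>\<^sub>y r = \<Sigma>\<^sub>y x\<^sup>4(x - 1)\<close>, and this splits the augmentation ideal as
  \<open>r\<Lambda> \<oplus> (y - 1)\<Lambda>\<close> with \<open>r\<Lambda>\<close> isomorphic to \<open>R(1)\<close>.
  The annihilator of \<open>r\<close> is \<open>g\<Lambda>\<close> for \<open>g = 1 + y - x\<^sup>4y\<^sup>3\<close>, the annihilator of \<open>g\<close> is \<open>l\<Lambda>\<close> for an element \<open>l\<close>
  that satisfies the defining relations of \<open>w\<^sup>2\<close>, and \<open>y - 1\<close> and \<open>\<Sigma>\<^sub>y\<close> generate each other's annihilators.
  Splicing gives \<open>0 \<rightarrow> l\<Lambda> \<oplus> (y - 1)\<Lambda> \<rightarrow> \<Lambda>\<^sup>2 \<rightarrow> \<Lambda>\<^sup>2 \<rightarrow> \<Lambda> \<rightarrow> \<int> \<rightarrow> 0\<close> with \<open>l\<Lambda>\<close> isomorphic to \<open>R(2)\<close>.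
\<close>

subsection \<open>Modules and Schanuel's lemma\<close>

text \<open>The factor \<open>- x\<close> in \<open>r\<close> comes from
  \<open>sum_y x sum_y = (sum_x - 1) sum_y\<close>: since \<open>y^j x = x^(3^j) y^j\<close>, the
  exponents \<open>3^j\<close> run through all nonzero residues modulo 7. As \<open>sum_x\<close>
  kills \<open>x - 1\<close>, this yields \<open>sum_y r = sum_y x^4 (x - 1)\<close>, and hence
  \<open>r = - x (sum_y r)\<close>, so that left multiplication by \<open>sum_y\<close> is injective
  on r\<Lambda>. The element \<open>g\<close> is read off from \<open>w\<close>: the action of
  \<open>y^3\<close> is complex conjugation, and both \<open>w + w y\<close> and the image of
  \<open>w \<zeta>^4\<close> under \<open>y^3\<close> equal \<open>- w \<zeta>\<close>. The delicate
  point is that the annihilators of \<open>r\<close> and \<open>g\<close> are generated by single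
  elements. Explicit identities with fixed coefficients reduce this to two structural facts: the
  annihilators of \<open>x - 1\<close>, \<open>y - 1\<close> and their norm sums, obtained from
  coset decompositions, and the fact that \<open>p(\<zeta>) = 0\<close> forces the seventh
  cyclotomic polynomial to divide \<open>p\<close>, obtained from the arithmetic of
  \<open>\<zeta> - 1\<close> over 7.\<close>

lemma right_moduleI:
  assumes "0 \<in> mcarrier M"
    and "\<And>u v. u \<in> mcarrier M \<Longrightarrow> v \<in> mcarrier M \<Longrightarrow> u + v \<in> mcarrier M"
    and "\<And>u. u \<in> mcarrier M \<Longrightarrow> - u \<in> mcarrier M"
    and "\<And>u a. u \<in> mcarrier M \<Longrightarrow> act M u a \<in> mcarrier M"
    and "\<And>u v a. u \<in> mcarrier M \<Longrightarrow> v \<in> mcarrier M \<Longrightarrow> act M (u + v) a = act M u a + act M v a"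
    and "\<And>u a b. u \<in> mcarrier M \<Longrightarrow> act M u (a + b) = act M u a + act M u b"
    and "\<And>u a b. u \<in> mcarrier M \<Longrightarrow> act M u (a * b) = act M (act M u a) b"
    and "\<And>u. u \<in> mcarrier M \<Longrightarrow> act M u 1 = u"
  shows "right_module M"
  unfolding right_module_def by (intro conjI ballI allI) (fact assms | rule assms; assumption)+

lemma right_moduleD:
  assumes "right_module M"
  shows "0 \<in> mcarrier M"
    and "\<And>u v. u \<in> mcarrier M \<Longrightarrow> v \<in> mcarrier M \<Longrightarrow> u + v \<in> mcarrier M"
    and "\<And>u. u \<in> mcarrier M \<Longrightarrow> - u \<in> mcarrier M"
    and "\<And>u a. u \<in> mcarrier M \<Longrightarrow> act M u a \<in> mcarrier M"
    and "\<And>u v a. u \<in> mcarrier M \<Longrightarrow> v \<in> mcarrier M \<Longrightarrow> act M (u + v) a = act M u a + act M v a"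
    and "\<And>u a b. u \<in> mcarrier M \<Longrightarrow> act M u (a + b) = act M u a + act M u b"
    and "\<And>u a b. u \<in> mcarrier M \<Longrightarrow> act M u (a * b) = act M (act M u a) b"
    and "\<And>u. u \<in> mcarrier M \<Longrightarrow> act M u 1 = u"
  using assms unfolding right_module_def by blast+

lemma right_module_diff:
  "right_module M \<Longrightarrow> u \<in> mcarrier M \<Longrightarrow> v \<in> mcarrier M \<Longrightarrow> u - v \<in> mcarrier M"
  using right_moduleD(2)[of M u "- v"] right_moduleD(3)[of M v] by simp

lemma right_module_sum:
  "right_module M \<Longrightarrow> (\<And>i. i \<in> I \<Longrightarrow> f i \<in> mcarrier M) \<Longrightarrow> sum f I \<in> mcarrier M"
  by (induction I rule: infinite_finite_induct) (auto simp: right_moduleD)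

lemma act_zero_left: "right_module M \<Longrightarrow> act M 0 a = 0"
  using right_moduleD(5)[of M 0 0 a] right_moduleD(1)[of M] by simp

lemma act_zero_right: "right_module M \<Longrightarrow> u \<in> mcarrier M \<Longrightarrow> act M u 0 = 0"
  using right_moduleD(6)[of M u 0 0] by simp

lemma act_uminus_left: "right_module M \<Longrightarrow> u \<in> mcarrier M \<Longrightarrow> act M (- u) a = - act M u a"
  using right_moduleD(5)[of M u "- u" a] right_moduleD(3)[of M u] act_zero_left[of M a]
  by (simp add: minus_unique)

lemma act_uminus_right: "right_module M \<Longrightarrow> u \<in> mcarrier M \<Longrightarrow> act M u (- a) = - act M u a"
  using right_moduleD(6)[of M u a "- a"] act_zero_right[of M u] by (simp add: minus_unique)

lemma act_diff_left:
  "right_module M \<Longrightarrow> u \<in> mcarrier M \<Longrightarrow> v \<in> mcarrier M \<Longrightarrow> act M (u - v) a = act M u a - act M v a"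
  using right_moduleD(5)[of M u "- v" a] right_moduleD(3)[of M v] by (simp add: act_uminus_left)

lemma act_sum_left:
  "right_module M \<Longrightarrow> (\<And>i. i \<in> I \<Longrightarrow> f i \<in> mcarrier M) \<Longrightarrow>
     act M (sum f I) a = (\<Sum>i\<in>I. act M (f i) a)"
  by (induction I rule: infinite_finite_induct)
    (auto simp: right_moduleD act_zero_left right_module_sum)

lemma module_homI:
  assumes "\<And>u. u \<in> mcarrier M \<Longrightarrow> f u \<in> mcarrier N"
    and "\<And>u v. u \<in> mcarrier M \<Longrightarrow> v \<in> mcarrier M \<Longrightarrow> f (u + v) = f u + f v"
    and "\<And>u a. u \<in> mcarrier M \<Longrightarrow> f (act M u a) = act N (f u) a"
  shows "module_hom M N f"
  using assms unfolding module_hom_def by blast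

lemma module_homD:
  assumes "module_hom M N f"
  shows "\<And>u. u \<in> mcarrier M \<Longrightarrow> f u \<in> mcarrier N"
    and "\<And>u v. u \<in> mcarrier M \<Longrightarrow> v \<in> mcarrier M \<Longrightarrow> f (u + v) = f u + f v"
    and "\<And>u a. u \<in> mcarrier M \<Longrightarrow> f (act M u a) = act N (f u) a"
  using assms unfolding module_hom_def by blast+

lemma module_hom_zero: "module_hom M N f \<Longrightarrow> right_module M \<Longrightarrow> f 0 = 0"
  using module_homD(2)[of M N f 0 0] right_moduleD(1)[of M] by simp

lemma module_hom_uminus:
  "module_hom M N f \<Longrightarrow> right_module M \<Longrightarrow> u \<in> mcarrier M \<Longrightarrow> f (- u) = - f u"
  using module_homD(2)[of M N f u "- u"] right_moduleD(3)[of M u] module_hom_zero[of M N f]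
  by (simp add: minus_unique)

lemma module_hom_diff:
  "module_hom M N f \<Longrightarrow> right_module M \<Longrightarrow> u \<in> mcarrier M \<Longrightarrow> v \<in> mcarrier M \<Longrightarrow> f (u - v) = f u - f v"
  using module_homD(2)[of M N f u "- v"] right_moduleD(3)[of M v] by (simp add: module_hom_uminus)

lemma module_hom_sum:
  "module_hom M N f \<Longrightarrow> right_module M \<Longrightarrow> (\<And>i. i \<in> I \<Longrightarrow> s i \<in> mcarrier M) \<Longrightarrow>
     f (sum s I) = (\<Sum>i\<in>I. f (s i))"
  by (induction I rule: infinite_finite_induct)
    (auto simp: module_hom_zero module_homD(2) right_module_sum)

lemma module_hom_compose:
  "module_hom M N f \<Longrightarrow> module_hom N L g \<Longrightarrow> module_hom M L (\<lambda>u. g (f u))"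
  by (rule module_homI) (auto simp: module_homD)

text \<open>The module axioms are equations, and an injective additive equivariant map reflects
  equations. This supplies the module structures on ideals of \<int>[\<zeta>] and on integer
  vectors.\<close>

lemma right_module_inj_transfer:
  assumes N: "right_module N"
    and im: "\<And>u. u \<in> mcarrier M \<Longrightarrow> f u \<in> mcarrier N"
    and zero: "0 \<in> mcarrier M" and add: "\<And>u v. u \<in> mcarrier M \<Longrightarrow> v \<in> mcarrier M \<Longrightarrow> u + v \<in> mcarrier M"
    and uminus: "\<And>u. u \<in> mcarrier M \<Longrightarrow> - u \<in> mcarrier M"
    and act: "\<And>u a. u \<in> mcarrier M \<Longrightarrow> act M u a \<in> mcarrier M"
    and hom_add: "\<And>u v. u \<in> mcarrier M \<Longrightarrow> v \<in> mcarrier M \<Longrightarrow> f (u + v) = f u + f v"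
    and hom_act: "\<And>u a. u \<in> mcarrier M \<Longrightarrow> f (act M u a) = act N (f u) a"
    and inj: "inj_on f (mcarrier M)"
  shows "right_module M"
  by (rule right_moduleI; (intro zero add uminus act inj_onD[OF inj])?)
    (simp_all add: zero add uminus act hom_add hom_act im right_moduleD[OF N])

definition kernel_module ::
  "('r::ring_1, 'm::ab_group_add) rmod \<Rightarrow> ('m \<Rightarrow> 'n::ab_group_add) \<Rightarrow> ('r, 'm) rmod" where
  "kernel_module M f = M\<lparr>mcarrier := module_kernel M f\<rparr>"

lemma kernel_module_simps [simp]:
  "mcarrier (kernel_module M f) = module_kernel M f" "act (kernel_module M f) = act M"
  by (simp_all add: kernel_module_def)

lemma right_module_kernel:
  assumes "module_hom M N f" "right_module M" "right_module N"
  shows "right_module (kernel_module M f)"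
  using assms
  by (intro right_moduleI)
    (auto simp: module_kernel_def right_moduleD module_homD module_hom_zero module_hom_uminus
      act_zero_left)

section \<open>Direct sums and isomorphisms of modules\<close>

lemma direct_sum_simps [simp]:
  "mcarrier (direct_sum M N) = mcarrier M \<times> mcarrier N"
  "act (direct_sum M N) (u, v) a = (act M u a, act N v a)"
  by (simp_all add: direct_sum_def)

lemma right_module_direct_sum:
  "right_module M \<Longrightarrow> right_module N \<Longrightarrow> right_module (direct_sum M N)"
  by (intro right_moduleI) (auto simp: right_moduleD zero_prod_def)

lemma module_isomorphicI:
  assumes "module_hom M N f"
    and "\<And>v. v \<in> mcarrier N \<Longrightarrow> g v \<in> mcarrier M"
    and "\<And>u. u \<in> mcarrier M \<Longrightarrow> g (f u) = u"
    and "\<And>v. v \<in> mcarrier N \<Longrightarrow> f (g v) = v"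
  shows "module_isomorphic M N"
  unfolding module_isomorphic_def using assms
  by (intro exI[of _ f] conjI bij_betw_byWitness[where f' = g]) (auto simp: module_homD)

text \<open>Additivity of the inverse is checked by applying it to \<open>f (g u + g v)\<close>, so
  \<open>g u + g v\<close> has to lie in the carrier of \<open>M\<close>; this is where
  \<open>right_module M\<close> enters.\<close>

lemma module_isomorphic_inverse:
  assumes "module_isomorphic M N" "right_module M"
  shows "\<exists>f g. module_hom M N f \<and> module_hom N M g \<and>
    (\<forall>u\<in>mcarrier M. g (f u) = u) \<and> (\<forall>v\<in>mcarrier N. f (g v) = v)"
proof -
  obtain f where f: "module_hom M N f" "bij_betw f (mcarrier M) (mcarrier N)"
    using assms unfolding module_isomorphic_def by blast
  define g where "g = inv_into (mcarrier M) f"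
  have gM: "g v \<in> mcarrier M" and fg: "f (g v) = v" if "v \<in> mcarrier N" for v
    using f(2) that bij_betw_imp_surj_on[OF f(2)]
    unfolding g_def by (auto intro: inv_into_into f_inv_into_f)
  have gf: "g (f u) = u" if "u \<in> mcarrier M" for u
    using f(2) that unfolding g_def by (simp add: bij_betw_inv_into_left)
  have "module_hom N M g"
  proof (rule module_homI)
    fix u v assume uv: "u \<in> mcarrier N" "v \<in> mcarrier N"
    then have "g (f (g u + g v)) = g u + g v"
      by (intro gf right_moduleD(2)[OF assms(2)] gM)
    then show "g (u + v) = g u + g v"
      using uv by (simp add: module_homD(2)[OF f(1)] gM fg)
  next
    fix u a assume u: "u \<in> mcarrier N"
    then have "g (f (act M (g u) a)) = act M (g u) a"
      by (intro gf right_moduleD(4)[OF assms(2)] gM)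
    then show "g (act N u a) = act M (g u) a"
      using u by (simp add: module_homD(3)[OF f(1)] gM fg)
  qed (rule gM)
  with f(1) gf fg show ?thesis by blast
qed

lemma module_isomorphic_refl: "module_isomorphic M M"
  by (rule module_isomorphicI[where f = "\<lambda>u. u" and g = "\<lambda>u. u"]) (auto simp: module_hom_def)

lemma module_isomorphic_sym:
  assumes "module_isomorphic M N" "right_module M"
  shows "module_isomorphic N M"
proof -
  obtain f g where f: "module_hom M N f" and g: "module_hom N M g"
    and gf: "\<And>u. u \<in> mcarrier M \<Longrightarrow> g (f u) = u" and fg: "\<And>v. v \<in> mcarrier N \<Longrightarrow> f (g v) = v"
    using module_isomorphic_inverse[OF assms] by blast
  show ?thesis
    by (rule module_isomorphicI[OF g module_homD(1)[OF f] fg gf])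
qed

lemma module_isomorphic_trans [trans]:
  assumes "module_isomorphic M N" "module_isomorphic N L"
  shows "module_isomorphic M L"
proof -
  obtain f g where "module_hom M N f" "bij_betw f (mcarrier M) (mcarrier N)"
    and "module_hom N L g" "bij_betw g (mcarrier N) (mcarrier L)"
    using assms unfolding module_isomorphic_def by blast
  then show ?thesis
    unfolding module_isomorphic_def
    by (intro exI[of _ "\<lambda>u. g (f u)"])
      (auto intro: module_hom_compose dest: bij_betw_trans simp: comp_def)
qed

lemma module_isomorphic_direct_sum:
  assumes "module_isomorphic M M'" "module_isomorphic N N'"
  shows "module_isomorphic (direct_sum M N) (direct_sum M' N')"
proof -
  obtain f g where "module_hom M M' f" "bij_betw f (mcarrier M) (mcarrier M')"
    and "module_hom N N' g" "bij_betw g (mcarrier N) (mcarrier N')"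
    using assms unfolding module_isomorphic_def by blast
  then show ?thesis
    unfolding module_isomorphic_def
    by (intro exI[of _ "map_prod f g"])
      (auto intro!: module_homI bij_betw_map_prod simp: module_homD)
qed

lemma direct_sum_assoc:
  "module_isomorphic (direct_sum (direct_sum M N) L) (direct_sum M (direct_sum N L))"
  by (rule module_isomorphicI[where f = "\<lambda>((u, v), w). (u, (v, w))" and g = "\<lambda>(u, (v, w)). ((u, v), w)"])
    (auto intro!: module_homI)

lemma direct_sum_commute: "module_isomorphic (direct_sum M N) (direct_sum N M)"
  by (rule module_isomorphicI[where f = prod.swap and g = prod.swap]) (auto intro!: module_homI)

section \<open>Free modules and their lifting property\<close>

lemma lookup_act_free_module [simp]:
  "Poly_Mapping.lookup (act (free_module n) u a) i = Poly_Mapping.lookup u i * a"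
  by (auto simp: free_module_def Poly_Mapping.map.rep_eq when_def)

lemma mcarrier_free_module: "u \<in> mcarrier (free_module n) \<longleftrightarrow> (\<forall>i\<ge>n. Poly_Mapping.lookup u i = 0)"
  by (auto simp: free_module_def subset_iff in_keys_iff not_less[symmetric])

lemma right_module_free_module: "right_module (free_module n)"
  by (rule right_moduleI)
    (auto simp: mcarrier_free_module lookup_add algebra_simps intro!: poly_mapping_eqI)

lemma fg_free_free_module: "fg_free (free_module n)"
  unfolding fg_free_def using right_module_free_module module_isomorphic_refl by blast

lemma free_module_add:
  "module_isomorphic (direct_sum (free_module m) (free_module n))
     (free_module (m + n) :: ('r::ring_1, nat \<Rightarrow>\<^sub>0 'r) rmod)"
proof -
  define f :: "(nat \<Rightarrow>\<^sub>0 'r) \<times> (nat \<Rightarrow>\<^sub>0 'r) \<Rightarrow> nat \<Rightarrow>\<^sub>0 'r" where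
    "f = (\<lambda>(u, v). \<Sum>i<m + n. Poly_Mapping.single i
            (if i < m then Poly_Mapping.lookup u i else Poly_Mapping.lookup v (i - m)))"
  define g :: "(nat \<Rightarrow>\<^sub>0 'r) \<Rightarrow> (nat \<Rightarrow>\<^sub>0 'r) \<times> (nat \<Rightarrow>\<^sub>0 'r)" where
    "g = (\<lambda>u. (\<Sum>i<m. Poly_Mapping.single i (Poly_Mapping.lookup u i),
               \<Sum>i<n. Poly_Mapping.single i (Poly_Mapping.lookup u (m + i))))"
  have sum_single: "Poly_Mapping.lookup (\<Sum>i<k. Poly_Mapping.single i (c i)) j = (if j < k then c j else 0)"
    for c :: "nat \<Rightarrow> 'r" and k j
    by (simp add: lookup_sum lookup_single when_def sum.delta)
  have f: "Poly_Mapping.lookup (f (u, v)) i =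
      (if i < m then Poly_Mapping.lookup u i else if i < m + n then Poly_Mapping.lookup v (i - m) else 0)" for u v i
    by (simp add: f_def sum_single)
  have g: "Poly_Mapping.lookup (fst (g u)) i = (if i < m then Poly_Mapping.lookup u i else 0)"
    "Poly_Mapping.lookup (snd (g u)) i = (if i < n then Poly_Mapping.lookup u (m + i) else 0)" for u i
    by (simp_all add: g_def sum_single)
  show ?thesis
  proof (rule module_isomorphicI[where f = f and g = g])
    show "module_hom (direct_sum (free_module m) (free_module n)) (free_module (m + n)) f"
      by (rule module_homI)
        (auto simp: mcarrier_free_module f lookup_add intro!: poly_mapping_eqI)
  next
    fix v :: "nat \<Rightarrow>\<^sub>0 'r" assume v: "v \<in> mcarrier (free_module (m + n))"
    then show "g v \<in> mcarrier (direct_sum (free_module m) (free_module n))"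
      by (cases "g v") (use g[of v] in \<open>auto simp: mcarrier_free_module\<close>)
    show "f (g v) = v"
      using v by (cases "g v")
        (use g[of v] in \<open>auto simp: mcarrier_free_module f intro!: poly_mapping_eqI\<close>)
  next
    fix u :: "(nat \<Rightarrow>\<^sub>0 'r) \<times> (nat \<Rightarrow>\<^sub>0 'r)"
    assume u: "u \<in> mcarrier (direct_sum (free_module m) (free_module n))"
    obtain v w where vw: "u = (v, w)" by (cases u)
    have "Poly_Mapping.lookup (fst (g u')) = Poly_Mapping.lookup v"
      "Poly_Mapping.lookup (snd (g u')) = Poly_Mapping.lookup w" if "u' = f (v, w)" for u'
      using u by (auto simp: that vw fun_eq_iff g f mcarrier_free_module)
    then show "g (f u) = u"
      by (simp add: vw prod_eq_iff lookup_inject)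
  qed
qed

lemma fg_free_direct_sum:
  assumes "fg_free P" "fg_free Q"
  shows "fg_free (direct_sum P Q)"
proof -
  from assms obtain m n where "right_module P" "right_module Q"
    "module_isomorphic P (free_module m)" "module_isomorphic Q (free_module n)"
    unfolding fg_free_def by blast
  then show ?thesis
    unfolding fg_free_def
    using right_module_direct_sum module_isomorphic_direct_sum module_isomorphic_trans free_module_add
    by blast
qed

lemma free_module_expansion:
  assumes "u \<in> mcarrier (free_module n)"
  shows "u = (\<Sum>i<n. act (free_module n) (Poly_Mapping.single i 1) (Poly_Mapping.lookup u i))"
proof (rule poly_mapping_eqI)
  fix j
  have "(\<Sum>i<n. (1 when i = j) * Poly_Mapping.lookup u i) =
      (\<Sum>i<n. if i = j then Poly_Mapping.lookup u j else 0)"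
    by (rule sum.cong) auto
  then show "Poly_Mapping.lookup u j = Poly_Mapping.lookup
      (\<Sum>i<n. act (free_module n) (Poly_Mapping.single i 1) (Poly_Mapping.lookup u i)) j"
    using assms by (simp add: lookup_sum lookup_single mcarrier_free_module)
qed

text \<open>Projectivity: each basis vector goes to a chosen preimage under \<open>f\<close>, and
  the map is extended by coordinates.\<close>

lemma fg_free_lift:
  assumes P: "fg_free P" and Q: "right_module Q" and M: "right_module M"
    and g: "module_hom P M g" and f: "module_hom Q M f"
    and sub: "g ` mcarrier P \<subseteq> f ` mcarrier Q"
  shows "\<exists>h. module_hom P Q h \<and> (\<forall>u\<in>mcarrier P. f (h u) = g u)"
proof -
  obtain n where rP: "right_module P" and iso: "module_isomorphic P (free_module n)"
    using P unfolding fg_free_def by blast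
  obtain p q where p: "module_hom P (free_module n) p" and q: "module_hom (free_module n) P q"
    and qp: "\<And>u. u \<in> mcarrier P \<Longrightarrow> q (p u) = u"
    using module_isomorphic_inverse[OF iso rP] by blast
  define e where "e i = (Poly_Mapping.single i 1 :: nat \<Rightarrow>\<^sub>0 'a)" for i
  have e: "e i \<in> mcarrier (free_module n)" if "i < n" for i
    using that by (auto simp: e_def mcarrier_free_module lookup_single)
  define c where "c i = inv_into (mcarrier Q) f (g (q (e i)))" for i
  have "g (q (e i)) \<in> f ` mcarrier Q" if "i < n" for i
    using that e module_homD(1)[OF q] sub by auto
  then have c: "\<And>i. i < n \<Longrightarrow> c i \<in> mcarrier Q" "\<And>i. i < n \<Longrightarrow> f (c i) = g (q (e i))"
    by (simp_all add: c_def inv_into_into f_inv_into_f)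
  define h where "h u = (\<Sum>i<n. act Q (c i) (Poly_Mapping.lookup (p u) i))" for u
  have "module_hom P Q h"
  proof (rule module_homI)
    fix u a assume u: "u \<in> mcarrier P"
    have "act Q (h u) a = (\<Sum>i<n. act Q (act Q (c i) (Poly_Mapping.lookup (p u) i)) a)"
      unfolding h_def using c(1) by (intro act_sum_left[OF Q]) (auto simp: right_moduleD[OF Q])
    then show "h (act P u a) = act Q (h u) a"
      using c(1) u by (simp add: h_def module_homD[OF p] right_moduleD[OF Q])
  qed (use c(1) in \<open>auto simp: h_def module_homD[OF p] lookup_add right_moduleD[OF Q] sum.distrib
        intro!: right_module_sum[OF Q]\<close>)
  moreover have "f (h u) = g u" if u: "u \<in> mcarrier P" for u
  proof -
    have pu: "p u \<in> mcarrier (free_module n)"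
      using u module_homD(1)[OF p] by blast
    have "f (h u) = (\<Sum>i<n. f (act Q (c i) (Poly_Mapping.lookup (p u) i)))"
      unfolding h_def using c(1) by (intro module_hom_sum[OF f Q]) (auto simp: right_moduleD[OF Q])
    also have "\<dots> = (\<Sum>i<n. g (q (act (free_module n) (e i) (Poly_Mapping.lookup (p u) i))))"
      using c e module_homD[OF q]
      by (intro sum.cong) (auto simp: module_homD(3)[OF f] module_homD(3)[OF g] module_homD(3)[OF q])
    also have "\<dots> = g (q (\<Sum>i<n. act (free_module n) (e i) (Poly_Mapping.lookup (p u) i)))"
      using e right_moduleD(4)[OF right_module_free_module]
      by (subst module_hom_sum[OF module_hom_compose[OF q g] right_module_free_module]) auto
    also have "\<dots> = g u"
      using free_module_expansion[OF pu] qp[OF u] by (simp add: e_def)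
    finally show ?thesis .
  qed
  ultimately show ?thesis by blast
qed

text \<open>Both sides describe the pullback of pairs \<open>(p, q)\<close> with
  \<open>f p = g q\<close>. With lifts \<open>h\<close> and \<open>k\<close>, the pair determines
  \<open>a = p - k q\<close> in the kernel of \<open>f\<close> and \<open>b = q - h p\<close> in the
  kernel of \<open>g\<close>; the two maps below pass from \<open>(a, q)\<close> to
  \<open>(b, p)\<close> and back.\<close>

lemma schanuel:
  assumes P: "fg_free P" and Q: "fg_free Q" and M: "right_module M"
    and f: "module_hom P M f" "f ` mcarrier P = mcarrier M"
    and g: "module_hom Q M g" "g ` mcarrier Q = mcarrier M"
  shows "module_isomorphic (direct_sum (kernel_module P f) Q) (direct_sum (kernel_module Q g) P)"
proof -
  have rP: "right_module P" and rQ: "right_module Q"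
    using P Q by (auto simp: fg_free_def)
  obtain h where h: "module_hom P Q h" "\<And>u. u \<in> mcarrier P \<Longrightarrow> g (h u) = f u"
    using fg_free_lift[OF P rQ M f(1) g(1)] f(2) g(2) by auto
  obtain k where k: "module_hom Q P k" "\<And>u. u \<in> mcarrier Q \<Longrightarrow> f (k u) = g u"
    using fg_free_lift[OF Q rP M g(1) f(1)] f(2) g(2) by auto
  note clo = right_moduleD[OF rP] right_moduleD[OF rQ] right_module_diff[OF rP] right_module_diff[OF rQ]
    module_homD[OF h(1)] module_homD[OF k(1)] module_homD[OF f(1)] module_homD[OF g(1)]
    module_hom_diff[OF f(1) rP] module_hom_diff[OF g(1) rQ]
    act_diff_left[OF rP] act_diff_left[OF rQ] h(2) k(2)
  show ?thesis
  proof (rule module_isomorphicI[where f = "\<lambda>(a, q). (q - h (a + k q), a + k q)"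
        and g = "\<lambda>(b, p). (p - k (b + h p), b + h p)"])
    show "module_hom (direct_sum (kernel_module P f) Q) (direct_sum (kernel_module Q g) P)
       (\<lambda>(a, q). (q - h (a + k q), a + k q))"
      by (rule module_homI) (auto simp: module_kernel_def clo algebra_simps)
  qed (auto simp: module_kernel_def clo)
qed

section \<open>Stable equivalence and independence of the resolution\<close>

lemma stably_equivalent_trans:
  assumes "stably_equivalent M N" "stably_equivalent N L" and rM: "right_module M" and rN: "right_module N"
  shows "stably_equivalent M L"
proof -
  let ?F = "free_module :: nat \<Rightarrow> ('a, nat \<Rightarrow>\<^sub>0 'a) rmod"
  let ?iso = "module_isomorphic" let ?S = "direct_sum"
  note rF = right_module_free_module and sum = module_isomorphic_direct_sum
  note refl = module_isomorphic_refl and sym = module_isomorphic_sym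
  obtain a b c d where ab: "?iso (?S M (?F a)) (?S N (?F b))" and cd: "?iso (?S N (?F c)) (?S L (?F d))"
    using assms unfolding stably_equivalent_def by blast
  \<comment> \<open>Padding the first isomorphism with \<open>F c\<close> and the second with
    \<open>F b\<close> makes the middle terms agree up to the order of the free summands.\<close>
  have "?iso (?S (?S M (?F a)) (?F c)) (?S M (?F (a + c)))"
    by (rule module_isomorphic_trans[OF direct_sum_assoc sum[OF refl free_module_add]])
  then have "?iso (?S M (?F (a + c))) (?S (?S M (?F a)) (?F c))"
    by (rule sym) (intro right_module_direct_sum rM rF)
  also have "?iso \<dots> (?S (?S N (?F b)) (?F c))"
    by (rule sum[OF ab refl])
  also have "?iso \<dots> (?S N (?S (?F b) (?F c)))"
    by (rule direct_sum_assoc)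
  also have "?iso \<dots> (?S N (?S (?F c) (?F b)))"
    by (rule sum[OF refl direct_sum_commute])
  also have "?iso \<dots> (?S (?S N (?F c)) (?F b))"
    by (rule sym[OF direct_sum_assoc]) (intro right_module_direct_sum rN rF)
  also have "?iso \<dots> (?S (?S L (?F d)) (?F b))"
    by (rule sum[OF cd refl])
  also have "?iso \<dots> (?S L (?F (d + b)))"
    by (rule module_isomorphic_trans[OF direct_sum_assoc sum[OF refl free_module_add]])
  finally show ?thesis unfolding stably_equivalent_def by blast
qed

lemma stably_equivalent_sym:
  "stably_equivalent M N \<Longrightarrow> right_module M \<Longrightarrow> stably_equivalent N M"
  unfolding stably_equivalent_def
  by (metis module_isomorphic_sym right_module_direct_sum right_module_free_module)

lemma module_isomorphic_imp_stably_equivalent: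
  "module_isomorphic M N \<Longrightarrow> stably_equivalent M N"
  unfolding stably_equivalent_def using module_isomorphic_direct_sum module_isomorphic_refl by blast

text \<open>Schanuel's lemma needs a common target. Free summands are added to covers and targets,
  and \<open>t\<close> carries one enlarged target to the other; the kernels only gain a zero
  summand.\<close>

lemma stably_equivalent_kernels:
  assumes P: "fg_free P" and Q: "fg_free Q" and rM: "right_module M" and rN: "right_module N"
    and f: "module_hom P M f" "f ` mcarrier P = mcarrier M"
    and g: "module_hom Q N g" "g ` mcarrier Q = mcarrier N"
    and MN: "stably_equivalent M N"
  shows "stably_equivalent (kernel_module P f) (kernel_module Q g)"
proof -
  let ?F = "free_module :: nat \<Rightarrow> ('a, nat \<Rightarrow>\<^sub>0 'a) rmod"
  let ?iso = "module_isomorphic" let ?S = "direct_sum"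
  have rP: "right_module P" and rQ: "right_module Q"
    using P Q by (auto simp: fg_free_def)
  note rF = right_module_free_module and sum = module_isomorphic_direct_sum
  note refl = module_isomorphic_refl and sym = module_isomorphic_sym
  obtain a b where "?iso (?S M (?F a)) (?S N (?F b))"
    using MN unfolding stably_equivalent_def by blast
  then obtain t where t: "module_hom (?S M (?F a)) (?S N (?F b)) t"
      "bij_betw t (mcarrier (?S M (?F a))) (mcarrier (?S N (?F b)))"
    unfolding module_isomorphic_def by blast
  define f' where "f' = (\<lambda>u. t (map_prod f id u))"
  define g' where "g' = map_prod g (id :: (nat \<Rightarrow>\<^sub>0 'a) \<Rightarrow> _)"
  have f0: "module_hom (?S P (?F a)) (?S M (?F a)) (map_prod f id)"
    by (rule module_homI) (auto simp: module_homD[OF f(1)] right_moduleD[OF rF])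
  have f': "module_hom (?S P (?F a)) (?S N (?F b)) f'"
    unfolding f'_def by (rule module_hom_compose[OF f0 t(1)])
  have g': "module_hom (?S Q (?F b)) (?S N (?F b)) g'"
    unfolding g'_def by (rule module_homI) (auto simp: module_homD[OF g(1)] right_moduleD[OF rF])
  have imf: "f' ` mcarrier (?S P (?F a)) = mcarrier (?S N (?F b))"
  proof -
    have "f' ` mcarrier (?S P (?F a)) = t ` map_prod f id ` (mcarrier P \<times> mcarrier (?F a))"
      by (simp add: f'_def image_image)
    also have "map_prod f id ` (mcarrier P \<times> mcarrier (?F a)) = mcarrier (?S M (?F a))"
      using f(2) by (simp add: map_prod_surj_on)
    finally show ?thesis using bij_betw_imp_surj_on[OF t(2)] by simp
  qed
  have img: "g' ` mcarrier (?S Q (?F b)) = mcarrier (?S N (?F b))"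
    using g(2) by (simp add: g'_def map_prod_surj_on)
  have t0: "t u = 0 \<longleftrightarrow> u = 0" if "u \<in> mcarrier (?S M (?F a))" for u
    using bij_betw_imp_inj_on[OF t(2)] that right_moduleD(1)[OF right_module_direct_sum[OF rM rF]]
      module_hom_zero[OF t(1) right_module_direct_sum[OF rM rF]]
    by (metis inj_onD)
  have kf: "module_kernel (?S P (?F a)) f' = module_kernel P f \<times> {0}"
    using t0 module_homD(1)[OF f(1)] right_moduleD(1)[OF rF] right_moduleD(1)[OF rM]
    by (auto simp: module_kernel_def f'_def zero_prod_def)
  have kg: "module_kernel (?S Q (?F b)) g' = module_kernel Q g \<times> {0}"
    using right_moduleD(1)[OF rF] by (auto simp: module_kernel_def g'_def zero_prod_def)
  have isof: "?iso (kernel_module (?S P (?F a)) f') (kernel_module P f)"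
    by (rule module_isomorphicI[where f = fst and g = "\<lambda>u. (u, 0)"]) (auto intro!: module_homI simp: kf)
  have isog: "?iso (kernel_module (?S Q (?F b)) g') (kernel_module Q g)"
    by (rule module_isomorphicI[where f = fst and g = "\<lambda>u. (u, 0)"]) (auto intro!: module_homI simp: kg)
  have FP: "fg_free (?S P (?F a))" and FQ: "fg_free (?S Q (?F b))"
    by (simp_all add: P Q fg_free_direct_sum fg_free_free_module)
  then obtain m n where m: "?iso (?S P (?F a)) (?F m)" and n: "?iso (?S Q (?F b)) (?F n)"
    unfolding fg_free_def by blast
  have rf: "right_module (kernel_module (?S P (?F a)) f')"
    by (intro right_module_kernel[OF f'] right_module_direct_sum rP rN rF)
  have rf2: "right_module (?S Q (?F b))" by (intro right_module_direct_sum rQ rF)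
  have "?iso (?S (kernel_module P f) (?F n)) (?S (kernel_module (?S P (?F a)) f') (?S Q (?F b)))"
    by (intro sum sym[OF isof rf] sym[OF n rf2])
  also have "?iso \<dots> (?S (kernel_module (?S Q (?F b)) g') (?S P (?F a)))"
    by (intro schanuel[OF FP FQ _ f' imf g' img] right_module_direct_sum rN rF)
  also have "?iso \<dots> (?S (kernel_module Q g) (?F m))"
    by (intro sum isog m)
  finally show ?thesis unfolding stably_equivalent_def by blast
qed

text \<open>Dimension shifting: stable equivalence passes from the kernels of \<open>e\<close> to
  those of \<open>d1\<close> and then of \<open>d2\<close>, since each differential maps onto the
  next kernel.\<close>

lemma third_syzygies_stably_equivalent:
  assumes "exact_free3 J j F2 d2 F1 d1 F0 e N" "exact_free3 J' j' F2' d2' F1' d1' F0' e' N"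
  shows "stably_equivalent J J'"
proof -
  have base: "right_module J" "fg_free F2" "fg_free F1" "fg_free F0" "right_module N"
      "module_hom J F2 j" "module_hom F2 F1 d2" "module_hom F1 F0 d1" "module_hom F0 N e"
      "inj_on j (mcarrier J)" "j ` mcarrier J = module_kernel F2 d2"
      "d2 ` mcarrier F2 = module_kernel F1 d1" "d1 ` mcarrier F1 = module_kernel F0 e"
      "e ` mcarrier F0 = mcarrier N"
      "right_module J'" "fg_free F2'" "fg_free F1'" "fg_free F0'"
      "module_hom J' F2' j'" "module_hom F2' F1' d2'" "module_hom F1' F0' d1'" "module_hom F0' N e'"
      "inj_on j' (mcarrier J')" "j' ` mcarrier J' = module_kernel F2' d2'"
      "d2' ` mcarrier F2' = module_kernel F1' d1'" "d1' ` mcarrier F1' = module_kernel F0' e'"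
      "e' ` mcarrier F0' = mcarrier N"
    using assms unfolding exact_free3_def by auto
  have rF: "right_module F2" "right_module F1" "right_module F0"
    "right_module F2'" "right_module F1'" "right_module F0'"
    using base by (auto simp: fg_free_def)
  have onto: "module_hom A (kernel_module B q) p"
    if "module_hom A B p" "p ` mcarrier A = module_kernel B q" for A B p q
    using that unfolding module_hom_def by simp
  have "stably_equivalent (kernel_module F0 e) (kernel_module F0' e')"
    using base module_isomorphic_imp_stably_equivalent[OF module_isomorphic_refl]
    by (intro stably_equivalent_kernels[where M = N and N = N]) simp_all
  then have "stably_equivalent (kernel_module F1 d1) (kernel_module F1' d1')"
    using base rF by (intro stably_equivalent_kernels[where M = "kernel_module F0 e" and N = "kernel_module F0' e'"]
        onto right_module_kernel[of F0 N] right_module_kernel[of F0' N]) simp_all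
  then have K: "stably_equivalent (kernel_module F2 d2) (kernel_module F2' d2')"
    using base rF by (intro stably_equivalent_kernels[where M = "kernel_module F1 d1" and N = "kernel_module F1' d1'"]
        onto right_module_kernel[of F1 F0] right_module_kernel[of F1' F0']) simp_all
  have J: "module_isomorphic J (kernel_module F2 d2)"
    unfolding module_isomorphic_def using base
    by (intro exI[of _ j] conjI onto) (auto simp: bij_betw_def)
  have J': "module_isomorphic J' (kernel_module F2' d2')"
    unfolding module_isomorphic_def using base
    by (intro exI[of _ j'] conjI onto) (auto simp: bij_betw_def)
  have r: "right_module (kernel_module F2 d2)" "right_module (kernel_module F2' d2')"
    using base rF by (auto intro: right_module_kernel[of _ F1] right_module_kernel[of _ F1'])
  show ?thesis
    by (rule stably_equivalent_trans[OF module_isomorphic_imp_stably_equivalent[OF J]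
          stably_equivalent_trans[OF K stably_equivalent_sym[OF module_isomorphic_imp_stably_equivalent[OF J']]]])
      (simp_all add: base r)
qed

lemma third_syzygy_eq_stable_module:
  fixes J :: "('r::ring_1, nat \<Rightarrow>\<^sub>0 'r) rmod" and F2 F1 F0 :: "('r, nat \<Rightarrow>\<^sub>0 'r) rmod"
    and K :: "('r, 'k::ab_group_add) rmod"
  assumes J: "exact_free3 J j F2 d2 F1 d1 F0 e N" and K: "module_isomorphic J K" "right_module K"
  shows "(third_syzygy N :: ('r, 'm::ab_group_add) rmod set) = stable_module K"
proof -
  have rJ: "right_module J" using J by (simp add: exact_free3_def)
  have JK: "stably_equivalent J K" and KJ: "stably_equivalent K J"
    using K rJ by (auto intro: module_isomorphic_imp_stably_equivalent module_isomorphic_sym)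
  show ?thesis
  proof (intro set_eqI iffI)
    fix M :: "('r, 'm) rmod" assume "M \<in> third_syzygy N"
    then obtain J' :: "('r, nat \<Rightarrow>\<^sub>0 'r) rmod" and j' and F2' F1' F0' :: "('r, nat \<Rightarrow>\<^sub>0 'r) rmod"
      and d2' d1' e' where J': "exact_free3 J' j' F2' d2' F1' d1' F0' e' N" "M \<in> stable_module J'"
      unfolding third_syzygy_def by blast
    have rJ': "right_module J'" using J' by (simp add: exact_free3_def)
    show "M \<in> stable_module K"
      using J'(2) rJ rJ' JK third_syzygies_stably_equivalent[OF J'(1) J]
      unfolding stable_module_def by (blast intro: stably_equivalent_trans)
  next
    fix M :: "('r, 'm) rmod" assume "M \<in> stable_module K"
    then have "M \<in> stable_module J"
      using KJ K(2) unfolding stable_module_def by (blast intro: stably_equivalent_trans)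
    then show "M \<in> third_syzygy N" using J unfolding third_syzygy_def by blast
  qed
qed

subsection \<open>Integral group rings\<close>

lemma group_ring_expansion:
  fixes a :: "'g \<Rightarrow>\<^sub>0 'c::comm_monoid_add"
  shows "a = (\<Sum>g\<in>Poly_Mapping.keys a. Poly_Mapping.single g (Poly_Mapping.lookup a g))"
proof (rule poly_mapping_eqI)
  fix h
  show "Poly_Mapping.lookup a h =
      Poly_Mapping.lookup (\<Sum>g\<in>Poly_Mapping.keys a. Poly_Mapping.single g (Poly_Mapping.lookup a g)) h"
    by (cases "h \<in> Poly_Mapping.keys a")
      (auto simp: lookup_sum lookup_single when_def in_keys_iff sum.delta)
qed

lemma group_ring_induct [case_names zero single add]:
  fixes a :: "'g \<Rightarrow>\<^sub>0 'c::comm_monoid_add"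
  assumes "P 0" "\<And>g c. P (Poly_Mapping.single g c)" "\<And>a b. P a \<Longrightarrow> P b \<Longrightarrow> P (a + b)"
  shows "P a"
proof -
  have "P (\<Sum>g\<in>A. Poly_Mapping.single g (Poly_Mapping.lookup a g))" for A
    by (induction A rule: infinite_finite_induct) (auto intro: assms)
  then show ?thesis by (subst group_ring_expansion)
qed

lemma lookup_single_mult:
  fixes a :: "'g::group_add \<Rightarrow>\<^sub>0 int"
  shows "Poly_Mapping.lookup (Poly_Mapping.single h 1 * a) g = Poly_Mapping.lookup a (- h + g)"
proof (induction a rule: group_ring_induct)
  case (single k c)
  have "h + k = g \<longleftrightarrow> k = - h + g" by (metis add.assoc add.left_neutral left_minus right_minus)
  then show ?case by (simp add: mult_single lookup_single)
qed (simp_all add: distrib_left lookup_add)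

lemma lookup_mult_single:
  fixes a :: "'g::group_add \<Rightarrow>\<^sub>0 int"
  shows "Poly_Mapping.lookup (a * Poly_Mapping.single h 1) g = Poly_Mapping.lookup a (g - h)"
proof (induction a rule: group_ring_induct)
  case (single k c)
  have "k + h = g \<longleftrightarrow> k = g - h" by auto
  then show ?case by (simp add: mult_single lookup_single)
qed (simp_all add: distrib_right lookup_add)

lemma lookup_of_int_mult:
  fixes a :: "'g::group_add \<Rightarrow>\<^sub>0 int"
  shows "Poly_Mapping.lookup (of_int n * a) g = n * Poly_Mapping.lookup a g"
proof (induction a rule: group_ring_induct)
  case (single k c)
  have "(of_int n :: 'g \<Rightarrow>\<^sub>0 int) = Poly_Mapping.single 0 n"
    by (metis of_int_eq_id id_apply single_of_int)
  then show ?case by (simp add: mult_single lookup_single when_def)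
qed (simp_all add: distrib_left lookup_add)

lemma group_ring_torsion_free:
  fixes a :: "'g::group_add \<Rightarrow>\<^sub>0 int"
  assumes "of_int n * a = 0" "n \<noteq> 0"
  shows "a = 0"
proof (rule poly_mapping_eqI)
  fix g
  show "Poly_Mapping.lookup a g = Poly_Mapping.lookup 0 g"
    using assms lookup_of_int_mult[of n a g] by simp
qed

section \<open>The augmentation homomorphism\<close>

definition augmentation :: "('g \<Rightarrow>\<^sub>0 int) \<Rightarrow> int" where
  "augmentation a = (\<Sum>g\<in>Poly_Mapping.keys a. Poly_Mapping.lookup a g)"

lemma augmentation_add: "augmentation (a + b) = augmentation a + augmentation b"
  unfolding augmentation_def
  using setsum_keys_plus_distrib[where f = "\<lambda>_ c. c" and p = a and q = b] by simp

lemma augmentation_single [simp]: "augmentation (Poly_Mapping.single g c) = c"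
  by (simp add: augmentation_def)

lemma augmentation_zero [simp]: "augmentation 0 = 0"
  by (simp add: augmentation_def)

lemma augmentation_mult:
  fixes a b :: "'g::monoid_add \<Rightarrow>\<^sub>0 int"
  shows "augmentation (a * b) = augmentation a * augmentation b"
proof (induction a rule: group_ring_induct)
  case (single g c)
  show ?case
    by (induction b rule: group_ring_induct)
      (simp_all add: mult_single distrib_left augmentation_add)
qed (simp_all add: distrib_right augmentation_add)

lemma augmentation_uminus: "augmentation (- a) = - augmentation a"
  using augmentation_add[of a "- a"] by simp

lemma left_right_inverse_unique:
  fixes a b c :: "'a::monoid_mult"
  assumes "a * b = 1" "b * c = 1"
  shows "a = c"
  using mult.assoc[of a b c] assms by simp

subsection \<open>Annihilators attached to a cyclic subgroup\<close>

text \<open>\<open>E\<close> is the projection onto the part supported on a transversal of the cyclic group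
  generated by the unit \<open>u\<close>.\<close>

locale cyclic_transversal =
  fixes u v :: "'r::ring_1" and n :: nat and E :: "'r \<Rightarrow> 'r"
  assumes n: "n > 0" and un: "u ^ n = 1" and uv: "u * v = 1"
    and E_add: "E (a + b) = E a + E b"
    and decomp: "a = (\<Sum>j<n. u ^ j * E (v ^ j * a))"
begin

lemma E_zero: "E 0 = 0"
  using E_add[of 0 0] by simp

lemma E_sum: "E (\<Sum>i\<in>I. f i) = (\<Sum>i\<in>I. E (f i))"
  by (induction I rule: infinite_finite_induct) (simp_all add: E_add E_zero)

lemma vu: "v * u = 1"
proof -
  have "u ^ (n - 1) * u = 1" using n un by (metis Suc_diff_1 power_Suc2)
  then show ?thesis using left_right_inverse_unique[OF _ uv] by simp
qed

lemma v_power: "j \<le> n \<Longrightarrow> v ^ j = u ^ (n - j)"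
proof -
  have "v ^ j * u ^ j = 1" for j
  proof (induction j)
    case (Suc j)
    have "v ^ Suc j * u ^ Suc j = v ^ j * (v * u) * u ^ j"
      by (simp only: power_Suc2[of v] power_Suc[of u] mult.assoc)
    then show ?case using Suc by (simp add: vu)
  qed simp
  moreover assume "j \<le> n"
  ultimately have "v ^ j * u ^ j = 1" "u ^ j * u ^ (n - j) = 1"
    by (simp_all add: un flip: power_add)
  then show ?thesis by (rule left_right_inverse_unique)
qed

text \<open>Here \<open>u\<close> fixes \<open>a\<close>, so every coefficient
  \<open>E (v ^ j * a)\<close> in \<open>decomp\<close> equals \<open>E a\<close>.\<close>

lemma annihilator_minus_one:
  assumes "(u - 1) * a = 0"
  shows "a = (\<Sum>j<n. u ^ j) * E a"
proof -
  have "u * a = a" using assms by (simp add: algebra_simps)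
  then have "v * a = a" by (metis mult.assoc mult.left_neutral vu)
  then have "v ^ j * a = a" for j
    by (induction j) (simp_all add: mult.assoc)
  then show ?thesis using decomp[of a] by (simp add: sum_distrib_right)
qed

text \<open>The powers of \<open>v\<close> run through the powers of \<open>u\<close>, so the
  hypothesis makes the sum of all \<open>E (v ^ j * a)\<close> vanish. Subtracting this zero from
  \<open>decomp\<close> turns each \<open>u ^ j\<close> into \<open>u ^ j - 1\<close>, which lies in
  the right ideal of \<open>u - 1\<close>.\<close>

lemma annihilator_sum:
  assumes "(\<Sum>j<n. u ^ j) * a = 0"
  shows "\<exists>b. a = (u - 1) * b"
proof -
  have "(\<Sum>j<n. v ^ j) = u * (\<Sum>j<n. u ^ j)"
  proof -
    have "(\<Sum>j<n. v ^ j) = (\<Sum>j<n. u ^ Suc (n - Suc j))"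
      by (intro sum.cong) (simp_all add: v_power Suc_diff_Suc)
    also have "\<dots> = (\<Sum>j<n. u ^ Suc j)"
      by (rule sum.nat_diff_reindex)
    finally show ?thesis by (simp add: sum_distrib_left)
  qed
  then have "(\<Sum>j<n. v ^ j * a) = 0"
    using assms by (simp add: mult.assoc flip: sum_distrib_right)
  then have 0: "(\<Sum>j<n. E (v ^ j * a)) = 0"
    using E_sum[of "\<lambda>j. v ^ j * a" "{..<n}"] E_zero by simp
  have "\<exists>b. (u ^ j - 1) * c = (u - 1) * b" for j c
  proof (induction j)
    case (Suc j)
    then obtain b where "(u ^ j - 1) * c = (u - 1) * b" by blast
    moreover have "(u ^ Suc j - 1) * c = (u - 1) * (u ^ j * c) + (u ^ j - 1) * c"
      by (simp add: algebra_simps)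
    ultimately have "(u ^ Suc j - 1) * c = (u - 1) * (u ^ j * c + b)"
      by (simp add: distrib_left)
    then show ?case by blast
  qed (auto intro: exI[of _ 0])
  then have "\<forall>j. \<exists>b. (u ^ j - 1) * E (v ^ j * a) = (u - 1) * b"
    by blast
  then obtain B where B: "\<And>j. (u ^ j - 1) * E (v ^ j * a) = (u - 1) * B j"
    by (auto dest: choice)
  have "a = (\<Sum>j<n. u ^ j * E (v ^ j * a)) - (\<Sum>j<n. E (v ^ j * a))"
    using decomp[of a] 0 by simp
  also have "\<dots> = (\<Sum>j<n. (u ^ j - 1) * E (v ^ j * a))"
    by (simp add: sum_subtractf left_diff_distrib)
  also have "\<dots> = (u - 1) * (\<Sum>j<n. B j)"
    unfolding B by (rule sum_distrib_left[symmetric])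
  finally show ?thesis by blast
qed

end

definition restrict_support :: "'g set \<Rightarrow> ('g \<Rightarrow>\<^sub>0 'c::zero) \<Rightarrow> 'g \<Rightarrow>\<^sub>0 'c" where
  "restrict_support T a = Abs_poly_mapping (\<lambda>g. Poly_Mapping.lookup a g when g \<in> T)"

lemma lookup_restrict_support:
  "Poly_Mapping.lookup (restrict_support T a) g = (Poly_Mapping.lookup a g when g \<in> T)"
  unfolding restrict_support_def
  by (subst lookup_Abs_poly_mapping) (auto intro: finite_subset[OF _ finite_lookup[of a]])

text \<open>\<open>c h\<close> is the position of \<open>h\<close> in its orbit under left
  translation by \<open>g\<close>. Exactly one \<open>j < n\<close>, namely \<open>j = c h\<close>,
  translates \<open>h\<close> into the transversal \<open>c = 0\<close>, so only that summand
  contributes at \<open>h\<close>. Writing \<open>c h + n - 1\<close> avoids truncated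
  subtraction.\<close>

lemma cyclic_transversal_group_ring:
  fixes g :: "'g::group_add" and c :: "'g \<Rightarrow> nat"
  assumes n: "n > 0" and un: "Poly_Mapping.single g (1::int) ^ n = 1"
    and c: "\<And>h. c h < n" "\<And>h. c (- g + h) mod n = (c h + n - 1) mod n"
  shows "cyclic_transversal (Poly_Mapping.single g (1::int)) (Poly_Mapping.single (- g) 1) n
    (restrict_support {h. c h = 0})"
proof
  let ?E = "restrict_support {h. c h = 0} :: ('g \<Rightarrow>\<^sub>0 int) \<Rightarrow> _"
  fix a :: "'g \<Rightarrow>\<^sub>0 int"
  have left: "Poly_Mapping.lookup (Poly_Mapping.single (- g) 1 ^ j * b) h =
      Poly_Mapping.lookup b (((+) g ^^ j) h)"
    "Poly_Mapping.lookup (Poly_Mapping.single g 1 ^ j * b) h =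
      Poly_Mapping.lookup b (((+) (- g) ^^ j) h)" for j h and b :: "'g \<Rightarrow>\<^sub>0 int"
    by (induction j arbitrary: h) (simp_all add: mult.assoc lookup_single_mult funpow_swap1)
  have inv: "((+) g ^^ j) (((+) (- g) ^^ j) h) = h" for j h
    by (induction j arbitrary: h) (simp_all add: funpow_swap1 flip: add.assoc)
  have cpow: "c (((+) (- g) ^^ j) h) = (c h + (n - j)) mod n" if "j \<le> n" for j h
    using that
  proof (induction j)
    case 0
    then show ?case using c(1)[of h] by simp
  next
    case (Suc j)
    have "c (((+) (- g) ^^ Suc j) h) = (c (((+) (- g) ^^ j) h) + n - 1) mod n"
      using c(2)[of "((+) (- g) ^^ j) h"] c(1) by simp
    also have "\<dots> = ((c h + (n - j)) mod n + (n - 1)) mod n"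
      using Suc n by simp
    also have "\<dots> = (c h + (n - Suc j) + n) mod n"
      using Suc.prems by (subst mod_add_left_eq) (simp add: algebra_simps)
    finally show ?case by simp
  qed
  have iff: "c (((+) (- g) ^^ j) h) = 0 \<longleftrightarrow> j = c h" if "j < n" for j h
  proof -
    have "(c h + (n - j)) mod n = (if j \<le> c h then c h - j else c h + n - j)"
      using c(1)[of h] that by (auto simp: mod_if)
    then show ?thesis using cpow[of j h] that by auto
  qed
  show "a = (\<Sum>j<n. Poly_Mapping.single g 1 ^ j * ?E (Poly_Mapping.single (- g) 1 ^ j * a))"
  proof (rule poly_mapping_eqI)
    fix h
    have "(\<Sum>j<n. Poly_Mapping.lookup a h when c (((+) (- g) ^^ j) h) = 0) =
        (\<Sum>j<n. if j = c h then Poly_Mapping.lookup a h else 0)"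
      by (intro sum.cong) (auto simp: iff)
    then show "Poly_Mapping.lookup a h = Poly_Mapping.lookup
        (\<Sum>j<n. Poly_Mapping.single g 1 ^ j * ?E (Poly_Mapping.single (- g) 1 ^ j * a)) h"
      using c(1)[of h] by (simp add: lookup_sum left lookup_restrict_support inv)
  qed
qed (auto simp: n un mult_single lookup_restrict_support lookup_add when_def intro!: poly_mapping_eqI)

subsection \<open>The group\<close>

text \<open>The group acts on \<open>\<int>/7\<close> by \<open>x \<cdot> t = t + 1\<close> and \<open>y \<cdot> t = 3t\<close>; together with the exponent sum of \<open>y\<close>
  modulo \<open>6\<close> this separates the \<open>42\<close> elements \<open>x\<^sup>iy\<^sup>j\<close>.\<close>

fun affine_step :: "gen \<times> bool \<Rightarrow> int \<Rightarrow> int" where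
  "affine_step (X, False) t = t + 1"
| "affine_step (X, True) t = t - 1"
| "affine_step (Y, False) t = 3 * t"
| "affine_step (Y, True) t = 5 * t"

fun y_step :: "gen \<times> bool \<Rightarrow> int" where
  "y_step (Y, b) = (if b then - 1 else 1)"
| "y_step (X, b) = 0"

lemma G76_relations_cases:
  assumes "(u, v) \<in> G76_relations"
  obtains "u = replicate 7 (X, False)" "v = []" | "u = replicate 6 (Y, False)" "v = []"
  | "u = [(Y, False), (X, False)]" "v = replicate 3 (X, False) @ [(Y, False)]"
  using assms unfolding G76_relations_def by blast

lemma step_x_power: "(affine_step (X, False) ^^ n) t = t + int n"
  by (induction n) simp_all

lemma step_y_power: "(affine_step (Y, False) ^^ n) t = 3 ^ n * t"
  by (induction n) simp_all

lemma step_mod: "affine_step l (t mod 7) mod 7 = affine_step l t mod 7"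
  by (cases "(l, t)" rule: affine_step.cases) (simp_all add: mod_simps)

lemma foldr_affine_step_mod: "foldr affine_step w (t mod 7) mod 7 = foldr affine_step w t mod 7"
proof (induction w arbitrary: t)
  case (Cons l w)
  have "affine_step l (foldr affine_step w (t mod 7)) mod 7 = affine_step l (foldr affine_step w (t mod 7) mod 7) mod 7"
    by (rule step_mod[symmetric])
  also have "\<dots> = affine_step l (foldr affine_step w t) mod 7"
    unfolding Cons by (rule step_mod)
  finally show ?case by simp
qed simp

lift_definition aff :: "G76 \<Rightarrow> int \<Rightarrow> int" is "\<lambda>w t. foldr affine_step w t mod 7"
proof -
  fix u v assume "presented_eq G76_relations u v"
  then show "(\<lambda>t. foldr affine_step u t mod 7) = (\<lambda>t. foldr affine_step v t mod 7)"
  proof induction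
    case (rel u v)
    then show ?case
    proof (cases rule: G76_relations_cases)
      case 1
      then show ?thesis by (simp add: step_x_power fun_eq_iff)
    next
      case 2
      have "3 ^ 6 * t mod 7 = t mod 7" for t :: int
        using mod_mult_cong[of "3 ^ 6" 7 1 t t] by simp
      with 2 show ?thesis by (simp add: step_y_power fun_eq_iff)
    next
      case 3
      then show ?thesis by (simp add: step_x_power fun_eq_iff algebra_simps)
    qed
  next
    case (cancel s b)
    have "15 * t mod 7 = t mod 7" for t :: int
      using mod_mult_cong[of 15 7 1 t t] by simp
    then show ?case by (cases s; cases b) (simp_all add: fun_eq_iff)
  next
    case (append u v u' v')
    show ?case
    proof
      fix t
      have "foldr affine_step (u @ u') t mod 7 = foldr affine_step u (foldr affine_step u' t mod 7) mod 7"
        by (simp add: foldr_affine_step_mod)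
      also have "\<dots> = foldr affine_step (v @ v') t mod 7"
        using append.IH by (simp add: fun_eq_iff foldr_affine_step_mod)
      finally show "foldr affine_step (u @ u') t mod 7 = foldr affine_step (v @ v') t mod 7" .
    qed
  qed auto
qed

lift_definition y_exp :: "G76 \<Rightarrow> int" is "\<lambda>w. sum_list (map y_step w) mod 6"
proof -
  fix u v assume "presented_eq G76_relations u v"
  then show "sum_list (map y_step u) mod 6 = sum_list (map y_step v) mod 6"
  proof induction
    case (rel u v)
    then show ?case
      by (cases rule: G76_relations_cases) (simp_all add: sum_list_replicate)
  next
    case (cancel s b)
    show ?case by (cases s; cases b) simp_all
  next
    case (append u v u' v')
    then show ?case
      unfolding map_append sum_list_append by (intro mod_add_cong)
  qed auto
qed

lemma aff_add: "aff (g + h) t = aff g (aff h t)"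
  by transfer (simp add: foldr_affine_step_mod)

lemma y_exp_add: "y_exp (g + h) = (y_exp g + y_exp h) mod 6"
  by transfer (simp add: mod_simps)

lemma aff_minus_x: "aff (- gen_elem X) t = (t - 1) mod 7"
  by transfer (simp add: word_inv_def)

lemma y_exp_minus_y: "y_exp (- gen_elem Y) = 5"
  by transfer (simp add: word_inv_def)

lemma aff_range: "0 \<le> aff g t" "aff g t < 7"
  by (transfer; simp)+

lemma y_exp_range: "0 \<le> y_exp g" "y_exp g < 6"
  by (transfer; simp)+

abbreviation gx :: "nat \<Rightarrow> G76" where "gx i \<equiv> abs_G76 (replicate i (X, False))"
abbreviation gy :: "nat \<Rightarrow> G76" where "gy i \<equiv> abs_G76 (replicate i (Y, False))"

lemma gen_x_power: "gen_x ^ i = Poly_Mapping.single (gx i) 1"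
proof (induction i)
  case (Suc i)
  have "gen_elem X + gx i = gx (Suc i)"
    by (simp only: gen_elem.abs_eq plus_G76.abs_eq append.simps replicate.simps)
  then show ?case using Suc by (simp only: gen_x_def mult_single power_Suc mult_1)
qed (simp add: zero_G76_def[symmetric])

lemma gen_y_power: "gen_y ^ i = Poly_Mapping.single (gy i) 1"
proof (induction i)
  case (Suc i)
  have "gen_elem Y + gy i = gy (Suc i)"
    by (simp only: gen_elem.abs_eq plus_G76.abs_eq append.simps replicate.simps)
  then show ?case using Suc by (simp only: gen_y_def mult_single power_Suc mult_1)
qed (simp add: zero_G76_def[symmetric])

lemma gen_x_7: "gen_x ^ 7 = 1"
proof -
  have "gx 7 = 0"
    unfolding zero_G76_def by (subst G76.abs_eq_iff) (rule presented_eq.rel, simp add: G76_relations_def)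
  then show ?thesis by (simp add: gen_x_power)
qed

lemma gen_y_6: "gen_y ^ 6 = 1"
proof -
  have "gy 6 = 0"
    unfolding zero_G76_def by (subst G76.abs_eq_iff) (rule presented_eq.rel, simp add: G76_relations_def)
  then show ?thesis by (simp add: gen_y_power)
qed

lemma gen_y_gen_x: "gen_y * gen_x = gen_x ^ 3 * gen_y"
proof -
  have "gen_elem Y + gen_elem X = gx 3 + gen_elem Y"
    unfolding gen_elem.abs_eq plus_G76.abs_eq
    by (subst G76.abs_eq_iff) (rule presented_eq.rel, simp add: G76_relations_def)
  then show ?thesis by (simp add: gen_x_power gen_y_def mult_single) (simp add: gen_x_def mult_single)
qed

text \<open>The inverses of \<open>x\<close> and \<open>y\<close> are \<open>x^6\<close> and
  \<open>y^5\<close>, so ring operations on the two generators already reach every group element.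
  Claims about actions therefore need checking on \<open>x\<close> and \<open>y\<close>
  only.\<close>

lemma Lam_induct [case_names one x y add uminus mult]:
  fixes a :: Lam
  assumes one: "P 1" and x: "P gen_x" and y: "P gen_y" and add: "\<And>a b. P a \<Longrightarrow> P b \<Longrightarrow> P (a + b)"
    and uminus: "\<And>a. P a \<Longrightarrow> P (- a)" and mult: "\<And>a b. P a \<Longrightarrow> P b \<Longrightarrow> P (a * b)"
  shows "P a"
proof -
  have zero: "P 0" using add[OF one uminus[OF one]] by simp
  have pow: "P (b ^ i)" if "P b" for b i
    by (induction i) (auto simp: one mult that)
  have inverse: "Poly_Mapping.single (- gen_elem X) 1 = gen_x ^ 6" "Poly_Mapping.single (- gen_elem Y) 1 = gen_y ^ 5"
  proof -
    have "Poly_Mapping.single (- gen_elem X) 1 * gen_x = 1" "gen_x * gen_x ^ 6 = 1"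
      using gen_x_7 by (simp add: gen_x_def mult_single, simp flip: power_Suc)
    then show "Poly_Mapping.single (- gen_elem X) 1 = gen_x ^ 6"
      by (rule left_right_inverse_unique)
    have "Poly_Mapping.single (- gen_elem Y) 1 * gen_y = 1" "gen_y * gen_y ^ 5 = 1"
      using gen_y_6 by (simp add: gen_y_def mult_single, simp flip: power_Suc)
    then show "Poly_Mapping.single (- gen_elem Y) 1 = gen_y ^ 5"
      by (rule left_right_inverse_unique)
  qed
  have letter: "P (Poly_Mapping.single (abs_G76 [l]) 1)" for l
  proof -
    have "abs_G76 [(s, True)] = - gen_elem s" for s
      by (simp add: gen_elem.abs_eq uminus_G76.abs_eq word_inv_def)
    then show ?thesis
      using pow[OF x, of 6] pow[OF y, of 5] x y inverse
      by (cases l; cases "fst l"; cases "snd l") (auto simp: gen_elem.abs_eq gen_x_def gen_y_def)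
  qed
  have word: "P (Poly_Mapping.single (abs_G76 w) 1)" for w
  proof (induction w)
    case Nil
    then show ?case using one by (simp add: zero_G76_def[symmetric])
  next
    case (Cons l w)
    have "abs_G76 (l # w) = abs_G76 [l] + abs_G76 w" by (simp add: plus_G76.abs_eq)
    then show ?case
      using mult[OF letter Cons] by (simp add: mult_single)
  qed
  have int: "P (of_int n)" for n
    by (induction n rule: int_induct[of _ 0]) (auto simp: zero intro: add one uminus dest: add[OF _ uminus[OF one]])
  have single: "P (Poly_Mapping.single g n)" for g n
  proof -
    have "Poly_Mapping.single g n = of_int n * Poly_Mapping.single g 1"
      by (metis of_int_eq_id id_apply single_of_int mult_single add_0 mult.right_neutral)
    moreover obtain w where "g = abs_G76 w" by (metis Quotient_G76 Quotient_abs_rep)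
    ultimately show ?thesis using mult[OF int word] by metis
  qed
  show ?thesis
    by (induction a rule: group_ring_induct) (auto intro: zero single add)
qed

text \<open>For \<open>h = x^i y^j\<close> the value \<open>aff h 0\<close> is \<open>i\<close>
  modulo 7, because \<open>y\<close> fixes 0; the transversal consists of the powers of
  \<open>y\<close>.\<close>

lemma cyclic_transversal_x:
  "cyclic_transversal gen_x (Poly_Mapping.single (- gen_elem X) 1) 7 (restrict_support {h. nat (aff h 0) = 0})"
  unfolding gen_x_def
proof (rule cyclic_transversal_group_ring)
  show "Poly_Mapping.single (gen_elem X) (1::int) ^ 7 = 1"
    using gen_x_7 by (simp add: gen_x_def)
  fix h
  show "nat (aff h 0) < 7" using aff_range[of h 0] by auto
  obtain m where m: "aff h 0 = int m" using aff_range(1) by (rule nonneg_int_cases)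
  have "(int m - 1) mod 7 = (int m - 1 + 7) mod 7" by (simp only: mod_add_self2)
  also have "\<dots> = int ((m + 6) mod 7)" by (simp add: zmod_int add.commute)
  finally show "nat (aff (- gen_elem X + h) 0) mod 7 = (nat (aff h 0) + 7 - 1) mod 7"
    by (simp add: aff_add aff_minus_x m add.commute)
qed simp

text \<open>\<open>y_exp\<close> reads off \<open>j\<close> from \<open>x^i y^j\<close>, so the
  transversal consists of the powers of \<open>x\<close>.\<close>

lemma cyclic_transversal_y:
  "cyclic_transversal gen_y (Poly_Mapping.single (- gen_elem Y) 1) 6 (restrict_support {h. nat (y_exp h) = 0})"
  unfolding gen_y_def
proof (rule cyclic_transversal_group_ring)
  show "Poly_Mapping.single (gen_elem Y) (1::int) ^ 6 = 1"
    using gen_y_6 by (simp add: gen_y_def)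
  fix h
  show "nat (y_exp h) < 6" using y_exp_range[of h] by auto
  obtain m where m: "y_exp h = int m" using y_exp_range(1) by (rule nonneg_int_cases)
  have "(5 + int m) mod 6 = int ((m + 5) mod 6)" by (simp add: zmod_int add.commute)
  then show "nat (y_exp (- gen_elem Y + h)) mod 6 = (nat (y_exp h) + 6 - 1) mod 6"
    by (simp add: y_exp_add y_exp_minus_y m add.commute)
qed simp

definition sum_x :: Lam where "sum_x = (\<Sum>i<7. gen_x ^ i)"
definition sum_y :: Lam where "sum_y = (\<Sum>i<6. gen_y ^ i)"

lemma annihilator_sum_x: "sum_x * a = 0 \<Longrightarrow> \<exists>b. a = (gen_x - 1) * b"
  unfolding sum_x_def by (rule cyclic_transversal.annihilator_sum[OF cyclic_transversal_x])

lemma annihilator_sum_y: "sum_y * a = 0 \<Longrightarrow> \<exists>b. a = (gen_y - 1) * b"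
  unfolding sum_y_def by (rule cyclic_transversal.annihilator_sum[OF cyclic_transversal_y])

lemma annihilator_y_minus_one: "(gen_y - 1) * a = 0 \<Longrightarrow> \<exists>b. a = sum_y * b"
  unfolding sum_y_def using cyclic_transversal.annihilator_minus_one[OF cyclic_transversal_y] by blast

subsection \<open>Computing in the group ring\<close>

text \<open>The triple \<open>(c, i, j)\<close> stands for \<open>c x\<^sup>i y\<^sup>j\<close>.\<close>

type_synonym terms = "(int \<times> nat \<times> nat) list"

fun eval_term :: "int \<times> nat \<times> nat \<Rightarrow> Lam" where
  "eval_term (c, i, j) = of_int c * (gen_x ^ i * gen_y ^ j)"

definition eval_terms :: "terms \<Rightarrow> Lam" where
  "eval_terms L = sum_list (map eval_term L)"

fun mult_term :: "int \<times> nat \<times> nat \<Rightarrow> int \<times> nat \<times> nat \<Rightarrow> int \<times> nat \<times> nat" where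
  "mult_term (c, i, j) (d, k, l) = (c * d, (i + 3 ^ j * k) mod 7, (j + l) mod 6)"

definition mult_terms :: "terms \<Rightarrow> terms \<Rightarrow> terms" where
  "mult_terms L M = concat (map (\<lambda>s. map (mult_term s) M) L)"

definition uminus_terms :: "terms \<Rightarrow> terms" where
  "uminus_terms L = map (\<lambda>(c, m). (- c, m)) L"

text \<open>Like monomials are collected one at a time, so the lists need no normal form. On
  concrete lists \<open>simp\<close> evaluates this test, which turns each explicit identity in
  \<Lambda> into integer arithmetic.\<close>

function zero_terms :: "terms \<Rightarrow> bool" where
  "zero_terms [] = True"
| "zero_terms ((c, m) # L) =
     (c + sum_list (map fst (filter (\<lambda>t. snd t = m) L)) = 0 \<and> zero_terms (filter (\<lambda>t. snd t \<noteq> m) L))"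
  by pat_completeness auto
termination by (relation "Wellfounded.measure length") (auto simp: le_imp_less_Suc length_filter_le)

lemma gen_x_mod: "gen_x ^ (i mod 7) = gen_x ^ i"
proof -
  have "gen_x ^ i = gen_x ^ (7 * (i div 7) + i mod 7)" by simp
  then show ?thesis by (simp only: power_add power_mult gen_x_7 power_one mult_1)
qed

lemma gen_y_mod: "gen_y ^ (i mod 6) = gen_y ^ i"
proof -
  have "gen_y ^ i = gen_y ^ (6 * (i div 6) + i mod 6)" by simp
  then show ?thesis by (simp only: power_add power_mult gen_y_6 power_one mult_1)
qed

lemma gen_y_gen_x_power: "gen_y * gen_x ^ k = gen_x ^ (3 * k) * gen_y"
proof (induction k)
  case (Suc k)
  have "gen_y * gen_x ^ Suc k = gen_y * gen_x * gen_x ^ k" by (simp add: mult.assoc)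
  also have "\<dots> = gen_x ^ 3 * (gen_y * gen_x ^ k)" by (simp only: gen_y_gen_x mult.assoc)
  also have "\<dots> = gen_x ^ (3 + 3 * k) * gen_y" by (simp only: Suc power_add mult.assoc)
  finally show ?case by simp
qed simp

lemma gen_y_power_gen_x_power: "gen_y ^ j * gen_x ^ k = gen_x ^ (3 ^ j * k) * gen_y ^ j"
proof (induction j)
  case (Suc j)
  have "gen_y ^ Suc j * gen_x ^ k = gen_y * gen_x ^ (3 ^ j * k) * gen_y ^ j"
    by (simp add: mult.assoc Suc)
  then show ?case by (simp add: gen_y_gen_x_power mult.assoc)
qed simp

lemma eval_mult_term: "eval_term (mult_term s t) = eval_term s * eval_term t"
proof -
  obtain c i j d k l where st: "s = (c, i, j)" "t = (d, k, l)" by (cases s; cases t) auto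
  have "eval_term s * eval_term t = of_int c * gen_x ^ i * gen_y ^ j * of_int d * gen_x ^ k * gen_y ^ l"
    by (simp add: st mult.assoc)
  also have "\<dots> = of_int c * of_int d * gen_x ^ i * (gen_y ^ j * gen_x ^ k) * gen_y ^ l"
    using mult_of_int_commute[of d] by (metis (no_types) mult.assoc)
  also have "\<dots> = eval_term (mult_term s t)"
    by (simp add: st gen_y_power_gen_x_power gen_x_mod gen_y_mod power_add mult.assoc)
  finally show ?thesis by simp
qed

lemma eval_terms_simps [simp]:
  "eval_terms [] = 0" "eval_terms (t # L) = eval_term t + eval_terms L"
  "eval_terms (L @ M) = eval_terms L + eval_terms M"
  by (simp_all add: eval_terms_def)

lemma eval_mult_terms: "eval_terms (mult_terms L M) = eval_terms L * eval_terms M"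
proof (induction L)
  case (Cons s L)
  have "eval_terms (map (mult_term s) M) = eval_term s * eval_terms M"
    by (induction M) (simp_all add: eval_mult_term distrib_left)
  then show ?case using Cons by (simp add: mult_terms_def distrib_right)
qed (simp add: mult_terms_def)

lemma eval_uminus_terms: "eval_terms (uminus_terms L) = - eval_terms L"
  by (induction L) (auto simp: uminus_terms_def)

lemma zero_terms: "zero_terms L \<Longrightarrow> eval_terms L = 0"
proof (induction L rule: zero_terms.induct)
  case (2 c m L)
  obtain i j where m: "m = (i, j)" by (cases m)
  have "eval_terms L = of_int (sum_list (map fst (filter (\<lambda>t. snd t = m) L))) * (gen_x ^ i * gen_y ^ j)
      + eval_terms (filter (\<lambda>t. snd t \<noteq> m) L)"
    by (induction L) (auto simp: m algebra_simps)
  then have "eval_terms ((c, m) # L) =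
      of_int (c + sum_list (map fst (filter (\<lambda>t. snd t = m) L))) * (gen_x ^ i * gen_y ^ j)
      + eval_terms (filter (\<lambda>t. snd t \<noteq> m) L)"
    by (simp add: m algebra_simps)
  moreover have "c + sum_list (map fst (filter (\<lambda>t. snd t = m) L)) = 0"
    and "eval_terms (filter (\<lambda>t. snd t \<noteq> m) L) = 0"
    using 2 by simp_all
  ultimately show ?case by (simp only: of_int_0 mult_zero_left add_0)
qed simp

lemma eval_terms_eqI: "zero_terms (L @ uminus_terms M) \<Longrightarrow> eval_terms L = eval_terms M"
  using zero_terms[of "L @ uminus_terms M"] by (simp add: eval_uminus_terms)

section \<open>The elements \<open>w\<close>, \<open>r\<close>, \<open>g\<close>, \<open>l\<close>
  and the identities between them\<close>

definition w_terms :: terms where "w_terms = [(1, 5, 0), (- 1, 4, 0)]"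
definition Sx_terms :: terms where "Sx_terms = map (\<lambda>i. (1, i, 0)) [0..<7]"
definition Sy_terms :: terms where "Sy_terms = map (\<lambda>j. (1, 0, j)) [0..<6]"
definition r_terms :: terms where "r_terms = mult_terms (mult_terms [(- 1, 1, 0)] Sy_terms) w_terms"
definition g_terms :: terms where "g_terms = [(1, 0, 0), (1, 0, 1), (- 1, 4, 3)]"
text \<open>The right factor is \<open>x - 1\<close>, which gives \<open>l sum_x = 0\<close>. The
  left factor is such that \<open>g\<close> kills \<open>l\<close> and that \<open>y\<close> acts on
  \<open>l\<close> as \<open>(1 + x)^2\<close>.\<close>

definition l_terms :: terms where
  "l_terms = mult_terms [(-1,3,0), (-1,6,0), (1,4,1), (1,2,2), (1,3,2), (1,6,2),
     (1,0,3), (1,3,3), (-1,2,4), (-1,0,5), (-1,3,5), (-1,4,5)] [(1,1,0), (-1,0,0)]"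

definition elt_r :: Lam where "elt_r = eval_terms r_terms"
definition elt_g :: Lam where "elt_g = eval_terms g_terms"
definition elt_l :: Lam where "elt_l = eval_terms l_terms"

lemma sum_x_terms: "sum_x = eval_terms Sx_terms"
  by (simp add: sum_x_def Sx_terms_def eval_terms_def atLeast0LessThan[symmetric] interv_sum_list_conv_sum_set_nat comp_def)

lemma sum_y_terms: "sum_y = eval_terms Sy_terms"
  by (simp add: sum_y_def Sy_terms_def eval_terms_def atLeast0LessThan[symmetric] interv_sum_list_conv_sum_set_nat comp_def)

lemma terms_gen: "1 = eval_terms [(1, 0, 0)]" "gen_x = eval_terms [(1, 1, 0)]" "gen_y = eval_terms [(1, 0, 1)]"
  by simp_all

lemma terms_add: "eval_terms L + eval_terms M = eval_terms (L @ M)" by simp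

lemma terms_diff: "eval_terms L - eval_terms M = eval_terms (L @ uminus_terms M)"
  by (simp add: eval_uminus_terms)

lemmas terms_defs = w_terms_def Sx_terms_def Sy_terms_def r_terms_def g_terms_def l_terms_def
  mult_terms_def uminus_terms_def

lemma elt_g_mult_elt_l: "elt_g * elt_l = 0"
  unfolding elt_g_def elt_l_def eval_mult_terms[symmetric]
  by (rule zero_terms) (simp add: terms_defs)

lemma gen_x_minus_one_mult_sum_x: "(gen_x - 1) * sum_x = 0"
  unfolding sum_x_terms terms_gen terms_diff eval_mult_terms[symmetric]
  by (rule zero_terms) (simp add: terms_defs upt_rec)

lemma elt_l_mult_sum_x: "elt_l * sum_x = 0"
proof -
  have "eval_terms [(1,1,0), (-1,0,0)] = gen_x - 1" by simp
  then show ?thesis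
    by (simp only: elt_l_def l_terms_def eval_mult_terms mult.assoc gen_x_minus_one_mult_sum_x mult_zero_right)
qed

lemma elt_l_mult_gen_y: "elt_l * gen_y = elt_l * (1 + gen_x) ^ 2"
  unfolding elt_l_def terms_gen power2_eq_square terms_add eval_mult_terms[symmetric]
  by (rule eval_terms_eqI) (simp add: terms_defs)

text \<open>With \<open>k\<close> the five-term factor, left multiplication by
  \<open>1 - k g\<close> is the identity on the annihilator of \<open>g\<close>. The relation sends
  (x - 1)\<Lambda> into l\<Lambda>, so whatever \<open>g\<close> kills in (x - 1)\<Lambda> lies in
  l\<Lambda>.\<close>

lemma elt_g_elt_l_relation:
  "(1 - eval_terms [(1,0,0), (1,1,1), (1,4,2), (-1,5,3), (-1,2,4)] * elt_g) * (gen_x - 1) =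
    elt_l * eval_terms [(1,0,0), (-1,4,1)]"
  unfolding elt_l_def elt_g_def terms_gen terms_diff eval_mult_terms[symmetric]
  by (rule eval_terms_eqI) (simp add: terms_defs)

text \<open>Modulo g\<Lambda> this says that \<open>sum_x\<close> is zero, and
  \<open>gen_y_plus_in_elt_g\<close> says that \<open>y\<close> equals \<open>- (1 + x)\<close>.
  Together they make \<Lambda>/g\<Lambda> an image of \<int>[\<zeta>].\<close>

lemma sum_x_in_elt_g:
  "elt_g * eval_terms [(1,2,0), (1,6,0), (-1,6,1), (1,0,2), (1,3,2), (1,4,2), (1,6,2),
     (-1,0,3), (-1,4,3), (1,0,4), (1,1,5), (1,4,5), (1,5,5)] = sum_x"
  unfolding elt_g_def sum_x_terms eval_mult_terms[symmetric]
  by (rule eval_terms_eqI) (simp add: terms_defs upt_rec)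

lemma gen_y_plus_in_elt_g:
  "elt_g * eval_terms [(1,0,0), (1,6,2), (1,5,5)] = gen_y + 1 + gen_x"
  unfolding elt_g_def terms_gen terms_add eval_mult_terms[symmetric]
  by (rule eval_terms_eqI) (simp add: terms_defs)

text \<open>As \<open>sum_x\<close> absorbs powers of \<open>x\<close> and commutes with
  \<open>y\<close>, it turns \<open>g\<close> into \<open>1 + y - y^3\<close>. The six-term factor
  is 7 times the inverse of that element in the rational group ring of the cyclic group of
  \<open>y\<close>.\<close>

lemma sum_x_elt_g_relation:
  "eval_terms [(2,0,0), (-1,0,1), (4,0,2), (-2,0,3), (1,0,4), (3,0,5)] * (sum_x * elt_g) = of_int 7 * sum_x"
proof -
  let ?f = "eval_terms [(1,0,0), (1,0,1), (-1,0,3)]"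
  have 1: "sum_x * elt_g = ?f * sum_x"
    unfolding elt_g_def sum_x_terms eval_mult_terms[symmetric]
    by (rule eval_terms_eqI) (simp add: terms_defs upt_rec)
  have 2: "eval_terms [(2,0,0), (-1,0,1), (4,0,2), (-2,0,3), (1,0,4), (3,0,5)] * ?f = eval_terms [(7,0,0)]"
    unfolding eval_mult_terms[symmetric] by (rule eval_terms_eqI) (simp add: terms_defs)
  show ?thesis unfolding 1 mult.assoc[symmetric] 2 by simp
qed

lemma sum_y_mult_elt_r: "sum_y * elt_r = sum_y * eval_terms w_terms"
  unfolding elt_r_def sum_y_terms eval_mult_terms[symmetric]
  by (rule eval_terms_eqI) (simp add: terms_defs upt_rec)

lemma elt_r_mult_sum_x: "elt_r * sum_x = 0"
  unfolding elt_r_def sum_x_terms eval_mult_terms[symmetric]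
  by (rule zero_terms) (simp add: terms_defs upt_rec)

lemma elt_r_mult_gen_y: "elt_r * gen_y = - (elt_r * (1 + gen_x))"
  unfolding elt_r_def terms_gen terms_add eval_mult_terms[symmetric] eval_uminus_terms[symmetric]
  by (rule eval_terms_eqI) (simp add: terms_defs upt_rec)

lemma elt_r_mult_elt_g: "elt_r * elt_g = 0"
  unfolding elt_r_def elt_g_def eval_mult_terms[symmetric]
  by (rule zero_terms) (simp add: terms_defs upt_rec)

subsection \<open>Integer polynomials evaluated in a ring\<close>

text \<open>The library's evaluation \<open>poly\<close> needs a commutative ring, which the group ring is not.\<close>

definition ipoly :: "'r::ring_1 \<Rightarrow> int poly \<Rightarrow> 'r" where
  "ipoly c p = fold_coeffs (\<lambda>a b. of_int a + c * b) p 0"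

lemma ipoly_0 [simp]: "ipoly c 0 = 0"
  by (simp add: ipoly_def)

lemma ipoly_pCons [simp]: "ipoly c (pCons a p) = of_int a + c * ipoly c p"
  by (cases "p = 0 \<and> a = 0") (auto simp: ipoly_def)

lemma ipoly_1 [simp]: "ipoly c 1 = 1"
  by (simp add: one_pCons)

lemma ipoly_add: "ipoly c (p + q) = ipoly c p + ipoly c q"
proof (induction p arbitrary: q)
  case (pCons a p)
  then show ?case by (cases q) (simp add: algebra_simps)
qed simp

lemma ipoly_uminus: "ipoly c (- p) = - ipoly c p"
  using ipoly_add[of c p "- p"] by (simp add: minus_unique)

lemma ipoly_diff: "ipoly c (p - q) = ipoly c p - ipoly c q"
  using ipoly_add[of c p "- q"] by (simp add: ipoly_uminus)

lemma ipoly_smult: "ipoly c (smult a p) = of_int a * ipoly c p"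
proof (induction p)
  case (pCons b p)
  have "c * (of_int a * ipoly c p) = of_int a * (c * ipoly c p)"
    using mult_of_int_commute[of a c] by (metis mult.assoc)
  then show ?case using pCons by (simp add: distrib_left)
qed simp

lemma ipoly_mult: "ipoly c (p * q) = ipoly c p * ipoly c q"
  by (induction p) (simp_all add: mult_pCons_left ipoly_add ipoly_smult distrib_right mult.assoc)

lemma ipoly_power: "ipoly c (p ^ n) = ipoly c p ^ n"
  by (induction n) (simp_all add: ipoly_mult)

lemma ipoly_sum: "ipoly c (\<Sum>i\<in>I. f i) = (\<Sum>i\<in>I. ipoly c (f i))"
  by (induction I rule: infinite_finite_induct) (simp_all add: ipoly_add)

lemma ipoly_pcompose: "ipoly c (p \<circ>\<^sub>p q) = ipoly (ipoly c q) p"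
  by (induction p) (simp_all add: pcompose_pCons ipoly_add ipoly_mult)

lemma ipoly_eq_poly: "ipoly c p = poly (map_poly of_int p) c" for c :: "'r::comm_ring_1"
  by (induction p) (simp_all add: map_poly_pCons)

subsection \<open>The ring \<open>\<int>[\<zeta>]\<close>\<close>

definition cyc7 :: "int poly" where "cyc7 = [:1, 1, 1, 1, 1, 1, 1:]"

lemma ipoly_cyc7: "ipoly c cyc7 = 1 + c + c ^ 2 + c ^ 3 + c ^ 4 + c ^ 5 + c ^ 6"
  by (simp add: cyc7_def distrib_left eval_nat_numeral)

lemma ipoly_cyc7_gen_x: "ipoly gen_x cyc7 = sum_x"
  by (simp add: ipoly_cyc7 sum_x_def eval_nat_numeral add.assoc)

lemma zeta_7: "zeta ^ 7 = 1"
proof -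
  have "zeta ^ 7 = exp (of_nat 7 * (2 * pi * \<i> / 7))"
    unfolding zeta_def by (rule exp_of_nat_mult[symmetric])
  then show ?thesis by (simp add: exp_eq_1)
qed

lemma zeta_neq_1: "zeta \<noteq> 1"
proof
  assume "zeta = 1"
  then obtain n :: int where "2 * pi / 7 = of_int (2 * n) * pi"
    unfolding zeta_def exp_eq_1 by auto
  then have "real_of_int (7 * n) = 1" by (simp add: field_simps)
  then have "7 * n = 1" by linarith
  then show False by presburger
qed

lemma zeta_nonzero: "zeta \<noteq> 0"
  by (simp add: zeta_def)

lemma zeta_power_mod: "zeta ^ (i mod 7) = zeta ^ i"
proof -
  have "zeta ^ i = zeta ^ (7 * (i div 7) + i mod 7)" by simp
  then show ?thesis by (simp only: power_add power_mult zeta_7 power_one mult_1)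
qed

lemma ipoly_cyc7_root:
  fixes z :: "'a::{idom}"
  assumes "z ^ 7 = 1" "z \<noteq> 1"
  shows "ipoly z cyc7 = 0"
proof -
  have "(z - 1) * ipoly z cyc7 = z ^ 7 - 1"
    by (simp add: ipoly_cyc7 algebra_simps eval_nat_numeral)
  then show ?thesis using assms by simp
qed

text \<open>The hypothesis exhibits \<zeta> as a power of \<open>zeta ^ i\<close>, which is
  therefore a seventh root of unity other than 1.\<close>

lemma ipoly_cyc7_zeta_power:
  assumes "i * j mod 7 = 1"
  shows "ipoly (zeta ^ i) cyc7 = 0"
proof (rule ipoly_cyc7_root)
  show "(zeta ^ i) ^ 7 = 1"
    by (metis mult.commute power_mult power_one zeta_7)
  have "(zeta ^ i) ^ j = zeta"
    using zeta_power_mod[of "i * j"] assms by (simp add: power_mult)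
  then show "zeta ^ i \<noteq> 1" using zeta_neq_1 by auto
qed

lemma Z_zeta_iff: "u \<in> Z_zeta \<longleftrightarrow> (\<exists>p. u = ipoly zeta p)"
  by (auto simp: Z_zeta_def ipoly_eq_poly)

lemma ipoly_in_Z_zeta [simp, intro]: "ipoly zeta p \<in> Z_zeta"
  by (auto simp: Z_zeta_iff)

lemma Z_zeta_add [intro]: "u \<in> Z_zeta \<Longrightarrow> v \<in> Z_zeta \<Longrightarrow> u + v \<in> Z_zeta"
  unfolding Z_zeta_iff by (metis ipoly_add)

lemma Z_zeta_mult [intro]: "u \<in> Z_zeta \<Longrightarrow> v \<in> Z_zeta \<Longrightarrow> u * v \<in> Z_zeta"
  unfolding Z_zeta_iff by (metis ipoly_mult)

lemma Z_zeta_uminus [intro]: "u \<in> Z_zeta \<Longrightarrow> - u \<in> Z_zeta"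
  unfolding Z_zeta_iff by (metis ipoly_uminus)

lemma Z_zeta_of_int [simp, intro]: "of_int n \<in> Z_zeta"
  unfolding Z_zeta_iff by (rule exI[of _ "[:n:]"]) simp

lemma Z_zeta_1 [simp, intro]: "1 \<in> Z_zeta"
  using Z_zeta_of_int[of 1] by simp

lemma Z_zeta_zeta [simp, intro]: "zeta \<in> Z_zeta"
  unfolding Z_zeta_iff by (rule exI[of _ "[:0, 1:]"]) simp

lemma Z_zeta_power [intro]: "u \<in> Z_zeta \<Longrightarrow> u ^ n \<in> Z_zeta"
  by (induction n) auto

lemma Z_zeta_diff [intro]: "u \<in> Z_zeta \<Longrightarrow> v \<in> Z_zeta \<Longrightarrow> u - v \<in> Z_zeta"
  using Z_zeta_add[OF _ Z_zeta_uminus] by fastforce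

lemma Z_zeta_sum [intro]: "(\<And>i. i \<in> I \<Longrightarrow> f i \<in> Z_zeta) \<Longrightarrow> sum f I \<in> Z_zeta"
  by (induction I rule: infinite_finite_induct) (use Z_zeta_of_int[of 0] in auto)

section \<open>Digit expansions in powers of \<open>X - 1\<close>\<close>

definition radix :: "(nat \<Rightarrow> int) \<Rightarrow> int poly" where
  "radix c = (\<Sum>k<6. smult (c k) ([:-1, 1:] ^ k))"

lemma ipoly_radix: "ipoly z (radix c) = (\<Sum>k<6. of_int (c k) * (z - 1) ^ k)"
  by (simp add: radix_def ipoly_sum ipoly_smult ipoly_power)

lemma cyc7_shift:
  "cyc7 = smult 7 1 + smult 21 ([:-1, 1:] ^ 1) + smult 35 ([:-1, 1:] ^ 2) + smult 35 ([:-1, 1:] ^ 3)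
    + smult 21 ([:-1, 1:] ^ 4) + smult 7 ([:-1, 1:] ^ 5) + [:-1, 1:] ^ 6"
  by (simp add: cyc7_def eval_nat_numeral one_pCons)

lemma radix_add: "radix c + radix d = radix (\<lambda>k. c k + d k)"
  by (simp add: radix_def smult_add_left sum.distrib)

text \<open>Division by the monic \<open>cyc7\<close>, with the remainder written in powers of
  \<open>X - 1\<close> because these give the prescribed basis after evaluation at \<zeta>.\<close>

lemma radix_expansion: "\<exists>q c. p = cyc7 * q + radix c"
proof (induction p)
  case 0
  show ?case by (rule exI[of _ 0], rule exI[of _ "\<lambda>_. 0"]) (simp add: radix_def)
next
  case (pCons a p)
  then obtain q c where p: "p = cyc7 * q + radix c" by blast
  \<comment> \<open>The lower coefficients of \<open>cyc7\<close> in powers of \<open>X - 1\<close>,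
    that is, the binomial coefficients 7 over \<open>k + 1\<close>.\<close>
  define e :: "nat \<Rightarrow> int" where "e k = [7, 21, 35, 35, 21, 7] ! k" for k
  let ?L = "[:-1, 1:] :: int poly"
  \<comment> \<open>The top digit \<open>c 5\<close> moves to the sixth power of \<open>?L\<close>,
    which is \<open>cyc7\<close> minus the combination of lower powers with coefficients
    \<open>e\<close>.\<close>
  have shift: "?L * radix c = cyc7 * [:c 5:] + radix (\<lambda>k. (if k = 0 then 0 else c (k - 1)) - c 5 * e k)"
    unfolding cyc7_shift by (simp add: radix_def e_def eval_nat_numeral algebra_simps smult_diff_left smult_add_right)
  have const: "[:a:] = radix (\<lambda>k. if k = 0 then a else 0)"
    by (simp add: radix_def if_distrib[of "\<lambda>a. smult a _"] sum.delta cong: if_cong)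
  have "pCons a p = [:a:] + pCons 0 1 * p" by simp
  also have "pCons 0 (1 :: int poly) = ?L + 1" by (simp add: one_pCons)
  also have "[:a:] + (?L + 1) * p = cyc7 * ((?L + 1) * q) + ([:a:] + ?L * radix c + radix c)"
    unfolding p by (simp only: distrib_left distrib_right mult_1 mult_ac add_ac)
  also have "\<dots> = cyc7 * ((?L + 1) * q + [:c 5:]) + radix (\<lambda>k. (if k = 0 then a else 0) +
      ((if k = 0 then 0 else c (k - 1)) - c 5 * e k) + c k)"
    unfolding shift const radix_add[symmetric] by (simp only: distrib_left add_ac)
  finally show ?case by blast
qed

subsection \<open>The index type and the basis \<open>(\<zeta> - 1)\<^sup>j\<close>\<close>

lemma idx_less: "j < k \<Longrightarrow> idx j < idx k"
  unfolding idx_def by (intro psubset_card_mono) auto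

lemma idx_inj: "inj idx"
  by (intro injI) (metis idx_less less_irrefl linorder_neqE)

lemma idx_less_iff: "idx j < idx k \<longleftrightarrow> j < k"
  by (metis idx_less less_asym linorder_neqE)

lemma idx_range: "1 \<le> idx j \<and> idx j \<le> 6"
proof -
  have "idx j \<le> CARD(6)"
    unfolding idx_def by (intro card_mono) auto
  moreover have "1 \<le> idx j"
    unfolding idx_def by (simp add: Suc_leI card_gt_0_iff)
  ultimately show ?thesis by simp
qed

lemma idx_bij: "bij_betw idx UNIV {1..6}"
proof -
  have "idx ` UNIV \<subseteq> {1..6}" using idx_range by auto
  moreover have "card (idx ` UNIV) = card {1..6::nat}"
    by (simp add: card_image idx_inj)
  ultimately have "idx ` UNIV = {1..6}" by (intro card_subset_eq) auto
  then show ?thesis by (simp add: bij_betw_def idx_inj)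
qed

definition pi_sum :: "int ^ 6 \<Rightarrow> complex" where
  "pi_sum r = (\<Sum>j\<in>UNIV. of_int (r $ j) * (zeta - 1) ^ idx j)"

text \<open>Indices start at 1, so one factor \<open>zeta - 1\<close> splits off and the exponents 0
  to 5 remain.\<close>

lemma pi_sum_idx: "pi_sum (\<chi> j. c (idx j)) = (zeta - 1) * (\<Sum>k<6. of_int (c (Suc k)) * (zeta - 1) ^ k)"
proof -
  have "pi_sum (\<chi> j. c (idx j)) = (\<Sum>k\<in>{1..6}. of_int (c k) * (zeta - 1) ^ k)"
    unfolding pi_sum_def
    using sum.reindex_bij_betw[OF idx_bij, of "\<lambda>k. of_int (c k) * (zeta - 1) ^ k"] by simp
  also have "{1..6} = Suc ` {..<6}"
    by (auto simp: image_iff Bex_def) presburger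
  finally show ?thesis
    by (simp add: sum.reindex sum_distrib_left algebra_simps)
qed

lemma vec_idx: obtains c where "r = (\<chi> j. c (idx j))"
  using that[of "\<lambda>k. r $ inv idx k"] by (simp add: idx_inj vec_eq_iff)

lemma pi_sum_add: "pi_sum (r + s) = pi_sum r + pi_sum s"
  by (simp add: pi_sum_def distrib_right sum.distrib)

lemma pi_sum_zero: "pi_sum 0 = 0"
  by (simp add: pi_sum_def)

lemma Z_zeta_expansion:
  assumes "u \<in> Z_zeta"
  obtains c where "u = (\<Sum>k<6. of_int (c k) * (zeta - 1) ^ k)"
proof -
  obtain p where p: "u = ipoly zeta p" using assms by (auto simp: Z_zeta_iff)
  obtain q c where "p = cyc7 * q + radix c" using radix_expansion by blast
  then have "u = (\<Sum>k<6. of_int (c k) * (zeta - 1) ^ k)"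
    using ipoly_cyc7_zeta_power[of 1 1] by (simp add: p ipoly_add ipoly_mult ipoly_radix)
  then show thesis by (rule that)
qed

lemma Z_zeta_pi: "zeta - 1 \<in> Z_zeta"
  by auto

lemma range_pi_sum: "range pi_sum = (\<lambda>w. (zeta - 1) * w) ` Z_zeta"
proof (intro subset_antisym subsetI)
  fix v assume "v \<in> range pi_sum"
  then obtain r where "v = pi_sum r" by blast
  moreover obtain c where "r = (\<chi> j. c (idx j))" by (rule vec_idx)
  ultimately have "v = (zeta - 1) * (\<Sum>k<6. of_int (c (Suc k)) * (zeta - 1) ^ k)"
    by (simp only: pi_sum_idx)
  then show "v \<in> (\<lambda>w. (zeta - 1) * w) ` Z_zeta"
    by (rule image_eqI)
      (intro Z_zeta_sum Z_zeta_mult Z_zeta_of_int Z_zeta_power Z_zeta_pi)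
next
  fix v assume "v \<in> (\<lambda>w. (zeta - 1) * w) ` Z_zeta"
  then obtain w where w: "w \<in> Z_zeta" "v = (zeta - 1) * w" by blast
  obtain c where "w = (\<Sum>k<6. of_int (c k) * (zeta - 1) ^ k)"
    using w(1) by (rule Z_zeta_expansion)
  then have "v = pi_sum (\<chi> j. c (idx j - 1))"
    using pi_sum_idx[of "\<lambda>k. c (k - 1)"] w(2) by simp
  then show "v \<in> range pi_sum" by (rule range_eqI)
qed

section \<open>Linear independence of the powers of \<open>zeta - 1\<close>\<close>

lemma det_of_int:
  fixes A :: "int ^ 'n ^ 'n"
  shows "det (\<chi> i j. (of_int (A $ i $ j) :: 'a::comm_ring_1)) = of_int (det A)"
  by (simp add: det_def)

lemma seven_mult_eq_0: "7 * z = (0 :: 7)"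
proof -
  have "(7 :: 7) = 0" by simp
  then have "7 * z = 0 * z" by (rule arg_cong)
  then show ?thesis by (simp only: mult_zero_left)
qed

text \<open>Multiplication by a putative \<open>1/7\<close> would be an integral matrix \<open>A\<close>, and \<open>1 - 7A\<close> is
  invertible modulo \<open>7\<close>.\<close>

lemma seven_not_unit:
  assumes "s \<in> Z_zeta"
  shows "7 * s \<noteq> 1"
proof
  assume 7: "7 * s = 1"
  have "\<exists>r. s * (zeta - 1) ^ idx i = pi_sum r" for i
  proof -
    obtain k where "idx i = Suc k" using idx_range[of i] by (cases "idx i") auto
    then have "s * (zeta - 1) ^ idx i = (zeta - 1) * (s * (zeta - 1) ^ k)" by simp
    moreover have "s * (zeta - 1) ^ k \<in> Z_zeta" using assms Z_zeta_pi by blast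
    ultimately show ?thesis using range_pi_sum by (metis image_iff rangeE)
  qed
  then obtain a where a: "\<And>i. s * (zeta - 1) ^ idx i = pi_sum (a i)" by metis
  define B :: "int ^ 6 ^ 6" where "B = (\<chi> i j. (if i = j then 1 else 0) - 7 * a i $ j)"
  define v :: "complex ^ 6" where "v = (\<chi> j. (zeta - 1) ^ idx j)"
  have "((\<chi> i j. of_int (B $ i $ j)) *v v) $ i = 0" for i
  proof -
    have "((\<chi> i j. of_int (B $ i $ j)) *v v) $ i =
        (\<Sum>j\<in>UNIV. (if i = j then v $ j else 0) - 7 * (of_int (a i $ j) * v $ j))"
      unfolding matrix_vector_mult_def by (auto intro!: sum.cong simp: B_def algebra_simps)
    also have "\<dots> = v $ i - 7 * pi_sum (a i)"
      by (simp add: sum_subtractf pi_sum_def v_def flip: sum_distrib_left)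
    also have "\<dots> = 0"
      using 7 by (simp add: v_def flip: a mult.assoc)
    finally show ?thesis .
  qed
  then have "(\<chi> i j. of_int (B $ i $ j)) *v v = 0" by (simp add: vec_eq_iff)
  moreover have "v \<noteq> 0" using zeta_neq_1 by (simp add: v_def vec_eq_iff)
  ultimately have "det (\<chi> i j. (of_int (B $ i $ j) :: complex)) = 0"
    by (metis invertible_det_nz invertible_def matrix_left_invertible_ker)
  then have "det B = 0" by (simp add: det_of_int)
  then have "det (\<chi> i j. (of_int (B $ i $ j) :: 7)) = 0" by (simp add: det_of_int)
  moreover have "(\<chi> i j. (of_int (B $ i $ j) :: 7)) = mat 1"
    by (simp add: B_def mat_def vec_eq_iff seven_mult_eq_0)
  ultimately show False by simp
qed

lemma pi_power_6: "(zeta - 1) ^ 6 = 7 * ipoly zeta [:0, -1, 2, -3, 2, -1:]"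
proof -
  have "(zeta - 1) ^ 6 = ipoly zeta cyc7 + 7 * ipoly zeta [:0, -1, 2, -3, 2, -1:]"
    unfolding ipoly_cyc7 by (simp add: algebra_simps eval_nat_numeral)
  then show ?thesis using ipoly_cyc7_zeta_power[of 1 1] by simp
qed

text \<open>The cofactor is the inverse of the unit occurring in \<open>pi_power_6\<close>, so 7 and
  \<open>(zeta - 1) ^ 6\<close> generate the same ideal. The second polynomial in the proof is the
  quotient by \<open>cyc7\<close> of the difference of the two sides.\<close>

lemma seven_eq_pi_power: "7 = (zeta - 1) ^ 6 * ipoly zeta [:3, 3, 0, -4, -6, -4:]"
proof -
  have "(zeta - 1) ^ 6 * ipoly zeta [:3, 3, 0, -4, -6, -4:] =
      7 + ipoly zeta cyc7 * ipoly zeta [:-4, -11, 42, -46, 22, -4:]"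
    unfolding ipoly_cyc7 by (simp add: algebra_simps eval_nat_numeral)
  then show ?thesis using ipoly_cyc7_zeta_power[of 1 1] by simp
qed

text \<open>Otherwise Bezout writes 1 as a combination of \<open>n\<close> and 7, both multiples of
  \<open>zeta - 1\<close>. Then \<open>zeta - 1\<close> is a unit, and so is its sixth power, a
  multiple of 7.\<close>

lemma pi_dvd_int:
  assumes "of_int n = (zeta - 1) * t" "t \<in> Z_zeta"
  shows "7 dvd n"
proof (rule ccontr)
  assume "\<not> 7 dvd n"
  then have "coprime n 7"
    using prime_imp_coprime[of 7 n] by (simp add: coprime_commute)
  then obtain a b where ab: "a * n + b * 7 = 1"
    using bezout_int[of n 7] by auto
  define T where "T = of_int a * t + of_int b * ((zeta - 1) ^ 5 * ipoly zeta [:3, 3, 0, -4, -6, -4:])"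
  have T: "T \<in> Z_zeta" unfolding T_def using assms(2) Z_zeta_pi by blast
  have "(1 :: complex) = of_int (a * n + b * 7)" by (simp only: ab of_int_1)
  also have "\<dots> = of_int a * of_int n + of_int b * 7" by simp
  also have "\<dots> = (zeta - 1) * T"
    unfolding assms(1) T_def by (subst seven_eq_pi_power) (simp add: algebra_simps eval_nat_numeral)
  finally have "1 = (zeta - 1) ^ 6 * T ^ 6"
    by (metis power_mult_distrib power_one)
  then have "7 * (ipoly zeta [:0, -1, 2, -3, 2, -1:] * T ^ 6) = 1"
    unfolding pi_power_6 by (simp only: mult.assoc)
  moreover have "ipoly zeta [:0, -1, 2, -3, 2, -1:] * T ^ 6 \<in> Z_zeta"
    using T by blast
  ultimately show False using seven_not_unit by blast
qed

text \<open>All terms other than the \<open>k\<close>-th are divisible by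
  \<open>(zeta - 1) ^ Suc k\<close>: the later ones by their exponent, the earlier ones because 7
  divides their coefficient by induction and contributes a sixth power. Hence
  \<open>zeta - 1\<close> divides \<open>c k\<close>.\<close>

lemma pi_sum_zero_imp_dvd:
  assumes "(\<Sum>k<6. of_int (c k) * (zeta - 1) ^ k) = 0" "k < 6"
  shows "7 dvd c k"
  using assms(2)
proof (induction k rule: less_induct)
  case (less k)
  have "\<exists>z\<in>Z_zeta. of_int (c j) * (zeta - 1) ^ j = (zeta - 1) ^ Suc k * z" if "j < 6" "j \<noteq> k" for j
  proof (cases "j < k")
    case True
    then obtain d where d: "c j = 7 * d" using less.IH less.prems by (meson dvdE less_trans)
    have "6 + j = Suc k + (5 + j - k)" using less.prems by simp
    then have exps: "(zeta - 1) ^ 6 * (zeta - 1) ^ j = (zeta - 1) ^ Suc k * (zeta - 1) ^ (5 + j - k)"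
      by (simp only: power_add[symmetric])
    have "of_int (c j) * (zeta - 1) ^ j = of_int d * (7 * (zeta - 1) ^ j)" by (simp add: d)
    also have "\<dots> = of_int d * ipoly zeta [:3, 3, 0, -4, -6, -4:] * ((zeta - 1) ^ 6 * (zeta - 1) ^ j)"
      by (subst seven_eq_pi_power) (simp only: mult_ac)
    also have "\<dots> = (zeta - 1) ^ Suc k * (of_int d * ipoly zeta [:3, 3, 0, -4, -6, -4:] * (zeta - 1) ^ (5 + j - k))"
      unfolding exps by (simp only: mult_ac)
    finally show ?thesis using Z_zeta_pi by blast
  next
    case False
    then have "(zeta - 1) ^ j = (zeta - 1) ^ Suc k * (zeta - 1) ^ (j - Suc k)"
      using that(2) by (simp only: power_add[symmetric]) simp
    then have "of_int (c j) * (zeta - 1) ^ j = (zeta - 1) ^ Suc k * (of_int (c j) * (zeta - 1) ^ (j - Suc k))"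
      by (simp only: mult_ac)
    then show ?thesis using Z_zeta_pi by blast
  qed
  then have "\<forall>j\<in>{..<6} - {k}. \<exists>z. z \<in> Z_zeta \<and> of_int (c j) * (zeta - 1) ^ j = (zeta - 1) ^ Suc k * z"
    by blast
  from bchoice[OF this] obtain z where z: "\<forall>j\<in>{..<6} - {k}. z j \<in> Z_zeta \<and>
      of_int (c j) * (zeta - 1) ^ j = (zeta - 1) ^ Suc k * z j"
    by blast
  have "0 = of_int (c k) * (zeta - 1) ^ k + (\<Sum>j\<in>{..<6} - {k}. of_int (c j) * (zeta - 1) ^ j)"
    using assms(1) less.prems by (subst (asm) sum.remove[of _ k]) auto
  also have "(\<Sum>j\<in>{..<6} - {k}. of_int (c j) * (zeta - 1) ^ j) = (zeta - 1) ^ Suc k * sum z ({..<6} - {k})"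
    unfolding sum_distrib_left using z by (intro sum.cong) blast+
  finally have "(zeta - 1) ^ k * (of_int (c k) + (zeta - 1) * sum z ({..<6} - {k})) = 0"
    by (simp add: algebra_simps)
  then have "of_int (c k) = (zeta - 1) * - sum z ({..<6} - {k})"
    using zeta_neq_1 by (simp add: eq_neg_iff_add_eq_0)
  then show ?case by (rule pi_dvd_int) (use z in blast)
qed

text \<open>Infinite descent: dividing a relation by 7 gives another relation, so each coefficient
  is divisible by every power of 7.\<close>

lemma pi_powers_independent:
  assumes "(\<Sum>k<6. of_int (c k) * (zeta - 1) ^ k) = 0" "k < 6"
  shows "c k = 0"
proof -
  have "7 ^ n dvd c k" for n
    using assms
  proof (induction n arbitrary: c)
    case (Suc n)
    have "\<forall>k<6. 7 dvd c k" using pi_sum_zero_imp_dvd[OF Suc.prems(1)] by blast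
    then have d: "c k = 7 * (c k div 7)" if "k < 6" for k using that by auto
    have "7 * (\<Sum>k<6. of_int (c k div 7) * (zeta - 1) ^ k) = (\<Sum>k<6. of_int (7 * (c k div 7)) * (zeta - 1) ^ k)"
      by (simp add: sum_distrib_left mult.assoc)
    also have "\<dots> = (\<Sum>k<6. of_int (c k) * (zeta - 1) ^ k)"
      using d by (intro sum.cong) (auto simp del: of_int_mult)
    finally have "7 ^ n dvd c k div 7"
      using Suc by (intro Suc.IH) simp_all
    then show ?case using d[OF assms(2)] by (metis mult_dvd_mono dvd_refl power_Suc)
  qed simp
  then have "7 ^ nat \<bar>c k\<bar> dvd c k" .
  moreover have "n < 7 ^ n" for n :: nat
    by (induction n) simp_all
  then have "int n < 7 ^ n" for n by simp
  then have "\<bar>c k\<bar> < 7 ^ nat \<bar>c k\<bar>" by (metis abs_ge_zero int_nat_eq)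
  ultimately show ?thesis by (meson dvd_imp_le_int leD abs_ge_zero order.trans abs_ge_self)
qed

lemma pi_sum_inj: "inj pi_sum"
proof (rule injI)
  fix r s assume "pi_sum r = pi_sum s"
  obtain c d where cd: "r = (\<chi> j. c (idx j))" "s = (\<chi> j. d (idx j))" by (metis vec_idx)
  have "(\<Sum>k<6. of_int (c (Suc k)) * (zeta - 1) ^ k) = (\<Sum>k<6. of_int (d (Suc k)) * (zeta - 1) ^ k)"
    using \<open>pi_sum r = pi_sum s\<close> zeta_neq_1 unfolding cd pi_sum_idx mult_cancel_left by simp
  then have "(\<Sum>k<6. of_int (c (Suc k) - d (Suc k)) * (zeta - 1) ^ k) = 0"
    by (simp add: left_diff_distrib sum_subtractf)
  then have "c (Suc k) - d (Suc k) = 0" if "k < 6" for k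
    using pi_powers_independent[of "\<lambda>k. c (Suc k) - d (Suc k)"] that by blast
  moreover have "\<exists>k<6. idx j = Suc k" for j
    using idx_range[of j] by (intro exI[of _ "idx j - 1"]) auto
  ultimately have "c (idx j) = d (idx j)" for j by (metis eq_iff_diff_eq_0)
  then show "r = s" by (simp add: cd)
qed

text \<open>Independence kills the digits of the remainder, so \<open>cyc7\<close> generates the
  kernel of evaluation at \<zeta>.\<close>

lemma cyc7_dvd: "ipoly zeta p = 0 \<Longrightarrow> cyc7 dvd p"
proof -
  assume 0: "ipoly zeta p = 0"
  obtain q c where p: "p = cyc7 * q + radix c" using radix_expansion by blast
  then have "(\<Sum>k<6. of_int (c k) * (zeta - 1) ^ k) = 0"
    using 0 ipoly_cyc7_zeta_power[of 1 1] by (simp add: ipoly_add ipoly_mult ipoly_radix)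
  then have "c k = 0" if "k < 6" for k using pi_powers_independent that by blast
  then have "radix c = 0" by (simp add: radix_def)
  then show ?thesis using p by simp
qed

text \<open>Transfers identities from \<zeta> to other ring elements. The left factor
  \<open>u\<close> matters in \<Lambda>, where \<open>sum_x\<close> itself is nonzero but
  \<open>u sum_x\<close> may vanish.\<close>

lemma ipoly_zeta_eq_imp:
  fixes c :: "'r::ring_1"
  assumes "ipoly zeta p = ipoly zeta q" "u * ipoly c cyc7 = 0"
  shows "u * ipoly c p = u * ipoly c q"
proof -
  have "cyc7 dvd p - q" using assms(1) by (intro cyc7_dvd) (simp add: ipoly_diff)
  then obtain k where "p - q = cyc7 * k" by (elim dvdE)
  then have "u * ipoly c (p - q) = u * ipoly c cyc7 * ipoly c k"
    by (simp add: ipoly_mult mult.assoc)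
  then show ?thesis using assms(2) by (simp add: ipoly_diff right_diff_distrib)
qed

subsection \<open>The automorphism \<open>\<sigma>\<close>\<close>

lemma ipoly_zeta_power_cong:
  assumes "ipoly zeta p = ipoly zeta q" "i * j mod 7 = 1"
  shows "ipoly (zeta ^ i) p = ipoly (zeta ^ i) q"
  using ipoly_zeta_eq_imp[of p q 1 "zeta ^ i"] ipoly_cyc7_zeta_power[OF assms(2)] assms(1) by simp

definition X_power :: "nat \<Rightarrow> int poly" where "X_power i = [:0, 1:] ^ i"

lemma ipoly_X_power [simp]: "ipoly c (X_power i) = c ^ i"
  by (simp add: X_power_def ipoly_power)

lemma ipoly_pcompose_X_power: "ipoly c (p \<circ>\<^sub>p X_power i) = ipoly (c ^ i) p"
  by (simp add: ipoly_pcompose)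

lemma zeta_15: "zeta ^ 15 = zeta"
  using zeta_power_mod[of 15] by simp

text \<open>\<open>s i\<close> substitutes \<open>zeta ^ i\<close> for \<zeta> in a chosen
  polynomial; the value is independent of the choice by \<open>ipoly_zeta_power_cong\<close>. As 3
  times 5 is 1 modulo 7, \<open>s 5\<close> inverts \<open>s 3\<close>.\<close>

lemma sigma_exists:
  "\<exists>s. bij_betw s Z_zeta Z_zeta \<and>
     (\<forall>u\<in>Z_zeta. \<forall>v\<in>Z_zeta. s (u + v) = s u + s v \<and> s (u * v) = s u * s v) \<and>
     s zeta = zeta ^ 3"
proof -
  define s where "s i u = ipoly (zeta ^ i) (SOME p. u = ipoly zeta p)" for i u
  have s: "s i (ipoly zeta p) = ipoly (zeta ^ i) p" if "i * j mod 7 = 1" for i j p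
    unfolding s_def by (rule ipoly_zeta_power_cong[OF _ that, symmetric], rule someI[of _ p]) simp
  have s3: "s 3 (ipoly zeta p) = ipoly zeta (p \<circ>\<^sub>p X_power 3)" for p
    using s[of 3 5] by (simp add: ipoly_pcompose_X_power)
  have s5: "s 5 (ipoly zeta p) = ipoly zeta (p \<circ>\<^sub>p X_power 5)" for p
    using s[of 5 3] by (simp add: ipoly_pcompose_X_power)
  have inv: "s 5 (s 3 u) = u" "s 3 (s 5 u) = u" if u: "u \<in> Z_zeta" for u
  proof -
    obtain p where p: "u = ipoly zeta p" using u by (auto simp: Z_zeta_iff)
    show "s 5 (s 3 u) = u" "s 3 (s 5 u) = u"
      by (simp_all only: p s3 s5) (simp_all add: ipoly_pcompose_X_power zeta_15)
  qed
  show ?thesis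
  proof (intro exI[of _ "s 3"] conjI ballI)
    show "bij_betw (s 3) Z_zeta Z_zeta"
      by (rule bij_betw_byWitness[where f' = "s 5"]) (auto simp: inv Z_zeta_iff s3 s5, blast+)
  next
    fix u v assume "u \<in> Z_zeta" "v \<in> Z_zeta"
    then obtain p q where pq: "u = ipoly zeta p" "v = ipoly zeta q" by (auto simp: Z_zeta_iff)
    show "s 3 (u + v) = s 3 u + s 3 v"
      using s[of 3 5 "p + q"] by (simp add: pq s[of 3 5] ipoly_add)
    show "s 3 (u * v) = s 3 u * s 3 v"
      using s[of 3 5 "p * q"] by (simp add: pq s[of 3 5] ipoly_mult)
  next
    show "s 3 zeta = zeta ^ 3"
      using s[of 3 5 "[:0, 1:]"] by simp
  qed
qed

lemma sigma:
  shows sigma_bij: "bij_betw sigma Z_zeta Z_zeta"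
    and sigma_add: "u \<in> Z_zeta \<Longrightarrow> v \<in> Z_zeta \<Longrightarrow> sigma (u + v) = sigma u + sigma v"
    and sigma_mult: "u \<in> Z_zeta \<Longrightarrow> v \<in> Z_zeta \<Longrightarrow> sigma (u * v) = sigma u * sigma v"
    and sigma_zeta: "sigma zeta = zeta ^ 3"
  using someI_ex[OF sigma_exists] unfolding sigma_def[symmetric] by blast+

lemma sigma_ipoly: "sigma (ipoly zeta p) = ipoly (zeta ^ 3) p"
proof -
  have 0: "sigma 0 = 0" using sigma_add[of 0 0] Z_zeta_of_int[of 0] by simp
  \<comment> \<open>That \<open>sigma\<close> fixes 1 is not among its chosen properties; it follows
    from surjectivity, by cancelling \<open>sigma e = 1\<close> in
    \<open>sigma (1 * e) = sigma e\<close>.\<close>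
  obtain e where e: "e \<in> Z_zeta" "sigma e = 1"
    using bij_betw_imp_surj_on[OF sigma_bij] Z_zeta_1 by (metis imageE)
  then have 1: "sigma 1 = 1" using sigma_mult[of 1 e] by simp
  have uminus: "sigma (- u) = - sigma u" if "u \<in> Z_zeta" for u
    using sigma_add[of u "- u"] that 0 by (simp add: Z_zeta_uminus minus_unique)
  have int: "sigma (of_int n) = of_int n" for n
  proof (induction n rule: int_induct[of _ 0])
    case (step1 i)
    then show ?case using sigma_add[of "of_int i" 1] 1 by simp
  next
    case (step2 i)
    then show ?case using sigma_add[of "of_int i" "- 1"] uminus[of 1] 1 by (simp add: Z_zeta_uminus)
  qed (simp add: 0)
  show ?thesis
  proof (induction p)
    case (pCons a p)
    have "sigma (zeta * ipoly zeta p) = zeta ^ 3 * ipoly (zeta ^ 3) p"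
      using sigma_mult[of zeta "ipoly zeta p"] pCons by (simp add: sigma_zeta)
    then show ?case using sigma_add[of "of_int a" "zeta * ipoly zeta p"] int[of a] by auto
  qed (simp add: 0)
qed

lemma inv_sigma_ipoly: "inv_into Z_zeta sigma (ipoly zeta p) = ipoly (zeta ^ 5) p"
proof (rule inv_into_f_eq)
  show "inj_on sigma Z_zeta" using sigma_bij by (rule bij_betw_imp_inj_on)
  show "ipoly (zeta ^ 5) p \<in> Z_zeta"
    by (simp flip: ipoly_pcompose_X_power)
  have "sigma (ipoly zeta (p \<circ>\<^sub>p X_power 5)) = ipoly zeta p"
    unfolding sigma_ipoly by (simp add: ipoly_pcompose_X_power zeta_15)
  then show "sigma (ipoly (zeta ^ 5) p) = ipoly zeta p"
    by (simp add: ipoly_pcompose_X_power)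
qed

subsection \<open>Comparing \<open>u\<Lambda>\<close> with \<open>\<int>[\<zeta>]\<close>\<close>

text \<open>Right multiplication by \<open>x\<close> becomes multiplication by \<open>\<zeta>\<close> under \<open>theta\<close>, so \<open>u p(x) = 0\<close> forces
  \<open>p(\<zeta>) = 0\<close> as soon as \<open>theta u \<noteq> 0\<close>.\<close>

definition theta :: "Lam \<Rightarrow> complex" where
  "theta a = (\<Sum>i<7. of_int (Poly_Mapping.lookup a (gx i)) * zeta ^ i)"

lemma theta_add: "theta (a + b) = theta a + theta b"
  by (simp add: theta_def lookup_add distrib_right sum.distrib)

lemma theta_zero [simp]: "theta 0 = 0"
  by (simp add: theta_def)

lemma theta_of_int_mult: "theta (of_int n * a) = of_int n * theta a"
  by (simp add: theta_def lookup_of_int_mult sum_distrib_left mult.assoc)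

lemma gx_add: "gx i + gx j = gx (i + j)"
  by (simp add: plus_G76.abs_eq replicate_add)

lemma gx_mod: "gx (i mod 7) = gx i"
  using gen_x_mod[of i] unfolding gen_x_power by (simp add: frag_of_eq)

lemma gy_multiple: "6 dvd j \<Longrightarrow> gy j = 0"
  using gen_y_mod[of j] unfolding gen_y_power by (simp add: frag_of_eq zero_G76_def)

lemma theta_mult_gen_x: "theta (a * gen_x) = theta a * zeta"
proof -
  have gx1: "gen_x = Poly_Mapping.single (gx 1) 1"
    using gen_x_power[of 1] by (simp only: power_one_right)
  \<comment> \<open>\<open>(i + 6) mod 7\<close> is the predecessor of \<open>i\<close> modulo
    7.\<close>
  have "gx i - gx 1 = gx ((i + 6) mod 7)" for i
  proof -
    have "gx ((i + 6) mod 7) + gx 1 = gx (i + 7)"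
      by (simp only: gx_mod gx_add add.assoc) simp
    also have "\<dots> = gx i"
      using gx_mod[of "i + 7"] gx_mod[of i] by (simp only: mod_add_self2)
    finally show ?thesis by (metis add_diff_cancel)
  qed
  then have "theta (a * gen_x) = (\<Sum>i<7. of_int (Poly_Mapping.lookup a (gx ((i + 6) mod 7))) * zeta ^ i)"
    unfolding theta_def gx1 lookup_mult_single by simp
  also have "\<dots> = (\<Sum>i<7. of_int (Poly_Mapping.lookup a (gx i)) * zeta ^ i * zeta)"
  proof (rule sum.reindex_bij_witness[of _ "\<lambda>i. (i + 1) mod 7" "\<lambda>i. (i + 6) mod 7"])
    fix i :: nat
    have "zeta ^ ((i + 6) mod 7) * zeta = zeta ^ (i + 7)"
      unfolding zeta_power_mod by (simp add: power_add eval_nat_numeral)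
    also have "\<dots> = zeta ^ i" by (simp add: power_add zeta_7)
    finally show "of_int (Poly_Mapping.lookup a (gx ((i + 6) mod 7))) * zeta ^ ((i + 6) mod 7) * zeta =
        of_int (Poly_Mapping.lookup a (gx ((i + 6) mod 7))) * zeta ^ i"
      by simp
  qed (auto simp: mod_simps)
  finally show ?thesis by (simp add: theta_def sum_distrib_right)
qed

lemma theta_mult_ipoly: "theta (a * ipoly gen_x p) = theta a * ipoly zeta p"
proof (induction p arbitrary: a)
  case (pCons c p)
  have "a * ipoly gen_x (pCons c p) = of_int c * a + a * gen_x * ipoly gen_x p"
    by (simp add: distrib_left mult.assoc mult_of_int_commute)
  then show ?case
    by (simp only: theta_add theta_of_int_mult pCons.IH theta_mult_gen_x) (simp add: algebra_simps)
qed simp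

text \<open>Exponents in a term need not be reduced, hence the test \<open>6 dvd j\<close>. The
  invariants \<open>y_exp\<close> and \<open>aff\<close> show which \<open>x^i y^j\<close> coincide
  with a power of \<open>x\<close>.\<close>

lemma theta_eval_term: "theta (eval_term (c, i, j)) = (if 6 dvd j then of_int c * zeta ^ i else 0)"
proof -
  have eq: "gx i + gy j = gx k \<longleftrightarrow> 6 dvd j \<and> k = i mod 7" if "k < 7" for k
  proof
    assume 1: "gx i + gy j = gx k"
    have "y_exp (gx n) = 0" "y_exp (gy n) = int n mod 6" for n
      by (simp_all add: y_exp.abs_eq sum_list_replicate)
    then have "int j mod 6 = 0"
      using arg_cong[OF 1, of y_exp] by (simp add: y_exp_add)
    then have j: "6 dvd j" by presburger
    then have "gy j = 0" by (simp add: gy_multiple)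
    then have "aff (gx i) 0 = aff (gx k) 0" using 1 by simp
    then have "int i mod 7 = int k mod 7"
      by (simp add: aff.abs_eq step_x_power)
    then have "i mod 7 = k mod 7" by (metis nat_int zmod_int of_nat_numeral)
    then show "6 dvd j \<and> k = i mod 7" using j that by simp
  next
    assume 1: "6 dvd j \<and> k = i mod 7"
    then have "gy j = 0" by (simp add: gy_multiple)
    then show "gx i + gy j = gx k" using 1 gx_mod[of i] by simp
  qed
  have "theta (eval_term (c, i, j)) =
      (\<Sum>k<7. of_int (c * (1 when gx i + gy j = gx k)) * zeta ^ k)"
    unfolding theta_def eval_term.simps lookup_of_int_mult gen_x_power gen_y_power mult_single lookup_single
    by simp
  also have "\<dots> = (\<Sum>k<7. if k = i mod 7 then (if 6 dvd j then of_int c * zeta ^ i else 0) else 0)"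
    by (intro sum.cong) (auto simp: eq zeta_power_mod)
  finally show ?thesis by simp
qed

lemma theta_eval_terms:
  "theta (eval_terms L) = (\<Sum>(c, i, j)\<leftarrow>L. if 6 dvd j then of_int c * zeta ^ i else 0)"
  by (induction L) (auto simp: theta_add theta_eval_term simp del: eval_term.simps)

lemma theta_elt_r: "theta elt_r \<noteq> 0"
proof -
  have "theta elt_r = zeta ^ 5 - zeta ^ 6"
    unfolding elt_r_def theta_eval_terms by (simp add: terms_defs upt_rec) (auto dest: dvd_imp_le)
  also have "\<dots> = zeta ^ 5 * (1 - zeta)" by (simp add: algebra_simps eval_nat_numeral)
  finally show ?thesis using zeta_neq_1 zeta_nonzero by simp
qed

lemma theta_elt_l: "theta elt_l \<noteq> 0"
proof
  assume 0: "theta elt_l = 0"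
  have "theta elt_l = ipoly zeta [:-1, 0, 0, 1, -1, 0, 1:]"
    unfolding elt_l_def theta_eval_terms by (simp add: terms_defs) (simp add: algebra_simps power_numeral_reduce)
  \<comment> \<open>Modulo \<open>cyc7\<close> the value comes from a nonzero polynomial of degree
    5, too small to be a multiple of \<open>cyc7\<close>.\<close>
  also have "\<dots> = ipoly zeta ([:-2, -1, -1, 0, -2, -1:] + cyc7)"
    by (simp add: cyc7_def)
  also have "\<dots> = ipoly zeta [:-2, -1, -1, 0, -2, -1:]"
    using ipoly_cyc7_zeta_power[of 1 1] by (simp add: ipoly_add del: ipoly_pCons)
  finally have "cyc7 dvd [:-2, -1, -1, 0, -2, -1:]"
    using 0 by (intro cyc7_dvd) simp
  then have "degree cyc7 \<le> degree ([:-2, -1, -1, 0, -2, -1:] :: int poly)"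
    by (rule dvd_imp_degree_le) simp
  then show False by (simp add: cyc7_def)
qed

text \<open>From \<open>y x^5 = x^15 y = x y\<close>; on the side of \<zeta> this is the inverse of
  \<sigma> sending \<zeta> to \<open>\<zeta>^5\<close>.\<close>

lemma ipoly_gen_x_mult_gen_y: "ipoly gen_x p * gen_y = gen_y * ipoly gen_x (p \<circ>\<^sub>p X_power 5)"
  unfolding ipoly_pcompose_X_power
proof (induction p)
  case (pCons a p)
  have "gen_x * gen_y = gen_y * gen_x ^ 5"
    using gen_y_gen_x_power[of 5] gen_x_mod[of 15] by simp
  then have "gen_x * ipoly gen_x p * gen_y = gen_y * (gen_x ^ 5 * ipoly (gen_x ^ 5) p)"
    using pCons by (metis mult.assoc)
  then show ?case by (simp add: distrib_left distrib_right mult_of_int_commute mult.assoc)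
qed simp

text \<open>Matching \<open>w p(\<zeta>)\<close> with \<open>u p(x)\<close> carries the module structure of \<open>u\<Lambda>\<close> over to the ideal
  \<open>w\<int>[\<zeta>]\<close>; no action of the presented group on the complex numbers has to be constructed.\<close>

locale cyclic_model =
  fixes u :: Lam and t :: "int poly" and w :: complex
  assumes u_sum_x: "u * sum_x = 0" and u_gen_y: "u * gen_y = u * ipoly gen_x t"
    and theta_u: "theta u \<noteq> 0" and w_nonzero: "w \<noteq> 0"
begin

definition ideal :: "complex set" where "ideal = (\<lambda>z. w * z) ` Z_zeta"

definition model :: "complex \<Rightarrow> Lam" where
  "model v = u * ipoly gen_x (SOME p. v = w * ipoly zeta p)"

lemma ideal_cases:
  assumes "v \<in> ideal"
  obtains p where "v = w * ipoly zeta p"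
  using assms that unfolding ideal_def image_iff Bex_def Z_zeta_iff by blast

lemma ideal_ipoly [simp, intro]: "w * ipoly zeta p \<in> ideal"
  by (auto simp: ideal_def)

text \<open>One direction makes \<open>model\<close> injective, because \<open>theta\<close> detects
  \<open>p(\<zeta>)\<close>; the other makes it well defined, because
  \<open>u sum_x = 0\<close>.\<close>

lemma u_ipoly_eq_iff: "u * ipoly gen_x p = u * ipoly gen_x q \<longleftrightarrow> ipoly zeta p = ipoly zeta q"
proof
  assume "u * ipoly gen_x p = u * ipoly gen_x q"
  then have "theta u * ipoly zeta p = theta u * ipoly zeta q"
    by (simp flip: theta_mult_ipoly)
  then show "ipoly zeta p = ipoly zeta q" using theta_u by simp
next
  assume "ipoly zeta p = ipoly zeta q"
  then show "u * ipoly gen_x p = u * ipoly gen_x q"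
    by (rule ipoly_zeta_eq_imp) (simp add: ipoly_cyc7_gen_x u_sum_x)
qed

lemma model_ipoly: "model (w * ipoly zeta p) = u * ipoly gen_x p"
proof -
  have "w * ipoly zeta p = w * ipoly zeta (SOME q. w * ipoly zeta p = w * ipoly zeta q)"
    by (rule someI[of _ p]) simp
  then show ?thesis using w_nonzero by (simp add: model_def u_ipoly_eq_iff)
qed

lemma u_ipoly_mult_gen_y: "u * ipoly gen_x p * gen_y = u * ipoly gen_x (t * (p \<circ>\<^sub>p X_power 5))"
proof -
  have "u * ipoly gen_x p * gen_y = u * gen_y * ipoly gen_x (p \<circ>\<^sub>p X_power 5)"
    by (simp only: mult.assoc ipoly_gen_x_mult_gen_y)
  then show ?thesis by (simp add: u_gen_y ipoly_mult mult.assoc)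
qed

text \<open>Polynomials in \<open>x\<close> can be moved past \<open>y\<close>, and
  \<open>u y\<close> is again \<open>u\<close> times such a polynomial. The induction needs an
  arbitrary polynomial in front in order to handle products.\<close>

lemma u_mult_cases: obtains p where "u * a = u * ipoly gen_x p"
proof -
  have "\<exists>p. u * ipoly gen_x q * a = u * ipoly gen_x p" for q
  proof (induction a arbitrary: q rule: Lam_induct)
    case x
    have "u * ipoly gen_x q * gen_x = u * ipoly gen_x (q * [:0, 1:])"
      by (simp add: ipoly_mult mult.assoc del: mult_pCons_right)
    then show ?case by blast
  next
    case (add a b)
    then show ?case by (metis distrib_left ipoly_add)
  next
    case (uminus a)
    then show ?case by (metis mult_minus_right ipoly_uminus)
  next
    case (mult a b)
    then show ?case by (metis mult.assoc)
  qed (auto simp: u_ipoly_mult_gen_y)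
  from this[of 1] that show thesis by auto
qed

lemma model_bij: "bij_betw model ideal (range ((*) u))"
proof (rule bij_betwI')
  fix v v' assume "v \<in> ideal" "v' \<in> ideal"
  then show "model v = model v' \<longleftrightarrow> v = v'"
    by (elim ideal_cases) (simp add: model_ipoly u_ipoly_eq_iff w_nonzero)
next
  fix v assume "v \<in> ideal"
  then show "model v \<in> range ((*) u)" by (elim ideal_cases) (simp add: model_ipoly)
next
  fix b assume "b \<in> range ((*) u)"
  then obtain a where "b = u * a" by blast
  moreover obtain p where "u * a = u * ipoly gen_x p" by (rule u_mult_cases)
  ultimately show "\<exists>v\<in>ideal. b = model v"
    using ideal_ipoly model_ipoly by metis
qed

lemma model_add: "v \<in> ideal \<Longrightarrow> v' \<in> ideal \<Longrightarrow> model (v + v') = model v + model v'"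
proof (elim ideal_cases)
  fix p q assume "v = w * ipoly zeta p" "v' = w * ipoly zeta q"
  then show "model (v + v') = model v + model v'"
    using model_ipoly[of "p + q"] by (simp add: ipoly_add distrib_left model_ipoly)
qed

lemma model_mult_zeta: "v \<in> ideal \<Longrightarrow> model (v * zeta) = model v * gen_x"
proof (elim ideal_cases)
  fix p assume v: "v = w * ipoly zeta p"
  show "model (v * zeta) = model v * gen_x"
    using model_ipoly[of "p * X_power 1"] by (simp add: v model_ipoly ipoly_mult mult.assoc)
qed

text \<open>On the ideal, \<open>y\<close> acts as the semilinear map that sends \<zeta> to
  \<open>\<zeta>^5\<close> and \<open>w\<close> to \<open>w t(\<zeta>)\<close>.\<close>

lemma model_twisted: "model (w * ipoly zeta t * ipoly (zeta ^ 5) p) = model (w * ipoly zeta p) * gen_y"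
proof -
  have "model (w * ipoly zeta (t * (p \<circ>\<^sub>p X_power 5))) = model (w * ipoly zeta p) * gen_y"
    by (simp only: model_ipoly u_ipoly_mult_gen_y)
  then show ?thesis by (simp add: ipoly_mult ipoly_pcompose_X_power mult.assoc)
qed

lemma ideal_add: "v \<in> ideal \<Longrightarrow> v' \<in> ideal \<Longrightarrow> v + v' \<in> ideal"
  by (elim ideal_cases) (simp flip: ipoly_add distrib_left)

lemma ideal_uminus: "v \<in> ideal \<Longrightarrow> - v \<in> ideal"
  by (elim ideal_cases) (simp flip: ipoly_uminus mult_minus_right)

lemma ideal_zero: "0 \<in> ideal"
  using ideal_ipoly[of 0] by simp

lemma ideal_mult_zeta: "v \<in> ideal \<Longrightarrow> v * zeta \<in> ideal"
  by (auto simp: ideal_def mult.assoc intro!: imageI Z_zeta_mult)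

lemma ideal_twisted: "w * ipoly zeta t * ipoly (zeta ^ 5) p \<in> ideal"
  using ideal_ipoly[of "t * (p \<circ>\<^sub>p X_power 5)"] by (simp add: ipoly_mult ipoly_pcompose_X_power mult.assoc)

end

lemma right_ideal_simps [simp]:
  "mcarrier (right_ideal c) = range ((*) c)" "act (right_ideal c) = (*)"
  by (simp_all add: right_ideal_def)

lemma right_module_right_ideal: "right_module (right_ideal c)"
  by (rule right_moduleI)
    (auto simp: right_ideal_def distrib_left distrib_right mult.assoc image_iff
      intro: exI[of _ 0] exI[of _ "- _"] simp flip: distrib_left mult_minus_right)

lemma module_hom_generators:
  assumes M: "right_module M" and N: "right_module N"
    and im: "\<And>u. u \<in> mcarrier M \<Longrightarrow> f u \<in> mcarrier N"
    and add: "\<And>u v. u \<in> mcarrier M \<Longrightarrow> v \<in> mcarrier M \<Longrightarrow> f (u + v) = f u + f v"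
    and x: "\<And>u. u \<in> mcarrier M \<Longrightarrow> f (act M u gen_x) = act N (f u) gen_x"
    and y: "\<And>u. u \<in> mcarrier M \<Longrightarrow> f (act M u gen_y) = act N (f u) gen_y"
  shows "module_hom M N f"
proof (rule module_homI)
  have zero: "f 0 = 0" using add[of 0 0] right_moduleD(1)[OF M] by simp
  have uminus: "f (- u) = - f u" if "u \<in> mcarrier M" for u
    using add[of u "- u"] that zero right_moduleD(3)[OF M that] by (simp add: minus_unique)
  fix u a assume "u \<in> mcarrier M"
  then show "f (act M u a) = act N (f u) a"
    by (induction a arbitrary: u rule: Lam_induct)
      (simp_all add: x y add im uminus right_moduleD[OF M] right_moduleD[OF N]
        act_uminus_right[OF M] act_uminus_right[OF N])
qed (fact im add)+

subsection \<open>The module structure on \<open>(\<zeta> - 1)\<int>[\<zeta>]\<close>\<close>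

definition w0 :: complex where "w0 = zeta ^ 4 * (zeta - 1)"

lemma w0_ipoly: "w0 = ipoly zeta (X_power 5 - X_power 4)"
  by (simp add: w0_def ipoly_diff algebra_simps eval_nat_numeral)

lemma inv_sigma_w0: "inv_into Z_zeta sigma (w0 * ipoly zeta p) = - (w0 * (1 + zeta) * ipoly (zeta ^ 5) p)"
proof -
  have "ipoly (zeta ^ 5) (X_power 5 - X_power 4) = zeta ^ 25 - zeta ^ 20"
    by (simp add: ipoly_diff flip: power_mult)
  also have "\<dots> = zeta ^ 4 - zeta ^ 6"
    using zeta_power_mod[of 25] zeta_power_mod[of 20] by simp
  also have "\<dots> = - (w0 * (1 + zeta))"
    by (simp add: w0_def algebra_simps eval_nat_numeral)
  finally show ?thesis
    unfolding w0_ipoly ipoly_mult[symmetric] inv_sigma_ipoly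
    by (simp add: ipoly_mult w0_ipoly)
qed

interpretation R1: cyclic_model elt_r "[:-1, -1:]" w0
proof
  show "elt_r * gen_y = elt_r * ipoly gen_x [:-1, -1:]"
    by (simp add: elt_r_mult_gen_y algebra_simps)
  show "w0 \<noteq> 0" using zeta_neq_1 zeta_nonzero by (simp add: w0_def)
qed (fact elt_r_mult_sum_x theta_elt_r)+

interpretation R2: cyclic_model elt_l "[:1, 2, 1:]" "w0 ^ 2"
proof
  show "elt_l * gen_y = elt_l * ipoly gen_x [:1, 2, 1:]"
  proof -
    have "[:1, 2, 1:] = [:1, 1 :: int:] ^ 2" by (simp add: power2_eq_square)
    then show ?thesis by (simp only: elt_l_mult_gen_y ipoly_power) simp
  qed
  show "w0 ^ 2 \<noteq> 0" using zeta_neq_1 zeta_nonzero by (simp add: w0_def)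
qed (fact elt_l_mult_sum_x theta_elt_l)+

lemma image_mult_zeta_power: "(\<lambda>z. zeta ^ i * z) ` Z_zeta = Z_zeta" if "i \<le> 14"
proof (intro subset_antisym subsetI)
  fix z assume z: "z \<in> Z_zeta"
  \<comment> \<open>The exponent 14 is a multiple of 7 that exceeds the exponents 4 and 8 occurring
    in \<open>w0\<close> and its square.\<close>
  have "zeta ^ i * zeta ^ (14 - i) = 1"
    using that zeta_power_mod[of 14] by (simp flip: power_add)
  then have "z = zeta ^ i * (zeta ^ (14 - i) * z)" by (simp flip: mult.assoc)
  moreover have "zeta ^ (14 - i) * z \<in> Z_zeta" using z by auto
  ultimately show "z \<in> (\<lambda>z. zeta ^ i * z) ` Z_zeta" by (rule image_eqI)
qed auto

lemma R1_ideal: "R1.ideal = (\<lambda>z. (zeta - 1) * z) ` Z_zeta"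
proof -
  have "R1.ideal = (\<lambda>z. (zeta - 1) * z) ` (\<lambda>z. zeta ^ 4 * z) ` Z_zeta"
    unfolding R1.ideal_def image_image by (simp add: w0_def mult_ac)
  then show ?thesis using image_mult_zeta_power[of 4] by simp
qed

lemma R2_ideal: "R2.ideal = (\<lambda>z. (zeta - 1) ^ 2 * z) ` Z_zeta"
proof -
  have "R2.ideal = (\<lambda>z. (zeta - 1) ^ 2 * z) ` (\<lambda>z. zeta ^ 8 * z) ` Z_zeta"
    unfolding R2.ideal_def image_image by (simp add: w0_def power_mult_distrib mult_ac flip: power_mult)
  then show ?thesis using image_mult_zeta_power[of 8] by simp
qed

lemma R2_subset_R1: "R2.ideal \<subseteq> R1.ideal"
  unfolding R1_ideal R2_ideal using Z_zeta_pi by (auto simp: power2_eq_square mult.assoc intro!: imageI)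

text \<open>The action pulls back right multiplication on r\<Lambda> along the bijection
  \<open>R1.model\<close>, so the module axioms are inherited and only the two generators remain to
  be compared.\<close>

lemma cyc_module_exists:
  "\<exists>M :: (Lam, complex) rmod. right_module M \<and>
     mcarrier M = (\<lambda>w. (zeta - 1) * w) ` Z_zeta \<and>
     (\<forall>v\<in>mcarrier M. act M v gen_x = v * zeta \<and> act M v gen_y = inv_into Z_zeta sigma v)"
proof -
  define M :: "(Lam, complex) rmod" where
    "M = \<lparr>mcarrier = R1.ideal, act = (\<lambda>v a. inv_into R1.ideal R1.model (R1.model v * a))\<rparr>"
  have M: "mcarrier M = R1.ideal" by (simp add: M_def)
  have range: "R1.model v * a \<in> R1.model ` R1.ideal" if "v \<in> R1.ideal" for v a
  proof -
    obtain b where "R1.model v = elt_r * b"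
      using \<open>v \<in> R1.ideal\<close> bij_betw_imp_surj_on[OF R1.model_bij] by blast
    then have "R1.model v * a \<in> range ((*) elt_r)" by (simp add: mult.assoc)
    then show ?thesis by (simp only: bij_betw_imp_surj_on[OF R1.model_bij])
  qed
  have act_in: "act M v a \<in> R1.ideal" and model_act: "R1.model (act M v a) = R1.model v * a"
    if "v \<in> R1.ideal" for v a
    using range[OF that, of a] by (auto simp: M_def inv_into_into f_inv_into_f)
  have inj: "inj_on R1.model R1.ideal" by (rule bij_betw_imp_inj_on[OF R1.model_bij])
  have "right_module M"
  proof (rule right_module_inj_transfer[where f = R1.model and N = "right_ideal elt_r"])
    show "R1.model v \<in> mcarrier (right_ideal elt_r)" if "v \<in> mcarrier M" for v
      using that bij_betw_imp_surj_on[OF R1.model_bij] by (auto simp: M)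
  qed (auto simp: M R1.ideal_zero R1.ideal_add R1.ideal_uminus act_in model_act R1.model_add inj
      right_module_right_ideal)
  moreover have "act M v gen_x = v * zeta" if "v \<in> R1.ideal" for v
    by (rule inj_onD[OF inj]) (simp_all add: that model_act act_in R1.model_mult_zeta R1.ideal_mult_zeta)
  moreover have "act M v gen_y = inv_into Z_zeta sigma v" if v: "v \<in> R1.ideal" for v
  proof -
    obtain p where p: "v = w0 * ipoly zeta p" using v by (rule R1.ideal_cases)
    have eq: "inv_into Z_zeta sigma v = w0 * ipoly zeta [:-1, -1:] * ipoly (zeta ^ 5) p"
      unfolding p inv_sigma_w0 by (simp add: algebra_simps)
    show ?thesis
      unfolding eq
      by (rule inj_onD[OF inj])
        (simp_all add: p model_act act_in R1.model_twisted R1.ideal_twisted del: ipoly_pCons)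
  qed
  ultimately show ?thesis
    using M R1_ideal by (intro exI[of _ M]) simp
qed

lemma cyc_module:
  shows right_module_cyc: "right_module cyc_module"
    and mcarrier_cyc: "mcarrier cyc_module = R1.ideal"
    and act_cyc_x: "v \<in> R1.ideal \<Longrightarrow> act cyc_module v gen_x = v * zeta"
    and act_cyc_y: "v \<in> R1.ideal \<Longrightarrow> act cyc_module v gen_y = inv_into Z_zeta sigma v"
  using someI_ex[OF cyc_module_exists] unfolding cyc_module_def[symmetric] R1_ideal by auto

text \<open>Reading \<open>w0^2 p\<close> as \<open>w0\<close> times \<open>w0 p\<close>, the action
  of \<open>y\<close> contributes the factor \<open>- (1 + \<zeta>)\<close> twice. Stability under
  \<Lambda> then follows from the generators.\<close>

lemma act_cyc_in_R2: "v \<in> R2.ideal \<Longrightarrow> act cyc_module v a \<in> R2.ideal"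
  and act_cyc_y_R2: "act cyc_module (w0 ^ 2 * ipoly zeta p) gen_y =
    w0 ^ 2 * ipoly zeta [:1, 2, 1:] * ipoly (zeta ^ 5) p"
proof -
  show act_y: "act cyc_module (w0 ^ 2 * ipoly zeta p) gen_y =
    w0 ^ 2 * ipoly zeta [:1, 2, 1:] * ipoly (zeta ^ 5) p" for p
  proof -
    have "w0 ^ 2 * ipoly zeta p = w0 * ipoly zeta ((X_power 5 - X_power 4) * p)"
      by (simp add: ipoly_mult power2_eq_square mult.assoc flip: w0_ipoly)
    moreover have "w0 ^ 2 * ipoly zeta p \<in> R1.ideal"
      using R2_subset_R1 R2.ideal_ipoly by blast
    ultimately have "act cyc_module (w0 ^ 2 * ipoly zeta p) gen_y =
        - (w0 * (1 + zeta) * ipoly (zeta ^ 5) ((X_power 5 - X_power 4) * p))"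
      by (simp add: act_cyc_y inv_sigma_w0)
    also have "ipoly (zeta ^ 5) (X_power 5 - X_power 4) = - (w0 * (1 + zeta))"
      using inv_sigma_w0[of 1] unfolding w0_ipoly by (simp add: inv_sigma_ipoly)
    then have "ipoly (zeta ^ 5) ((X_power 5 - X_power 4) * p) = - (w0 * (1 + zeta)) * ipoly (zeta ^ 5) p"
      by (simp add: ipoly_mult)
    finally show ?thesis by (simp add: power2_eq_square algebra_simps)
  qed
  note M = right_moduleD[OF right_module_cyc, unfolded mcarrier_cyc]
  show "v \<in> R2.ideal \<Longrightarrow> act cyc_module v a \<in> R2.ideal"
  proof (induction a arbitrary: v rule: Lam_induct)
    case one
    then show ?case using M(8)[of v] R2_subset_R1 by auto
  next
    case x
    then show ?case using R2_subset_R1 by (auto simp: act_cyc_x R2.ideal_mult_zeta)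
  next
    case y
    then show ?case by (elim R2.ideal_cases) (simp add: act_y R2.ideal_twisted del: ipoly_pCons)
  next
    case (add a b)
    then show ?case using M(6)[of v a b] R2_subset_R1 by (auto simp: R2.ideal_add)
  next
    case (uminus a)
    then show ?case using act_uminus_right[OF right_module_cyc, of v a] R2_subset_R1
      by (auto simp: R2.ideal_uminus mcarrier_cyc)
  next
    case (mult a b)
    then show ?case using M(7)[of v a b] R2_subset_R1 by auto
  qed
qed

section \<open>The matrix representation and the row module \<open>R(2)\<close>\<close>

lemma act_of_int_mult:
  assumes M: "right_module (M :: ('r::ring_1, 'm::ring_1) rmod)" and u: "u \<in> mcarrier M"
  shows "of_int n * u \<in> mcarrier M \<and> act M (of_int n * u) a = of_int n * act M u a"
proof (induction n rule: int_induct[of _ 0])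
  case base
  then show ?case by (simp add: right_moduleD[OF M] act_zero_left[OF M])
next
  case (step1 i)
  then show ?case using u by (simp add: distrib_right right_moduleD[OF M])
next
  case (step2 i)
  then show ?case using u by (simp add: left_diff_distrib right_module_diff[OF M] act_diff_left[OF M])
qed

lemma pi_sum_in_R1: "pi_sum r \<in> R1.ideal"
  using range_pi_sum R1_ideal by blast

lemma pi_power_in_R1: "(zeta - 1) ^ idx i \<in> R1.ideal"
proof -
  obtain k where k: "idx i = Suc k" using idx_range[of i] by (cases "idx i") auto
  show ?thesis unfolding R1_ideal k using Z_zeta_pi by auto
qed

text \<open>The definite description in \<open>lam\<close> denotes because coordinates exist by
  \<open>range_pi_sum\<close> and are unique by \<open>pi_sum_inj\<close>.\<close>

lemma lam: "act cyc_module ((zeta - 1) ^ idx i) a = pi_sum (lam a $ i)"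
proof -
  have "\<exists>r. act cyc_module ((zeta - 1) ^ idx i) a = pi_sum r" for i
    using right_moduleD(4)[OF right_module_cyc, of "(zeta - 1) ^ idx i" a] pi_power_in_R1[of i]
      range_pi_sum R1_ideal by (auto simp: mcarrier_cyc image_iff)
  then obtain f where f: "\<And>i. act cyc_module ((zeta - 1) ^ idx i) a = pi_sum (f i)" by metis
  have "\<exists>!A :: int ^ 6 ^ 6. \<forall>i. act cyc_module ((zeta - 1) ^ idx i) a = pi_sum (A $ i)"
  proof (rule ex1I[of _ "\<chi> i. f i"])
    fix A :: "int ^ 6 ^ 6" assume "\<forall>i. act cyc_module ((zeta - 1) ^ idx i) a = pi_sum (A $ i)"
    then show "A = (\<chi> i. f i)" using f pi_sum_inj by (simp add: vec_eq_iff inj_eq)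
  qed (simp add: f)
  then show ?thesis
    using theI'[of "\<lambda>A. \<forall>i. act cyc_module ((zeta - 1) ^ idx i) a = pi_sum (A $ i)"]
    unfolding lam_def pi_sum_def[symmetric] by blast
qed

lemma pi_sum_lam: "pi_sum (r v* lam a) = act cyc_module (pi_sum r) a"
proof -
  note int = act_of_int_mult[OF right_module_cyc, unfolded mcarrier_cyc, OF pi_power_in_R1]
  have "act cyc_module (pi_sum r) a = (\<Sum>i\<in>UNIV. of_int (r $ i) * pi_sum (lam a $ i))"
    unfolding pi_sum_def[of r] using int
    by (subst act_sum_left[OF right_module_cyc]) (simp_all add: mcarrier_cyc lam)
  also have "\<dots> = (\<Sum>i\<in>UNIV. \<Sum>j\<in>UNIV. of_int (lam a $ i $ j * r $ i) * (zeta - 1) ^ idx j)"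
    by (simp add: pi_sum_def sum_distrib_left mult_ac)
  also have "\<dots> = pi_sum (r v* lam a)"
    by (subst sum.swap) (simp add: pi_sum_def vector_matrix_mult_def sum_distrib_left sum_distrib_right mult_ac)
  finally show ?thesis by simp
qed

text \<open>Only the first coordinate of the second row is constrained. All other terms of
  \<open>pi_sum r\<close> lie in the ideal of \<open>(zeta - 1) ^ 2\<close>, and the first lies
  there exactly when \<open>zeta - 1\<close> divides its coefficient, that is, when 7 does.\<close>

lemma mcarrier_row_module_2: "r \<in> mcarrier (row_module 2) \<longleftrightarrow> pi_sum r \<in> R2.ideal"
proof -
  obtain c where c: "r = (\<chi> j. c (idx j))" by (rule vec_idx)
  obtain k1 k2 where k: "idx k1 = 1" "idx k2 = 2"
  proof -
    have "1 \<in> range idx" "2 \<in> range idx" by (simp_all add: bij_betw_imp_surj_on[OF idx_bij])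
    then show thesis using that by (metis rangeE)
  qed
  have k': "i < k2 \<longleftrightarrow> i = k1" "idx i = 2 \<longleftrightarrow> i = k2" for i
    using idx_less_iff[of i k2] idx_range[of i] k injD[OF idx_inj, of i k1] injD[OF idx_inj, of i k2] by auto
  have "r \<in> mcarrier (row_module 2) \<longleftrightarrow> 7 dvd r $ k1"
  proof
    assume "r \<in> mcarrier (row_module 2)"
    then show "7 dvd r $ k1" using k'(1)[of k1] by (auto simp: row_module_def T6_def k')
  next
    assume 7: "7 dvd r $ k1"
    define A :: "int ^ 6 ^ 6" where "A = (\<chi> i. if i = k2 then r else 0)"
    have "A \<in> T6" using 7 by (auto simp: T6_def A_def k')
    moreover have "r = A $ k2" by (simp add: A_def)
    ultimately show "r \<in> mcarrier (row_module 2)" using k by (auto simp: row_module_def)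
  qed
  also have "\<dots> \<longleftrightarrow> 7 dvd c 1" using k by (simp add: c)
  also have "\<dots> \<longleftrightarrow> pi_sum r \<in> R2.ideal"
  proof -
    define z where "z = (\<Sum>k<5. of_int (c (Suc (Suc k))) * (zeta - 1) ^ k)"
    have z: "z \<in> Z_zeta"
      unfolding z_def by (intro Z_zeta_sum Z_zeta_mult Z_zeta_of_int Z_zeta_power Z_zeta_pi)
    have r: "pi_sum r = (zeta - 1) * (of_int (c 1) + (zeta - 1) * z)"
      unfolding c pi_sum_idx z_def
      by (simp add: sum.lessThan_Suc_shift[of _ 5, simplified] sum_distrib_left mult_ac)
    show ?thesis
    proof
      assume "7 dvd c 1"
      then obtain d where "c 1 = 7 * d" by blast
      then have "of_int (c 1) = (zeta - 1) * ((zeta - 1) ^ 5 * ipoly zeta [:3, 3, 0, -4, -6, -4:] * of_int d)"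
        using seven_eq_pi_power by (simp add: power_Suc[of _ 5, simplified] mult_ac del: ipoly_pCons)
      then have "pi_sum r = (zeta - 1) ^ 2 *
          ((zeta - 1) ^ 5 * ipoly zeta [:3, 3, 0, -4, -6, -4:] * of_int d + z)"
        unfolding r by (simp only: power2_eq_square distrib_left mult.assoc)
      moreover have "(zeta - 1) ^ 5 * ipoly zeta [:3, 3, 0, -4, -6, -4:] * of_int d + z \<in> Z_zeta"
        by (intro Z_zeta_add Z_zeta_mult Z_zeta_of_int Z_zeta_power Z_zeta_pi z ipoly_in_Z_zeta)
      ultimately show "pi_sum r \<in> R2.ideal" unfolding R2_ideal by (rule image_eqI)
    next
      assume "pi_sum r \<in> R2.ideal"
      then obtain z' where z': "z' \<in> Z_zeta" "pi_sum r = (zeta - 1) * ((zeta - 1) * z')"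
        unfolding R2_ideal by (auto simp: power2_eq_square mult.assoc)
      then have "of_int (c 1) + (zeta - 1) * z = (zeta - 1) * z'"
        using zeta_neq_1 unfolding r mult_cancel_left by simp
      then have "of_int (c 1) = (zeta - 1) * (z' - z)" by (simp add: algebra_simps)
      then show "7 dvd c 1" by (rule pi_dvd_int) (intro Z_zeta_diff z z'(1))
    qed
  qed
  finally show ?thesis .
qed

lemma right_module_row_module_2: "right_module (row_module 2)"
proof (rule right_module_inj_transfer[where f = pi_sum and N = cyc_module])
  have uminus: "pi_sum (- r) = - pi_sum r" for r
    using pi_sum_add[of r "- r"] by (simp add: pi_sum_zero minus_unique)
  show "- r \<in> mcarrier (row_module 2)" if "r \<in> mcarrier (row_module 2)" for r
    using that by (simp add: mcarrier_row_module_2 uminus R2.ideal_uminus)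
  show "act (row_module 2) r a \<in> mcarrier (row_module 2)" if "r \<in> mcarrier (row_module 2)" for r a
    using that unfolding mcarrier_row_module_2 by (simp add: row_module_def pi_sum_lam act_cyc_in_R2)
qed (auto simp: right_module_cyc mcarrier_row_module_2 mcarrier_cyc pi_sum_in_R1 pi_sum_zero
    pi_sum_add R2.ideal_zero R2.ideal_add inj_on_subset[OF pi_sum_inj] row_module_def[of 2, THEN arg_cong, of act]
    pi_sum_lam)

text \<open>\<open>pi_sum\<close> identifies the row module with the ideal generated by
  \<open>w0^2\<close>, and \<open>R2.model\<close> identifies that ideal with l\<Lambda>.\<close>

lemma row_module_2_isomorphic: "module_isomorphic (row_module 2) (right_ideal elt_l)"
proof -
  define N where "N = cyc_module\<lparr>mcarrier := R2.ideal\<rparr>"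
  have N: "mcarrier N = R2.ideal" "act N = act cyc_module" by (simp_all add: N_def)
  have rN: "right_module N"
    using R2_subset_R1
    by (intro right_moduleI)
      (auto simp: N R2.ideal_zero R2.ideal_add R2.ideal_uminus act_cyc_in_R2 subset_iff
        right_moduleD[OF right_module_cyc, unfolded mcarrier_cyc])
  have "module_hom N (right_ideal elt_l) R2.model"
  proof (rule module_hom_generators[OF rN right_module_right_ideal])
    fix v assume v: "v \<in> mcarrier N"
    then show "R2.model v \<in> mcarrier (right_ideal elt_l)"
      using bij_betw_imp_surj_on[OF R2.model_bij] by (auto simp: N)
    show "R2.model (act N v gen_x) = act (right_ideal elt_l) (R2.model v) gen_x"
      using v R2_subset_R1 by (auto simp: N act_cyc_x R2.model_mult_zeta)
    obtain p where p: "v = w0 ^ 2 * ipoly zeta p" using v unfolding N by (rule R2.ideal_cases)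
    show "R2.model (act N v gen_y) = act (right_ideal elt_l) (R2.model v) gen_y"
      by (simp add: p N act_cyc_y_R2 R2.model_twisted del: ipoly_pCons)
  qed (simp add: N R2.model_add)
  then have N_iso: "module_isomorphic N (right_ideal elt_l)"
    unfolding module_isomorphic_def using R2.model_bij by (auto simp: N)
  have "pi_sum ` mcarrier (row_module 2) = R2.ideal"
  proof (intro subset_antisym subsetI)
    fix v assume v: "v \<in> R2.ideal"
    then have "v \<in> range pi_sum" using R2_subset_R1 R1_ideal range_pi_sum by blast
    then show "v \<in> pi_sum ` mcarrier (row_module 2)" using v mcarrier_row_module_2 by blast
  qed (auto simp: mcarrier_row_module_2)
  then have "module_isomorphic (row_module 2) N"
    unfolding module_isomorphic_def
    by (intro exI[of _ pi_sum] conjI module_homI)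
      (auto simp: N mcarrier_row_module_2 pi_sum_add row_module_def pi_sum_lam bij_betw_def
        intro: inj_on_subset[OF pi_sum_inj])
  then show ?thesis using N_iso by (rule module_isomorphic_trans)
qed

subsection \<open>The resolution\<close>

lemma elt_r_eq: "elt_r = - gen_x * sum_y * eval_terms w_terms"
  by (simp add: elt_r_def r_terms_def eval_mult_terms sum_y_terms)

text \<open>\<open>r\<close> is a left multiple of \<open>sum_y w\<close>, which equals
  \<open>sum_y r\<close>. Since \<open>sum_y\<close> kills \<open>y - 1\<close>, this makes the sum
  of r\<Lambda> and (y - 1)\<Lambda> direct.\<close>

lemma sum_y_mult_elt_r_eq_0: "sum_y * (elt_r * a) = 0 \<Longrightarrow> elt_r * a = 0"
proof -
  assume "sum_y * (elt_r * a) = 0"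
  then have "sum_y * eval_terms w_terms * a = 0"
    by (simp add: sum_y_mult_elt_r flip: mult.assoc)
  then show "elt_r * a = 0" by (simp add: elt_r_eq mult.assoc)
qed

lemma sum_y_gen_y_minus_one: "sum_y * (gen_y - 1) = 0" "(gen_y - 1) * sum_y = 0"
  unfolding sum_y_terms terms_gen terms_diff eval_mult_terms[symmetric]
  by (rule zero_terms, simp add: terms_defs upt_rec)+

lemma augmentation_diff: "augmentation (a - b) = augmentation a - augmentation b"
  using augmentation_add[of a "- b"] by (simp add: augmentation_uminus)

lemma augmentation_ideal_generators: "\<exists>a b. c - of_int (augmentation c) = elt_r * a + (gen_y - 1) * b"
proof (induction c rule: Lam_induct)
  case one
  then show ?case by (intro exI[of _ 0]) (simp flip: single_one)
next
  case x
  \<comment> \<open>The exponent 3 completes \<open>x^4\<close> in \<open>w\<close> to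
    \<open>x^7 = 1\<close>, so \<open>sum_y r x^3 = sum_y (x - 1)\<close>.\<close>
  have "sum_y * (gen_x - 1 - elt_r * gen_x ^ 3) = sum_y * ((gen_x - 1) - eval_terms w_terms * gen_x ^ 3)"
    by (simp add: right_diff_distrib sum_y_mult_elt_r flip: mult.assoc)
  also have "eval_terms w_terms * gen_x ^ 3 = gen_x ^ 8 - gen_x ^ 7"
    by (simp add: w_terms_def left_diff_distrib flip: power_add)
  also have "\<dots> = gen_x - 1"
    using gen_x_mod[of 8] by (simp add: gen_x_7)
  finally have "sum_y * (gen_x - 1 - elt_r * gen_x ^ 3) = 0" by simp
  then obtain b where "gen_x - 1 - elt_r * gen_x ^ 3 = (gen_y - 1) * b"
    using annihilator_sum_y by blast
  moreover have "augmentation gen_x = 1" by (simp add: gen_x_def)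
  ultimately show ?case by (metis diff_eq_eq add.commute of_int_1)
next
  case y
  have "augmentation gen_y = 1" by (simp add: gen_y_def)
  then show ?case by (intro exI[of _ 0] exI[of _ 1]) simp
next
  case (add c d)
  then obtain a b a' b' where c: "c - of_int (augmentation c) = elt_r * a + (gen_y - 1) * b"
    and d: "d - of_int (augmentation d) = elt_r * a' + (gen_y - 1) * b'" by blast
  have "c + d - of_int (augmentation (c + d)) =
      (c - of_int (augmentation c)) + (d - of_int (augmentation d))"
    by (simp add: augmentation_add)
  also have "\<dots> = elt_r * (a + a') + (gen_y - 1) * (b + b')"
    unfolding c d by (simp only: distrib_left add_ac)
  finally show ?case by blast
next
  case (uminus c)
  then obtain a b where c: "c - of_int (augmentation c) = elt_r * a + (gen_y - 1) * b" by blast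
  have "- c - of_int (augmentation (- c)) = - (c - of_int (augmentation c))"
    by (simp add: augmentation_uminus)
  also have "\<dots> = elt_r * (- a) + (gen_y - 1) * (- b)"
    unfolding c by (simp only: minus_add_distrib mult_minus_right)
  finally show ?case by blast
next
  case (mult c d)
  then obtain a b a' b' where c: "c - of_int (augmentation c) = elt_r * a + (gen_y - 1) * b"
    and d: "d - of_int (augmentation d) = elt_r * a' + (gen_y - 1) * b'" by blast
  let ?n = "augmentation c" and ?m = "augmentation d"
  have "of_int (augmentation (c * d)) = of_int ?m * (of_int ?n :: Lam)"
    by (simp add: augmentation_mult mult.commute flip: of_int_mult)
  then have "c * d - of_int (augmentation (c * d)) = (c - of_int ?n) * d + (d - of_int ?m) * of_int ?n"
    by (simp only: left_diff_distrib mult_of_int_commute[of ?n d]) simp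
  also have "\<dots> = elt_r * (a * d + a' * of_int (augmentation c)) +
      (gen_y - 1) * (b * d + b' * of_int (augmentation c))"
    unfolding c d by (simp only: distrib_left distrib_right mult.assoc add_ac)
  finally show ?case by blast
qed

lemma augmentation_eq_0_iff:
  "augmentation c = 0 \<longleftrightarrow> (\<exists>a b. c = elt_r * a + (gen_y - 1) * b)"
proof
  assume "\<exists>a b. c = elt_r * a + (gen_y - 1) * b"
  moreover have "augmentation (eval_terms w_terms) = 0"
    by (simp add: w_terms_def augmentation_diff gen_x_power)
  moreover have "augmentation (gen_y - 1) = 0"
    by (simp add: augmentation_diff gen_y_def flip: single_one)
  ultimately show "augmentation c = 0"
    by (auto simp: augmentation_add augmentation_diff augmentation_mult elt_r_eq)
qed (use augmentation_ideal_generators[of c] in simp)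

text \<open>Modulo g\<Lambda> the letter \<open>y\<close> becomes \<open>- (1 + x)\<close>, after
  polynomials in \<open>x\<close> have been moved to its right. The arbitrary \<open>q\<close> lets
  the second factor of a product act on the representative found for the first.\<close>

lemma elt_g_cosets: "\<exists>p b. ipoly gen_x q * a = ipoly gen_x p + elt_g * b"
proof (induction a arbitrary: q rule: Lam_induct)
  case one
  then show ?case by (intro exI[of _ q] exI[of _ 0]) simp
next
  case x
  show ?case by (intro exI[of _ "q * X_power 1"] exI[of _ 0]) (simp add: ipoly_mult)
next
  case y
  obtain s where s: "gen_y + 1 + gen_x = elt_g * s" using gen_y_plus_in_elt_g by metis
  let ?q = "q \<circ>\<^sub>p X_power 5"
  have "ipoly gen_x q * gen_y = (- 1 - gen_x) * ipoly gen_x ?q + (gen_y + 1 + gen_x) * ipoly gen_x ?q"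
    unfolding ipoly_gen_x_mult_gen_y by (simp flip: distrib_right)
  also have "\<dots> = ipoly gen_x ([:-1, -1:] * ?q) + elt_g * (s * ipoly gen_x ?q)"
    unfolding s ipoly_mult by (simp add: mult.assoc)
  finally show ?case by blast
next
  case (add a b)
  then obtain p c p' c' where "ipoly gen_x q * a = ipoly gen_x p + elt_g * c"
    "ipoly gen_x q * b = ipoly gen_x p' + elt_g * c'" by blast
  then have "ipoly gen_x q * (a + b) = ipoly gen_x (p + p') + elt_g * (c + c')"
    by (simp add: ipoly_add distrib_left)
  then show ?case by blast
next
  case (uminus a)
  then obtain p c where "ipoly gen_x q * a = ipoly gen_x p + elt_g * c" by blast
  then have "ipoly gen_x q * (- a) = ipoly gen_x (- p) + elt_g * (- c)"
    by (simp add: ipoly_uminus)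
  then show ?case by blast
next
  case (mult a b)
  obtain p c where "ipoly gen_x q * a = ipoly gen_x p + elt_g * c" using mult.IH(1) by blast
  moreover obtain p' c' where "ipoly gen_x p * b = ipoly gen_x p' + elt_g * c'" using mult.IH(2) by blast
  ultimately have "ipoly gen_x q * (a * b) = ipoly gen_x p' + elt_g * (c' + c * b)"
    by (simp add: distrib_left distrib_right flip: mult.assoc)
  then show ?case by blast
qed

text \<open>A polynomial representative killed by \<open>r\<close> vanishes at \<zeta> by
  \<open>theta\<close>, hence is a multiple of \<open>sum_x\<close>, which lies in
  g\<Lambda>.\<close>

lemma annihilator_elt_r:
  assumes "elt_r * a = 0"
  shows "\<exists>b. a = elt_g * b"
proof -
  obtain p b where a: "a = ipoly gen_x p + elt_g * b" using elt_g_cosets[of 1 a] by auto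
  have "elt_r * ipoly gen_x p = 0"
    using assms by (simp add: a distrib_left elt_r_mult_elt_g flip: mult.assoc)
  then have "ipoly zeta p = 0"
    using theta_mult_ipoly[of elt_r p] theta_elt_r by simp
  then have "cyc7 dvd p" by (rule cyc7_dvd)
  then obtain k where p: "p = cyc7 * k" by (elim dvdE)
  obtain s where s: "sum_x = elt_g * s" using sum_x_in_elt_g by metis
  have "a = elt_g * (s * ipoly gen_x k + b)"
    by (simp add: a p s ipoly_mult ipoly_cyc7_gen_x distrib_left mult.assoc)
  then show ?thesis ..
qed

text \<open>Inverting \<open>g\<close> up to 7 under \<open>sum_x\<close> gives
  \<open>7 sum_x a = 0\<close>. Torsion-freeness then places \<open>a\<close> in (x - 1)\<Lambda>,
  where \<open>1 - k g\<close> fixes \<open>a\<close> and maps it into l\<Lambda>.\<close>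

lemma annihilator_elt_g:
  assumes "elt_g * a = 0"
  shows "\<exists>b. a = elt_l * b"
proof -
  obtain f where f: "f * (sum_x * elt_g) = of_int 7 * sum_x" using sum_x_elt_g_relation by blast
  have "of_int 7 * (sum_x * a) = f * (sum_x * elt_g) * a" by (simp only: f mult.assoc)
  also have "\<dots> = f * (sum_x * (elt_g * a))" by (simp only: mult.assoc)
  also have "\<dots> = 0" by (simp only: assms mult_zero_right)
  finally have "sum_x * a = 0" by (rule group_ring_torsion_free) simp
  then obtain b where b: "a = (gen_x - 1) * b" using annihilator_sum_x by blast
  obtain k m where km: "(1 - k * elt_g) * (gen_x - 1) = elt_l * m" using elt_g_elt_l_relation by blast
  have "a = (1 - k * elt_g) * a" using assms by (simp add: left_diff_distrib mult.assoc)
  also have "\<dots> = elt_l * (m * b)" unfolding b by (simp only: km flip: mult.assoc)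
  finally show ?thesis by blast
qed

section \<open>The boundary maps, exactness and the kernel\<close>

abbreviation (input) "Lam_free n \<equiv> free_module n :: (Lam, nat \<Rightarrow>\<^sub>0 Lam) rmod"

definition bd0 :: "(nat \<Rightarrow>\<^sub>0 Lam) \<Rightarrow> int" where
  "bd0 u = augmentation (Poly_Mapping.lookup u 0)"

definition bd1 :: "(nat \<Rightarrow>\<^sub>0 Lam) \<Rightarrow> nat \<Rightarrow>\<^sub>0 Lam" where
  "bd1 u = Poly_Mapping.single 0
     (elt_r * Poly_Mapping.lookup u 0 + (gen_y - 1) * Poly_Mapping.lookup u 1)"

definition pair :: "Lam \<Rightarrow> Lam \<Rightarrow> nat \<Rightarrow>\<^sub>0 Lam" where
  "pair a b = Poly_Mapping.single 0 a + Poly_Mapping.single 1 b"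

definition bd2 :: "(nat \<Rightarrow>\<^sub>0 Lam) \<Rightarrow> nat \<Rightarrow>\<^sub>0 Lam" where
  "bd2 u = pair (elt_g * Poly_Mapping.lookup u 0) (sum_y * Poly_Mapping.lookup u 1)"

lemma lookup_pair: "Poly_Mapping.lookup (pair a b) i = (if i = 0 then a else if i = 1 then b else 0)"
  by (simp add: pair_def lookup_add lookup_single when_def)

lemma pair_in_Lam_free_2: "pair a b \<in> mcarrier (Lam_free 2)"
  by (simp add: mcarrier_free_module lookup_pair)

lemma Lam_free_2_cases:
  assumes "u \<in> mcarrier (Lam_free 2)"
  obtains a b where "u = pair a b"
proof
  have "i = 0 \<or> i = 1 \<or> i \<ge> 2" for i :: nat by auto
  then show "u = pair (Poly_Mapping.lookup u 0) (Poly_Mapping.lookup u 1)"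
    using assms by (intro poly_mapping_eqI) (auto simp: mcarrier_free_module lookup_pair)
qed

lemma Lam_free_1_cases:
  assumes "u \<in> mcarrier (Lam_free 1)"
  obtains a where "u = Poly_Mapping.single 0 a"
proof
  show "u = Poly_Mapping.single 0 (Poly_Mapping.lookup u 0)"
    using assms by (intro poly_mapping_eqI) (auto simp: mcarrier_free_module lookup_single when_def)
qed

lemma bd_pair:
  "bd2 (pair a b) = pair (elt_g * a) (sum_y * b)"
  "bd1 (pair a b) = Poly_Mapping.single 0 (elt_r * a + (gen_y - 1) * b)"
  by (simp_all add: bd2_def bd1_def lookup_pair)

lemma pair_eq_0_iff: "pair a b = 0 \<longleftrightarrow> a = 0 \<and> b = 0"
  by (metis lookup_pair lookup_zero pair_def single_zero add_0 zero_neq_one)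

lemma single_eq_0_iff: "Poly_Mapping.single i a = 0 \<longleftrightarrow> a = 0"
  by (metis lookup_single_eq lookup_zero single_zero)

lemma right_module_trivial: "right_module trivial_module"
  by (rule right_moduleI)
    (simp_all add: trivial_module_def augmentation_def[symmetric] augmentation_add augmentation_mult
      algebra_simps flip: single_one)

lemma hom_bd0: "module_hom (Lam_free 1) trivial_module bd0"
  by (rule module_homI)
    (simp_all add: bd0_def trivial_module_def lookup_add augmentation_add augmentation_mult
      augmentation_def[symmetric])

lemma hom_bd1: "module_hom (Lam_free 2) (Lam_free 1) bd1"
  by (rule module_homI)
    (auto simp: bd1_def mcarrier_free_module lookup_add lookup_single when_def distrib_left distrib_right mult.assoc
      intro!: poly_mapping_eqI)

lemma hom_bd2: "module_hom (Lam_free 2) (Lam_free 2) bd2"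
  by (rule module_homI)
    (auto simp: bd2_def mcarrier_free_module lookup_add lookup_pair distrib_left mult.assoc
      intro!: poly_mapping_eqI)

definition ker_bd2 :: "(Lam, nat \<Rightarrow>\<^sub>0 Lam) rmod" where "ker_bd2 = kernel_module (Lam_free 2) bd2"

lemma resolution: "exact_free3 ker_bd2 id (Lam_free 2) bd2 (Lam_free 2) bd1 (Lam_free 1) bd0 trivial_module"
  unfolding exact_free3_def
proof (intro conjI)
  show "right_module ker_bd2"
    unfolding ker_bd2_def by (intro right_module_kernel[OF hom_bd2] right_module_free_module)
  show "module_hom ker_bd2 (Lam_free 2) id"
    by (rule module_homI) (auto simp: ker_bd2_def module_kernel_def)
  show "id ` mcarrier ker_bd2 = module_kernel (Lam_free 2) bd2" by (simp add: ker_bd2_def)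
  show "bd2 ` mcarrier (Lam_free 2) = module_kernel (Lam_free 2) bd1"
  proof (intro subset_antisym subsetI)
    fix v assume "v \<in> bd2 ` mcarrier (Lam_free 2)"
    then obtain u where u: "u \<in> mcarrier (Lam_free 2)" "v = bd2 u" by blast
    obtain a b where "u = pair a b" using u(1) by (rule Lam_free_2_cases)
    then have v: "v = pair (elt_g * a) (sum_y * b)" using u(2) by (simp add: bd_pair)
    have "elt_r * (elt_g * a) + (gen_y - 1) * (sum_y * b) = 0"
      by (simp add: elt_r_mult_elt_g sum_y_gen_y_minus_one flip: mult.assoc)
    then show "v \<in> module_kernel (Lam_free 2) bd1"
      by (simp add: v module_kernel_def pair_in_Lam_free_2 bd_pair single_eq_0_iff)
  next
    fix v assume "v \<in> module_kernel (Lam_free 2) bd1"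
    then have "v \<in> mcarrier (Lam_free 2)" and 0: "bd1 v = 0" by (auto simp: module_kernel_def)
    then obtain a b where v: "v = pair a b" by (elim Lam_free_2_cases)
    then have ab: "elt_r * a + (gen_y - 1) * b = 0" using 0 by (simp add: bd_pair single_eq_0_iff)
    \<comment> \<open>Multiplication by \<open>sum_y\<close> removes the second summand and is
      injective on the first, so the two summands vanish separately.\<close>
    then have "sum_y * (elt_r * a) + sum_y * (gen_y - 1) * b = 0"
      by (metis distrib_left mult.assoc mult_zero_right)
    then have ra: "elt_r * a = 0"
      by (intro sum_y_mult_elt_r_eq_0) (simp add: sum_y_gen_y_minus_one)
    then obtain a' where "a = elt_g * a'" using annihilator_elt_r by blast
    moreover obtain b' where "b = sum_y * b'" using ab ra annihilator_y_minus_one by auto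
    ultimately have "v = bd2 (pair a' b')" by (simp add: v bd_pair)
    then show "v \<in> bd2 ` mcarrier (Lam_free 2)" using pair_in_Lam_free_2 by blast
  qed
  show "bd1 ` mcarrier (Lam_free 2) = module_kernel (Lam_free 1) bd0"
  proof (intro subset_antisym subsetI)
    fix v assume v: "v \<in> bd1 ` mcarrier (Lam_free 2)"
    then obtain u where u: "u \<in> mcarrier (Lam_free 2)" "v = bd1 u" by blast
    obtain a b where "u = pair a b" using u(1) by (rule Lam_free_2_cases)
    then have "v = Poly_Mapping.single 0 (elt_r * a + (gen_y - 1) * b)" using u(2) by (simp add: bd_pair)
    then show "v \<in> module_kernel (Lam_free 1) bd0"
      using v module_homD(1)[OF hom_bd1] augmentation_eq_0_iff
      by (auto simp: module_kernel_def bd0_def)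
  next
    fix v assume v: "v \<in> module_kernel (Lam_free 1) bd0"
    then have "v \<in> mcarrier (Lam_free 1)" and "augmentation (Poly_Mapping.lookup v 0) = 0"
      by (auto simp: module_kernel_def bd0_def)
    moreover then obtain a b where "Poly_Mapping.lookup v 0 = elt_r * a + (gen_y - 1) * b"
      using augmentation_eq_0_iff by blast
    ultimately have "v = bd1 (pair a b)" by (elim Lam_free_1_cases) (simp add: bd_pair)
    then show "v \<in> bd1 ` mcarrier (Lam_free 2)" using pair_in_Lam_free_2 by blast
  qed
  have "n \<in> bd0 ` mcarrier (Lam_free 1)" for n
  proof (rule image_eqI)
    show "n = bd0 (Poly_Mapping.single 0 (Poly_Mapping.single 0 n))" by (simp add: bd0_def)
  qed (auto simp: mcarrier_free_module lookup_single)
  then show "bd0 ` mcarrier (Lam_free 1) = mcarrier trivial_module"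
    by (auto simp: trivial_module_def)
qed (fact fg_free_free_module right_module_trivial hom_bd0 hom_bd1 hom_bd2 inj_on_id)+

lemma ker_bd2_isomorphic: "module_isomorphic ker_bd2 (direct_sum (row_module 2) (right_ideal (gen_y - 1)))"
proof -
  have ker_bd2: "pair a b \<in> mcarrier ker_bd2 \<longleftrightarrow> a \<in> range ((*) elt_l) \<and> b \<in> range ((*) (gen_y - 1))" for a b
  proof -
    have "elt_g * a = 0 \<longleftrightarrow> a \<in> range ((*) elt_l)"
      using annihilator_elt_g[of a] by (auto simp: elt_g_mult_elt_l simp flip: mult.assoc)
    moreover have "sum_y * b = 0 \<longleftrightarrow> b \<in> range ((*) (gen_y - 1))"
      using annihilator_sum_y[of b] by (auto simp: sum_y_gen_y_minus_one simp flip: mult.assoc)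
    ultimately show ?thesis
      by (simp add: ker_bd2_def module_kernel_def pair_in_Lam_free_2 bd_pair pair_eq_0_iff)
  qed
  have ker_bd2_cases: "\<exists>a b. u = pair a b" if "u \<in> mcarrier ker_bd2" for u
    using that Lam_free_2_cases by (auto simp: ker_bd2_def module_kernel_def) metis
  have act: "act ker_bd2 = act (Lam_free 2)" by (simp add: ker_bd2_def)
  have "module_isomorphic ker_bd2 (direct_sum (right_ideal elt_l) (right_ideal (gen_y - 1)))"
  proof (rule module_isomorphicI[where f = "\<lambda>u. (Poly_Mapping.lookup u 0, Poly_Mapping.lookup u 1)"
        and g = "\<lambda>(a, b). pair a b"])
    show "module_hom ker_bd2 (direct_sum (right_ideal elt_l) (right_ideal (gen_y - 1)))
        (\<lambda>u. (Poly_Mapping.lookup u 0, Poly_Mapping.lookup u 1))"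
    proof (rule module_homI)
      fix u assume "u \<in> mcarrier ker_bd2"
      then show "(Poly_Mapping.lookup u 0, Poly_Mapping.lookup u 1) \<in>
          mcarrier (direct_sum (right_ideal elt_l) (right_ideal (gen_y - 1)))"
        using ker_bd2_cases ker_bd2 by (fastforce simp: lookup_pair)
    qed (simp_all add: act lookup_add)
  qed (use ker_bd2 ker_bd2_cases in \<open>auto simp: lookup_pair dest!: ker_bd2_cases\<close>)
  also have "module_isomorphic \<dots> (direct_sum (row_module 2) (right_ideal (gen_y - 1)))"
    by (intro module_isomorphic_direct_sum module_isomorphic_refl
        module_isomorphic_sym[OF row_module_2_isomorphic right_module_row_module_2])
  finally show ?thesis .
qed

theorem theorem13:
  shows "(third_syzygy trivial_module :: (Lam, 'm::ab_group_add) rmod set) =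
           stable_module (direct_sum (row_module 2) (right_ideal (gen_y - 1)))"
  by (rule third_syzygy_eq_stable_module[OF resolution ker_bd2_isomorphic])
    (intro right_module_direct_sum right_module_row_module_2 right_module_right_ideal)

end
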